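(* There is an algorithm that, given an arena (a directed graph $G$ with root $r$, a multiset of terminals $(t_1,\dots,t_\ell)$ with associated player set $\Pi=\{1,\dots,\ell\}$, and cost functions $c_e$, $e\in E(G)$), finds the minimum value of the potential $\Phi(s)$ over all strategy profiles $s$ in time $3^{|\Pi|}\cdot |G|^{O(1)}$. Moreover, within the same time complexity the algorithm can also construct a corresponding optimal strategy profile $s^*$, i.e., one with $\Phi(s)\ge\Phi(s^* )$ for every strategy profile $s$.
   Context: An arena consists of a finite directed graph $G=(V,E)$ with a root vertex $r\in V$, a multiset of target vertices (terminals) $t_1,\dots,t_\ell\in V$ (repetitions allowed), and for every arc $e\in E$ a cost function $c_e:\mathbb{Z}^+\to\mathbb{R}^+\cup\{0\}$ such that $c_e(h)\ge c_e(h+1)$ for all $h\ge 1$. With each terminal $t_i$ a player $i$ is associated; $\Pi$ is the set of players, $|\Pi|=\ell$. A strategy of player $i$ is a directed path $P_i$ from $r$ to $t_i$ in $G$. A strategy profile is a tuple $s=(P_1,\dots,P_\ell)$ of strategies, one for each player. Let $n_e(s)$ be the number of players whose path in $s$ contains the arc $e$. The potential of $s$ is $$\Phi(s)=\sum_{e\in\bigcup_{i=1}^{\ell}E(P_i)}\ \sum_{h=1}^{n_e(s)}c_e(h).$$ If no strategy profile exists, the minimum is regarded as $+\infty$ (and there is no profile to construct). Running times are in the unit-cost model: each arithmetic operation on, comparison of, or access to cost values counts as one step, so the number of operations does not depend on the size of the weights. $|G|$ denotes the size of the graph $G$. *)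

theory Defs
  imports "Graph_Theory.Digraph_Component" "HOL-Library.Extended_Real"
begin

section \<open>Arenas\<close>

text \<open>Player \<open>i\<close> is the position \<open>i\<close> of the list \<open>terms\<close>, so a vertex may be the terminal
  of several players. The values \<open>cost e 0\<close> are irrelevant.\<close>

locale arena = fin_digraph G
  for G :: "('v, 'e) pre_digraph" +
  fixes r :: 'v and terms :: "'v list" and cost :: "'e \<Rightarrow> nat \<Rightarrow> real"
  assumes root_in_verts: "r \<in> verts G"
    and terms_in_verts: "set terms \<subseteq> verts G"
    and cost_nonneg: "\<And>e h. e \<in> arcs G \<Longrightarrow> h \<ge> 1 \<Longrightarrow> cost e h \<ge> 0"
    and cost_antimono: "\<And>e h. e \<in> arcs G \<Longrightarrow> h \<ge> 1 \<Longrightarrow> cost e h \<ge> cost e (h + 1)"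
begin

definition profiles :: "'e list list set" where
  "profiles = {s. length s = length terms \<and> (\<forall>i < length terms. apath r (s ! i) (terms ! i))}"

definition players_on :: "'e list list \<Rightarrow> 'e \<Rightarrow> nat" where
  "players_on s e = card {i. i < length s \<and> e \<in> set (s ! i)}"

definition potential :: "'e list list \<Rightarrow> real" where
  "potential s = (\<Sum>e \<in> (\<Union>i<length s. set (s ! i)). \<Sum>h = 1..players_on s e. cost e h)"

definition is_min_potential :: "ereal \<Rightarrow> bool" where
  "is_min_potential v \<longleftrightarrow>
     (if profiles = {} then v = \<infinity>
      else \<exists>s \<in> profiles. v = ereal (potential s) \<and> (\<forall>s' \<in> profiles. potential s' \<ge> potential s))"

definition optimal_profile :: "'e list list \<Rightarrow> bool" where
  "optimal_profile s \<longleftrightarrow> s \<in> profiles \<and> (\<forall>s' \<in> profiles. potential s' \<ge> potential s)"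

end

section \<open>The unit-cost machine\<close>

text \<open>
  Algorithms are programs of a structured random access machine. Its memory consists of arrays of
  natural numbers and arrays of real numbers, addressed by a name and an index (a scalar variable is
  an array used at index 0 only). A program mentions finitely many names. Real numbers
  can only be stored, added, subtracted and compared, and they never flow into natural numbers
  other than through comparisons. The cost functions are read through the oracle expression
  \<open>Cost e h\<close>. Every operation, memory access, oracle access, comparison and control
  decision takes one step.

  To keep the unit-cost assumption honest for the natural numbers, the machine has a
  word bound \<open>W\<close>: it gets stuck as soon as an expression has a natural-number subexpression with
  a value above \<open>W\<close>. Addresses are covered as well.
\<close>

record state =
  nmem :: "string \<Rightarrow> nat \<Rightarrow> nat"
  rmem :: "string \<Rightarrow> nat \<Rightarrow> real"

datatype nop = Plus | Minus | Times | Div | Mod | BitAnd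

datatype nexp = Const nat | NCell string nexp | Op nop nexp nexp

datatype rexp = RCell string nexp | Cost nexp nexp | RPlus rexp rexp | RMinus rexp rexp

datatype bexp = NLess nexp nexp | RLess rexp rexp | BNot bexp | BConj bexp bexp

datatype com =
    Skip
  | NAssign string nexp nexp
  | RAssign string nexp rexp
  | Seq com com
  | IfThen bexp com com
  | While bexp com

fun nop_val :: "nop \<Rightarrow> nat \<Rightarrow> nat \<Rightarrow> nat" where
  "nop_val Plus x y = x + y"
| "nop_val Minus x y = x - y"
| "nop_val Times x y = x * y"
| "nop_val Div x y = x div y"
| "nop_val Mod x y = x mod y"
| "nop_val BitAnd x y = semiring_bit_operations_class.and x y"

fun nval :: "state \<Rightarrow> nexp \<Rightarrow> nat" where
  "nval st (Const k) = k"
| "nval st (NCell x a) = nmem st x (nval st a)"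
| "nval st (Op f a b) = nop_val f (nval st a) (nval st b)"

fun rval :: "(nat \<Rightarrow> nat \<Rightarrow> real) \<Rightarrow> state \<Rightarrow> rexp \<Rightarrow> real" where
  "rval c st (RCell x a) = rmem st x (nval st a)"
| "rval c st (Cost a b) = c (nval st a) (nval st b)"
| "rval c st (RPlus p q) = rval c st p + rval c st q"
| "rval c st (RMinus p q) = rval c st p - rval c st q"

fun bval :: "(nat \<Rightarrow> nat \<Rightarrow> real) \<Rightarrow> state \<Rightarrow> bexp \<Rightarrow> bool" where
  "bval c st (NLess a b) \<longleftrightarrow> nval st a < nval st b"
| "bval c st (RLess p q) \<longleftrightarrow> rval c st p < rval c st q"
| "bval c st (BNot b) \<longleftrightarrow> \<not> bval c st b"
| "bval c st (BConj b b') \<longleftrightarrow> bval c st b \<and> bval c st b'"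

fun nsteps :: "nexp \<Rightarrow> nat" where
  "nsteps (Const k) = 1"
| "nsteps (NCell x a) = 1 + nsteps a"
| "nsteps (Op f a b) = 1 + nsteps a + nsteps b"

fun rsteps :: "rexp \<Rightarrow> nat" where
  "rsteps (RCell x a) = 1 + nsteps a"
| "rsteps (Cost a b) = 1 + nsteps a + nsteps b"
| "rsteps (RPlus p q) = 1 + rsteps p + rsteps q"
| "rsteps (RMinus p q) = 1 + rsteps p + rsteps q"

fun bsteps :: "bexp \<Rightarrow> nat" where
  "bsteps (NLess a b) = 1 + nsteps a + nsteps b"
| "bsteps (RLess p q) = 1 + rsteps p + rsteps q"
| "bsteps (BNot b) = 1 + bsteps b"
| "bsteps (BConj b b') = 1 + bsteps b + bsteps b'"

fun nfits :: "nat \<Rightarrow> state \<Rightarrow> nexp \<Rightarrow> bool" where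
  "nfits W st (Const k) \<longleftrightarrow> k \<le> W"
| "nfits W st (NCell x a) \<longleftrightarrow> nfits W st a \<and> nval st (NCell x a) \<le> W"
| "nfits W st (Op f a b) \<longleftrightarrow> nfits W st a \<and> nfits W st b \<and> nval st (Op f a b) \<le> W"

fun rfits :: "nat \<Rightarrow> state \<Rightarrow> rexp \<Rightarrow> bool" where
  "rfits W st (RCell x a) \<longleftrightarrow> nfits W st a"
| "rfits W st (Cost a b) \<longleftrightarrow> nfits W st a \<and> nfits W st b"
| "rfits W st (RPlus p q) \<longleftrightarrow> rfits W st p \<and> rfits W st q"
| "rfits W st (RMinus p q) \<longleftrightarrow> rfits W st p \<and> rfits W st q"

fun bfits :: "nat \<Rightarrow> state \<Rightarrow> bexp \<Rightarrow> bool" where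
  "bfits W st (NLess a b) \<longleftrightarrow> nfits W st a \<and> nfits W st b"
| "bfits W st (RLess p q) \<longleftrightarrow> rfits W st p \<and> rfits W st q"
| "bfits W st (BNot b) \<longleftrightarrow> bfits W st b"
| "bfits W st (BConj b b') \<longleftrightarrow> bfits W st b \<and> bfits W st b'"

definition nput :: "string \<Rightarrow> nat \<Rightarrow> nat \<Rightarrow> state \<Rightarrow> state" where
  "nput x i v st = st\<lparr>nmem := (nmem st)(x := (nmem st x)(i := v))\<rparr>"

definition rput :: "string \<Rightarrow> nat \<Rightarrow> real \<Rightarrow> state \<Rightarrow> state" where
  "rput x i v st = st\<lparr>rmem := (rmem st)(x := (rmem st x)(i := v))\<rparr>"

text \<open>\<open>exec c W p st t st'\<close>: with cost oracle \<open>c\<close> and word bound \<open>W\<close>, program \<open>p\<close> started in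
  \<open>st\<close> halts in \<open>st'\<close> after exactly \<open>t\<close> steps.\<close>

inductive exec :: "(nat \<Rightarrow> nat \<Rightarrow> real) \<Rightarrow> nat \<Rightarrow> com \<Rightarrow> state \<Rightarrow> nat \<Rightarrow> state \<Rightarrow> bool"
  for c :: "nat \<Rightarrow> nat \<Rightarrow> real" and W :: nat where
  Skip: "exec c W Skip st 1 st"
| NAssign: "nfits W st a \<Longrightarrow> nfits W st b \<Longrightarrow>
    exec c W (NAssign x a b) st (1 + nsteps a + nsteps b) (nput x (nval st a) (nval st b) st)"
| RAssign: "nfits W st a \<Longrightarrow> rfits W st q \<Longrightarrow>
    exec c W (RAssign x a q) st (1 + nsteps a + rsteps q) (rput x (nval st a) (rval c st q) st)"
| Seq: "exec c W p st t st' \<Longrightarrow> exec c W q st' t' st'' \<Longrightarrow> exec c W (Seq p q) st (t + t') st''"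
| IfTrue: "bfits W st b \<Longrightarrow> bval c st b \<Longrightarrow> exec c W p st t st' \<Longrightarrow>
    exec c W (IfThen b p q) st (1 + bsteps b + t) st'"
| IfFalse: "bfits W st b \<Longrightarrow> \<not> bval c st b \<Longrightarrow> exec c W q st t st' \<Longrightarrow>
    exec c W (IfThen b p q) st (1 + bsteps b + t) st'"
| WhileFalse: "bfits W st b \<Longrightarrow> \<not> bval c st b \<Longrightarrow>
    exec c W (While b p) st (1 + bsteps b) st"
| WhileTrue: "bfits W st b \<Longrightarrow> bval c st b \<Longrightarrow> exec c W p st t st' \<Longrightarrow>
    exec c W (While b p) st' t' st'' \<Longrightarrow>
    exec c W (While b p) st (1 + bsteps b + t + t') st''"

inductive_cases exec_SkipE: "exec c W Skip st u st'"
  and exec_NAssignE: "exec c W (NAssign x a b) st u st'"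
  and exec_RAssignE: "exec c W (RAssign x a q) st u st'"
  and exec_SeqE: "exec c W (Seq p q) st u st'"
  and exec_IfE: "exec c W (IfThen b p q) st u st'"
  and exec_WhileE: "exec c W (While b p) st u st'"

lemma exec_deterministic:
  assumes "exec c W p st t st'" "exec c W p st u st''"
  shows "u = t \<and> st'' = st'"
  using assms
proof (induction arbitrary: u st'' rule: exec.induct)
  case (Skip st)
  then show ?case by (elim exec_SkipE) simp
next
  case (NAssign st a b x)
  from NAssign.prems show ?case by (elim exec_NAssignE) simp
next
  case (RAssign st a q x)
  from RAssign.prems show ?case by (elim exec_RAssignE) simp
next
  case (Seq p st t st' q t' st2)
  from Seq.prems show ?case by (elim exec_SeqE) (metis Seq.IH)
next
  case (IfTrue st b p t st' q)
  from IfTrue.prems show ?case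
  proof (elim exec_IfE)
    fix t1
    assume *: "u = Suc (bsteps b + t1)" "exec c W p st t1 st''"
    from *(1) IfTrue.IH[OF *(2)] show ?thesis by simp
  qed (use IfTrue.hyps(2) in simp_all)
next
  case (IfFalse st b q t st' p)
  from IfFalse.prems show ?case
  proof (elim exec_IfE)
    fix t1
    assume *: "u = Suc (bsteps b + t1)" "exec c W q st t1 st''"
    from *(1) IfFalse.IH[OF *(2)] show ?thesis by simp
  qed (use IfFalse.hyps(2) in simp_all)
next
  case (WhileFalse st b p)
  from WhileFalse.prems show ?case by (rule exec_WhileE) (use WhileFalse.hyps(2) in simp_all)
next
  case (WhileTrue st b p t st' t' st2)
  from WhileTrue.prems show ?case
  proof (rule exec_WhileE)
    fix t1 s1 t2
    assume *: "u = Suc (bsteps b + t1 + t2)" "exec c W p st t1 s1" "exec c W (While b p) s1 t2 st''"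
    from WhileTrue.IH(1)[OF *(2)] have "t1 = t" "s1 = st'" by simp_all
    with * WhileTrue.IH(2)[of t2 st''] show ?thesis by simp
  qed (use WhileTrue.hyps(2) in simp)
qed

section \<open>Input and output\<close>

text \<open>A graph is presented to the machine with vertices \<open>0, \<dots>, n - 1\<close> and
  arcs \<open>0, \<dots>, m - 1\<close>, every arc being given by its tail and its head.\<close>

definition numbered :: "(nat, nat) pre_digraph \<Rightarrow> bool" where
  "numbered G \<longleftrightarrow> verts G = {..<card (verts G)} \<and> arcs G = {..<card (arcs G)}"

definition contents :: "nat list \<Rightarrow> nat \<Rightarrow> nat" where
  "contents xs i = (if i < length xs then xs ! i else 0)"

definition input_state :: "(nat, nat) pre_digraph \<Rightarrow> nat \<Rightarrow> nat list \<Rightarrow> state" where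
  "input_state G r terms =
     \<lparr>nmem = (\<lambda>_ _. 0)
        (''n'' := contents [card (verts G)],
         ''m'' := contents [card (arcs G)],
         ''tail'' := contents (map (tail G) [0..<card (arcs G)]),
         ''head'' := contents (map (head G) [0..<card (arcs G)]),
         ''root'' := contents [r],
         ''l'' := contents [length terms],
         ''term'' := contents terms),
      rmem = (\<lambda>_ _. 0)\<rparr>"

text \<open>A zero in \<open>feasible\<close> announces that there is no strategy profile.\<close>

definition output_value :: "state \<Rightarrow> ereal" where
  "output_value st = (if nmem st ''feasible'' 0 = 0 then \<infinity> else ereal (rmem st ''value'' 0))"

text \<open>Row \<open>i\<close> of the two-dimensional array \<open>path\<close>, which has rows of length \<open>n\<close>, holds the
  arcs of the path of player \<open>i\<close>; the number of these arcs is in \<open>len\<close>.\<close>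

definition output_profile :: "nat \<Rightarrow> nat \<Rightarrow> state \<Rightarrow> nat list list" where
  "output_profile n l st =
     map (\<lambda>i. map (\<lambda>j. nmem st ''path'' (i * n + j)) [0..<nmem st ''len'' i]) [0..<l]"

definition graph_size :: "(nat, nat) pre_digraph \<Rightarrow> nat" where
  "graph_size G = card (verts G) + card (arcs G)"

end

theory Submission
  imports Defs "HOL-Library.Nat_Bijection"
begin

text \<open>
  Rerouting one of two players with a common vertex along the initial segment of the other player,
  and vice versa, changes the potential by amounts with a nonpositive sum, since the costs are
  nonincreasing. Hence some optimal profile is tree-like: paths that use a common arc agree up to
  that arc. The potential of such a profile is computed by a dynamic program of Dreyfus--Wagner
  type over player sets \<open>X\<close>, vertices \<open>v\<close> and a bound on the number of arcs before the next split:
  the players in \<open>X\<close> leave \<open>v\<close> either together along an arc \<open>e\<close>, at the price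
  \<open>c\<^sub>e(1) + \<dots> + c\<^sub>e(|X|)\<close>, or they are split into two nonempty groups. Conversely, the walks read
  off from the table have at most the potential of the table entry, because \<open>k \<mapsto> c\<^sub>e(1) + \<dots> + c\<^sub>e(k)\<close>
  is subadditive, and removing cycles from the walks does not increase the potential. There are
  \<open>3 ^ l\<close> pairs of a player set and a subset of it.
\<close>

section \<open>Potentials and tree-like profiles\<close>

text \<open>The time bound has no factor polynomial in the number of players, and as terminals may
  repeat, \<open>l\<close> is not bounded by the size of the graph. So the work per pair of a player
  set and a subset must not depend on \<open>l\<close>: sizes of player sets and prefix sums of the
  costs are tabulated beforehand, and the submasks of \<open>S\<close> are enumerated by
  \<open>Y \<mapsto> and (Y - 1) S\<close>, one constant-time step each. Factors \<open>l\<close>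
  occur only outside the loop over pairs, where \<open>l * 2 ^ l \<le> 2 * 3 ^ l\<close> absorbs
  them. The bound on the number of arcs makes the recursion well-founded: an arc keeps the player
  set, and arcs of cost 0 may form cycles, so neither the set nor the value need decrease along it.
  With the bound, every entry depends on entries of smaller index only. A split can afford to reset
  the bound, since the player set shrinks. The word bound of the machine is the time bound itself,
  so every index, mask and code has to be shown to fit. The numeric step counts in the program
  lemmas are rounded up generously.\<close>

context arena
begin

section \<open>Prefix sums of the costs and the cost of a family of walks\<close>

definition cost_sum :: "'e \<Rightarrow> nat \<Rightarrow> real" where
  "cost_sum e k = (\<Sum>h = 1..k. cost e h)"

definition load :: "(nat \<Rightarrow> 'e list) \<Rightarrow> nat set \<Rightarrow> 'e \<Rightarrow> nat" where
  "load P X e = card {i \<in> X. e \<in> set (P i)}"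

definition family_cost :: "(nat \<Rightarrow> 'e list) \<Rightarrow> nat set \<Rightarrow> real" where
  "family_cost P X = (\<Sum>e \<in> arcs G. cost_sum e (load P X e))"

lemma cost_sum_0 [simp]: "cost_sum e 0 = 0"
  by (simp add: cost_sum_def)

lemma cost_sum_Suc: "cost_sum e (Suc k) = cost_sum e k + cost e (Suc k)"
  by (simp add: cost_sum_def)

lemma cost_sum_mono:
  assumes "e \<in> arcs G" "h \<le> k"
  shows "cost_sum e h \<le> cost_sum e k"
  using assms(2) by (induction k rule: dec_induct) (use cost_nonneg assms(1) in \<open>auto simp: cost_sum_Suc intro: order_trans\<close>)

lemma cost_sum_nonneg: "e \<in> arcs G \<Longrightarrow> 0 \<le> cost_sum e k"
  using cost_sum_mono[of e 0 k] by simp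

lemma cost_mono:
  assumes "e \<in> arcs G" "1 \<le> h" "h \<le> k"
  shows "cost e k \<le> cost e h"
  using assms(3)
proof (induction k rule: dec_induct)
  case (step k)
  then show ?case using cost_antimono[of e k] assms by auto
qed simp

text \<open>The increment at load \<open>h + k + 1\<close> is at most the increment at load
  \<open>k + 1\<close>, because the costs are nonincreasing.\<close>

lemma cost_sum_subadd:
  assumes "e \<in> arcs G"
  shows "cost_sum e (h + k) \<le> cost_sum e h + cost_sum e k"
proof (induction k)
  case (Suc k)
  have "cost e (Suc (h + k)) \<le> cost e (Suc k)" by (rule cost_mono) (use assms in auto)
  then show ?case using Suc by (simp add: cost_sum_Suc)
qed simp

lemma load_mono:
  assumes "finite X" "\<And>i. i \<in> X \<Longrightarrow> e \<in> set (P i) \<Longrightarrow> e \<in> set (Q i)"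
  shows "load P X e \<le> load Q X e"
  unfolding load_def by (rule card_mono) (use assms in auto)

lemma load_Un:
  assumes "finite X" "finite Y" "X \<inter> Y = {}"
  shows "load P (X \<union> Y) e = load P X e + load P Y e"
proof -
  have "{i \<in> X \<union> Y. e \<in> set (P i)} = {i \<in> X. e \<in> set (P i)} \<union> {i \<in> Y. e \<in> set (P i)}" by auto
  then show ?thesis unfolding load_def using assms by (subst card_Un_disjoint[symmetric]) auto
qed

lemma family_cost_mono:
  assumes "finite X" "\<And>i. i \<in> X \<Longrightarrow> set (P i) \<subseteq> set (Q i)"
  shows "family_cost P X \<le> family_cost Q X"
  unfolding family_cost_def
  by (intro sum_mono cost_sum_mono load_mono) (use assms in auto)

lemma family_cost_cong:
  assumes "\<And>i. i \<in> X \<Longrightarrow> set (P i) = set (Q i)"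
  shows "family_cost P X = family_cost Q X"
proof -
  have "{i \<in> X. e \<in> set (P i)} = {i \<in> X. e \<in> set (Q i)}" for e using assms by auto
  then show ?thesis unfolding family_cost_def load_def by simp
qed

lemma family_cost_nonneg: "0 \<le> family_cost P X"
  unfolding family_cost_def by (intro sum_nonneg cost_sum_nonneg)

text \<open>Two groups sharing an arc pay at most as much together as apart. This covers the walks
  read off after a split, which may meet again.\<close>

lemma family_cost_Un_le:
  assumes "finite X" "finite Y" "X \<inter> Y = {}"
  shows "family_cost P (X \<union> Y) \<le> family_cost P X + family_cost P Y"
  unfolding family_cost_def sum.distrib[symmetric]
  by (intro sum_mono) (simp add: load_Un[OF assms] cost_sum_subadd)

text \<open>The matching equality for arc-disjoint groups, which is what the groups of a tree-like
  profile are once they have parted.\<close>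

lemma family_cost_Un_eq:
  assumes "finite X" "finite Y" "X \<inter> Y = {}"
    and "\<And>i j. i \<in> X \<Longrightarrow> j \<in> Y \<Longrightarrow> set (P i) \<inter> set (P j) = {}"
  shows "family_cost P (X \<union> Y) = family_cost P X + family_cost P Y"
proof -
  have "load P X e = 0 \<or> load P Y e = 0" for e
  proof (cases "\<exists>i\<in>X. e \<in> set (P i)")
    case True
    then have "{j \<in> Y. e \<in> set (P j)} = {}" using assms(4) by blast
    then have "load P Y e = 0" unfolding load_def by (simp only: card.empty)
    then show ?thesis ..
  next
    case False
    then have "{i \<in> X. e \<in> set (P i)} = {}" by blast
    then have "load P X e = 0" unfolding load_def by (simp only: card.empty)
    then show ?thesis ..
  qed
  then have "cost_sum e (load P X e + load P Y e) = cost_sum e (load P X e) + cost_sum e (load P Y e)" for e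
    by (metis add.commute add.right_neutral cost_sum_0)
  then show ?thesis
    unfolding family_cost_def by (simp add: load_Un[OF assms(1-3)] sum.distrib)
qed

text \<open>Equality can fail only if some walk uses \<open>e\<close> again later:
  \<open>load\<close> counts a player once per arc, whereas the right-hand side charges both
  uses.\<close>

lemma family_cost_Cons:
  assumes "e \<in> arcs G"
  shows "family_cost (\<lambda>i. e # P i) X \<le> cost_sum e (card X) + family_cost P X"
    and "\<lbrakk>\<And>i. i \<in> X \<Longrightarrow> e \<notin> set (P i)\<rbrakk> \<Longrightarrow>
      family_cost (\<lambda>i. e # P i) X = cost_sum e (card X) + family_cost P X"
proof -
  have e: "load (\<lambda>i. e # P i) X e = card X" by (simp add: load_def)
  have f: "load (\<lambda>i. e # P i) X f = load P X f" if "f \<noteq> e" for f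
    using that by (simp add: load_def)
  have 1: "family_cost (\<lambda>i. e # P i) X =
    cost_sum e (card X) + (\<Sum>f \<in> arcs G - {e}. cost_sum f (load P X f))"
    unfolding family_cost_def using assms
    by (subst sum.remove[of _ e]) (auto simp: e f)
  have 2: "family_cost P X =
    cost_sum e (load P X e) + (\<Sum>f \<in> arcs G - {e}. cost_sum f (load P X f))"
    unfolding family_cost_def using assms by (subst sum.remove[of _ e]) auto
  show "family_cost (\<lambda>i. e # P i) X \<le> cost_sum e (card X) + family_cost P X"
    unfolding 1 2 using cost_sum_nonneg[OF assms] by auto
  show "family_cost (\<lambda>i. e # P i) X = cost_sum e (card X) + family_cost P X"
    if "\<And>i. i \<in> X \<Longrightarrow> e \<notin> set (P i)"
  proof -
    have "{i \<in> X. e \<in> set (P i)} = {}" using that by auto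
    then have "load P X e = 0" unfolding load_def by (simp only: card.empty)
    then show ?thesis unfolding 1 2 by simp
  qed
qed

lemma potential_eq_family_cost:
  assumes "s \<in> profiles"
  shows "potential s = family_cost (\<lambda>i. s ! i) {..<length terms}"
proof -
  have len: "length s = length terms" and sub: "(\<Union>i<length s. set (s ! i)) \<subseteq> arcs G"
    using assms by (auto simp: profiles_def apath_def awalk_def)
  have pl: "players_on s e = load (\<lambda>i. s ! i) {..<length terms} e" for e
    by (simp add: players_on_def load_def len)
  have "load (\<lambda>i. s ! i) {..<length terms} e = 0" if "e \<notin> (\<Union>i<length s. set (s ! i))" for e
  proof -
    have "{i \<in> {..<length terms}. e \<in> set (s ! i)} = {}" using that len by auto
    then show ?thesis unfolding load_def by simp
  qed
  then have "(\<Sum>e \<in> (\<Union>i<length s. set (s ! i)). cost_sum e (load (\<lambda>i. s ! i) {..<length terms} e))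
     = family_cost (\<lambda>i. s ! i) {..<length terms}"
    unfolding family_cost_def by (intro sum.mono_neutral_left) (use sub in auto)
  then show ?thesis unfolding potential_def pl cost_sum_def by simp
qed

lemma finite_profiles: "finite profiles"
proof -
  have "profiles \<subseteq> {s. set s \<subseteq> (\<Union>t\<in>set terms. {p. apath r p t}) \<and> length s = length terms}"
  proof
    fix s assume "s \<in> profiles"
    then have len: "length s = length terms" and p: "\<forall>i < length terms. apath r (s ! i) (terms ! i)"
      by (auto simp: profiles_def)
    have "p \<in> (\<Union>t\<in>set terms. {p. apath r p t})" if "p \<in> set s" for p
    proof -
      obtain i where "i < length s" "p = s ! i" using \<open>p \<in> set s\<close> by (metis in_set_conv_nth)
      then show ?thesis using len p by (auto intro!: bexI[of _ "terms ! i"])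
    qed
    then show "s \<in> {s. set s \<subseteq> (\<Union>t\<in>set terms. {p. apath r p t}) \<and> length s = length terms}"
      using len by auto
  qed
  moreover have "finite {s. set s \<subseteq> (\<Union>t\<in>set terms. {p. apath r p t}) \<and> length s = length terms}"
    by (rule finite_lists_length_eq) (simp add: apaths_finite)
  ultimately show ?thesis by (rule finite_subset)
qed

section \<open>Rerouting one player along the path of another\<close>

lemma apath_distinct: "apath u p v \<Longrightarrow> distinct p"
  unfolding apath_def by (meson distinct_verts_imp_distinct)

text \<open>Rerouting player \<open>i\<close> along the initial segment of player \<open>j\<close>. Since \<open>s1\<close> does not
  depend on the cost functions, the estimate can be used for several cost functions at once.\<close>

definition rerouted :: "'e list list \<Rightarrow> 'e list list \<Rightarrow> 'e set \<Rightarrow> 'e set \<Rightarrow> bool" where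
  "rerouted s s1 A A' \<longleftrightarrow> s1 \<in> profiles \<and> (\<forall>e.
     let k = load (\<lambda>i. s ! i) {..<length terms} e; k1 = load (\<lambda>i. s1 ! i) {..<length terms} e in
     (e \<in> A' - A \<longrightarrow> k1 \<le> Suc k) \<and> (e \<in> A - A' \<longrightarrow> Suc k1 \<le> k) \<and>
     (e \<notin> A' - A \<longrightarrow> e \<notin> A - A' \<longrightarrow> k1 \<le> k))"

text \<open>The walk \<open>a' @ b\<close> is shortened to a simple path, which only loses arcs. An
  arc of \<open>a\<close> outside \<open>a'\<close> is really abandoned: the original path is
  simple, so the arc does not recur in \<open>b\<close>.\<close>

lemma reroute:
  assumes s: "s \<in> profiles" and i: "i < length terms" and j: "j < length terms"
    and si: "s ! i = a @ b" and sj: "s ! j = a' @ b'"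
    and a: "awalk r a w" and a': "awalk r a' w"
  shows "\<exists>s1. rerouted s s1 (set a) (set a')"
proof -
  let ?t = "terms ! i"
  have ap: "apath r (a @ b) ?t" using s i si by (auto simp: profiles_def)
  then have "awalk r (a @ b) ?t" by (simp add: apath_def)
  then have "awalk w b ?t" using a by (auto simp: awalk_append_iff)
  then have w: "awalk r (a' @ b) ?t" using a' by auto
  define q where "q = awalk_to_apath (a' @ b)"
  have q: "apath r q ?t" and qs: "set q \<subseteq> set a' \<union> set b"
    using apath_awalk_to_apath[OF w] awalk_to_apath_subset[OF w] by (auto simp: q_def)
  define s1 where "s1 = s[i := q]"
  have len: "length s = length terms" using s by (auto simp: profiles_def)
  have s1: "s1 \<in> profiles" using s q i by (auto simp: profiles_def s1_def nth_list_update)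
  have dis: "set a \<inter> set b = {}" using apath_distinct[OF ap] by auto
  let ?I = "{..<length terms}"
  define M where "M e = card {k \<in> ?I - {i}. e \<in> set (s ! k)}" for e
  have eq: "load P ?I e = card {k \<in> ?I - {i}. e \<in> set (P k)} + (if e \<in> set (P i) then 1 else 0)"
    for P :: "nat \<Rightarrow> 'e list" and e
  proof -
    have "{k \<in> ?I. e \<in> set (P k)} = (if e \<in> set (P i) then insert i {k \<in> ?I - {i}. e \<in> set (P k)}
       else {k \<in> ?I - {i}. e \<in> set (P k)})" using i by auto
    then show ?thesis unfolding load_def by simp
  qed
  have M1: "{k \<in> ?I - {i}. e \<in> set (s1 ! k)} = {k \<in> ?I - {i}. e \<in> set (s ! k)}" for e
    by (auto simp: s1_def)
  have k: "load (\<lambda>k. s ! k) ?I e = M e + (if e \<in> set a \<union> set b then 1 else 0)" for e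
    unfolding eq M_def by (simp add: si)
  have k1: "load (\<lambda>k. s1 ! k) ?I e = M e + (if e \<in> set q then 1 else 0)" for e
    unfolding eq M_def M1 using i len by (simp add: s1_def)
  have "rerouted s s1 (set a) (set a')"
    unfolding rerouted_def Let_def k k1 using s1 dis qs by auto
  then show ?thesis by blast
qed

text \<open>A gained arc adds at most the next increment after the old load, and an abandoned arc
  gives back at least the last increment of the old load.\<close>

lemma rerouted_cost:
  assumes "rerouted s s1 A A'" "A \<subseteq> arcs G" "A' \<subseteq> arcs G"
  shows "family_cost (\<lambda>i. s1 ! i) {..<length terms} \<le> family_cost (\<lambda>i. s ! i) {..<length terms}
    + (\<Sum>e \<in> A' - A. cost e (load (\<lambda>i. s ! i) {..<length terms} e + 1))
    - (\<Sum>e \<in> A - A'. cost e (load (\<lambda>i. s ! i) {..<length terms} e))"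
proof -
  let ?k = "\<lambda>e. load (\<lambda>i. s ! i) {..<length terms} e" and ?k1 = "\<lambda>e. load (\<lambda>i. s1 ! i) {..<length terms} e"
  have *: "cost_sum e (?k1 e) \<le> cost_sum e (?k e) + (if e \<in> A' - A then cost e (?k e + 1) else 0)
    - (if e \<in> A - A' then cost e (?k e) else 0)" if e: "e \<in> arcs G" for e
  proof -
    have h: "e \<in> A' - A \<Longrightarrow> ?k1 e \<le> Suc (?k e)" "e \<in> A - A' \<Longrightarrow> Suc (?k1 e) \<le> ?k e"
      "e \<notin> A' - A \<Longrightarrow> e \<notin> A - A' \<Longrightarrow> ?k1 e \<le> ?k e"
      using assms(1) unfolding rerouted_def Let_def by blast+
    consider "e \<in> A' - A" | "e \<in> A - A'" | "e \<notin> A' - A" "e \<notin> A - A'" by blast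
    then show ?thesis
    proof cases
      case 1
      then have "cost_sum e (?k1 e) \<le> cost_sum e (Suc (?k e))" using h(1) e by (intro cost_sum_mono) simp_all
      then show ?thesis using 1 by (auto simp: cost_sum_Suc)
    next
      case 2
      then have *: "Suc (?k1 e) \<le> ?k e" using h(2) by blast
      then obtain k' where k': "?k e = Suc k'" "?k1 e \<le> k'" by (cases "?k e") auto
      have "cost_sum e (?k1 e) \<le> cost_sum e k'" using k' e by (intro cost_sum_mono) auto
      then show ?thesis using 2 k' by (auto simp: cost_sum_Suc)
    next
      case 3
      then have "cost_sum e (?k1 e) \<le> cost_sum e (?k e)" using h(3) e by (intro cost_sum_mono) simp_all
      then show ?thesis using 3 by auto
    qed
  qed
  have sm: "(\<Sum>e\<in>arcs G. if e \<in> B then f e else 0) = sum f B" if "B \<subseteq> arcs G" for B and f :: "'e \<Rightarrow> real"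
    using that by (simp add: sum.inter_restrict[symmetric] Int_absorb1)
  have "family_cost (\<lambda>i. s1 ! i) {..<length terms} \<le>
    (\<Sum>e\<in>arcs G. cost_sum e (?k e) + (if e \<in> A' - A then cost e (?k e + 1) else 0)
    - (if e \<in> A - A' then cost e (?k e) else 0))"
    unfolding family_cost_def by (rule sum_mono) (rule *)
  also have "\<dots> = family_cost (\<lambda>i. s ! i) {..<length terms}
    + (\<Sum>e \<in> A' - A. cost e (?k e + 1)) - (\<Sum>e \<in> A - A'. cost e (?k e))"
    unfolding sum.distrib sum_subtractf family_cost_def
    using assms(2,3) by (intro arg_cong2[of _ _ _ _ minus] arg_cong2[of _ _ _ _ plus] refl sm) auto
  finally show ?thesis .
qed

text \<open>Swapping the roles of the two players, the arcs saved by one rerouting pay for the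
  arcs added by the other one.\<close>

lemma reroute_both:
  assumes "rerouted s s1 A A'" "rerouted s s2 A' A" "A \<subseteq> arcs G" "A' \<subseteq> arcs G"
  shows "family_cost (\<lambda>i. s1 ! i) {..<length terms} + family_cost (\<lambda>i. s2 ! i) {..<length terms}
    \<le> 2 * family_cost (\<lambda>i. s ! i) {..<length terms}
    + (\<Sum>e \<in> (A - A') \<union> (A' - A). cost e (load (\<lambda>i. s ! i) {..<length terms} e + 1)
         - cost e (load (\<lambda>i. s ! i) {..<length terms} e))"
proof -
  have fin: "finite A" "finite A'" using assms by (auto intro: finite_subset)
  show ?thesis
    using rerouted_cost[OF assms(1,3,4)] rerouted_cost[OF assms(2,4,3)] fin
    by (subst sum.union_disjoint) (auto simp: sum_subtractf)
qed

text \<open>Only the arc sets of the prefixes are compared, because the rerouting estimate sees the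
  prefixes through \<open>A - A'\<close> and \<open>A' - A\<close> alone.\<close>

definition tree_like :: "(nat \<Rightarrow> 'e list) \<Rightarrow> nat set \<Rightarrow> bool" where
  "tree_like P X \<longleftrightarrow> (\<forall>i\<in>X. \<forall>j\<in>X. \<forall>a b a' b' e.
     P i = a @ e # b \<longrightarrow> P j = a' @ e # b' \<longrightarrow> set a = set a')"

text \<open>Among the profiles of minimal potential, one that is also minimal for the strictly decreasing
  cost function \<open>1 / h\<close> leaves no room for a rerouting.\<close>

lemma tree_like_optimum:
  assumes "profiles \<noteq> {}"
  obtains s where "optimal_profile s" "tree_like (\<lambda>i. s ! i) {..<length terms}"
proof -
  interpret H: arena G r terms "\<lambda>_ h. 1 / real h"
    by unfold_locales (use root_in_verts terms_in_verts in \<open>auto simp: field_simps\<close>)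
  let ?I = "{..<length terms}"
  obtain s0 where s0: "s0 \<in> profiles" "\<forall>s'\<in>profiles. potential s0 \<le> potential s'"
    using finite_profiles assms
    by (metis arg_min_if_finite(1) arg_min_least)
  define O1 where "O1 = {s \<in> profiles. potential s = potential s0}"
  have "finite O1" "s0 \<in> O1" using finite_profiles s0 by (auto simp: O1_def)
  then obtain s where s: "s \<in> O1" "\<forall>s'\<in>O1. H.potential s \<le> H.potential s'"
    by (metis arg_min_if_finite(1) arg_min_least empty_iff)
  have opt: "optimal_profile s" using s(1) s0 by (auto simp: O1_def optimal_profile_def)
  have sp: "s \<in> profiles" using s(1) by (auto simp: O1_def)
  have "set a = set a'"
    if ij: "i \<in> ?I" "j \<in> ?I" and si: "s ! i = a @ e # b" and sj: "s ! j = a' @ e # b'" for i j a b a' b' e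
  proof (rule ccontr)
    assume ne: "set a \<noteq> set a'"
    have "awalk r (a @ e # b) (terms ! i)" "awalk r (a' @ e # b') (terms ! j)"
      using sp ij si sj by (auto simp: profiles_def apath_def)
    then have a: "awalk r a (tail G e)" "awalk r a' (tail G e)"
      by (auto simp: awalk_append_iff awalk_Cons_iff)
    have sub: "set a \<subseteq> arcs G" "set a' \<subseteq> arcs G" using a by auto
    obtain s1 where s1: "rerouted s s1 (set a) (set a')"
      using reroute[OF sp _ _ si sj a] ij by auto
    obtain s2 where s2: "rerouted s s2 (set a') (set a)"
      using reroute[OF sp _ _ sj si a(2,1)] ij by auto
    let ?k = "\<lambda>e. load (\<lambda>i. s ! i) ?I e"
    let ?D = "(set a - set a') \<union> (set a' - set a)"
    \<comment> \<open>The costs are nonincreasing from load 1 on, so the load must be positive; an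
      arc of \<open>?D\<close> is used by \<open>i\<close> or by \<open>j\<close>.\<close>
    have kpos: "1 \<le> ?k f" if "f \<in> ?D" for f
    proof -
      have "i \<in> {i \<in> ?I. f \<in> set (s ! i)} \<or> j \<in> {i \<in> ?I. f \<in> set (s ! i)}"
        using that si sj ij by auto
      then show ?thesis unfolding load_def
        by (auto simp: Suc_le_eq card_gt_0_iff)
    qed
    have p1: "s1 \<in> profiles" and p2: "s2 \<in> profiles" using s1 s2 by (auto simp: rerouted_def)
    have "(\<Sum>f \<in> ?D. cost f (?k f + 1) - cost f (?k f)) \<le> 0"
    proof (rule sum_nonpos)
      fix f assume f: "f \<in> ?D"
      then have "f \<in> arcs G" using sub by auto
      from cost_antimono[OF this kpos[OF f]] show "cost f (?k f + 1) - cost f (?k f) \<le> 0" by simp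
    qed
    then have "potential s1 + potential s2 \<le> 2 * potential s"
      using reroute_both[OF s1 s2 sub] by (simp add: potential_eq_family_cost p1 p2 sp)
    moreover have "potential s \<le> potential s1" "potential s \<le> potential s2"
      using opt p1 p2 by (auto simp: optimal_profile_def)
    \<comment> \<open>Two numbers that are at least \<open>potential s\<close> and add up to at most
      twice that value are both equal to it. So the rerouted profiles are optimal too and compete
      with \<open>s\<close> for the secondary potential.\<close>
    ultimately have "potential s1 = potential s" "potential s2 = potential s" by auto
    then have "s1 \<in> O1" "s2 \<in> O1" using p1 p2 s(1) by (auto simp: O1_def)
    then have H12: "H.potential s \<le> H.potential s1" "H.potential s \<le> H.potential s2" using s by auto
    have "?D \<noteq> {}" using ne by auto
    \<comment> \<open>As \<open>1 / h\<close> is strictly decreasing, a single arc in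
      \<open>?D\<close> makes the average of the two secondary potentials drop strictly.\<close>
    then have "(\<Sum>f \<in> ?D. 1 / real (?k f + 1) - 1 / real (?k f)) < (\<Sum>f \<in> ?D. 0)"
    proof (intro sum_strict_mono)
      fix f assume f: "f \<in> ?D"
      have "0 < real (?k f)" using kpos[OF f] by linarith
      then show "1 / real (?k f + 1) - 1 / real (?k f) < 0" by (simp add: divide_strict_left_mono)
    qed auto
    then have "H.potential s1 + H.potential s2 < 2 * H.potential s"
      using H.reroute_both[OF s1 s2 sub] p1 p2 sp
      by (simp add: H.potential_eq_family_cost)
    then show False using H12 by auto
  qed
  then have "tree_like (\<lambda>i. s ! i) ?I" unfolding tree_like_def by blast
  with opt show ?thesis using that by blast
qed

text \<open>The characteristic equations of the dynamic program as inequalities: \<open>ok X k v\<close> says that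
  the entry for the player set \<open>X\<close>, the hop bound \<open>k\<close> and the start vertex \<open>v\<close> is finite.\<close>

lemma table_le_tree_like:
  fixes ok :: "nat set \<Rightarrow> nat \<Rightarrow> 'v \<Rightarrow> bool" and val :: "nat set \<Rightarrow> nat \<Rightarrow> 'v \<Rightarrow> real"
  assumes base: "\<And>i k. i < length terms \<Longrightarrow> k \<le> K \<Longrightarrow>
      ok {i} k (terms ! i) \<and> val {i} k (terms ! i) \<le> 0"
    and arc: "\<And>X k e. X \<subseteq> {..<length terms} \<Longrightarrow> e \<in> arcs G \<Longrightarrow> k < K \<Longrightarrow> ok X k (head G e) \<Longrightarrow>
      ok X (Suc k) (tail G e) \<and> val X (Suc k) (tail G e) \<le> cost_sum e (card X) + val X k (head G e)"
    and split: "\<And>Y Z k v. Y \<subseteq> {..<length terms} \<Longrightarrow> Z \<subseteq> {..<length terms} \<Longrightarrow> Y \<inter> Z = {} \<Longrightarrow>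
      Y \<noteq> {} \<Longrightarrow> Z \<noteq> {} \<Longrightarrow> k \<le> K \<Longrightarrow> v \<in> verts G \<Longrightarrow> ok Y K v \<Longrightarrow> ok Z K v \<Longrightarrow>
      ok (Y \<union> Z) k v \<and> val (Y \<union> Z) k v \<le> val Y K v + val Z K v"
    and X: "X \<noteq> {}" "X \<subseteq> {..<length terms}" "k \<le> K"
    and P: "\<And>i. i \<in> X \<Longrightarrow> apath v (P i) (terms ! i)" "\<And>i. i \<in> X \<Longrightarrow> length (P i) \<le> k"
    and K: "card (verts G) \<le> K"
    and tree: "tree_like P X"
  shows "ok X k v \<and> val X k v \<le> family_cost P X"
  using X P tree
\<comment> \<open>This is the lexicographic order on \<open>card X\<close> and
  \<open>k \<le> K\<close>: an arc lowers \<open>k\<close>, and a split lowers \<open>card X\<close>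
  while resetting the hop bound to \<open>K\<close>.\<close>
proof (induction "card X * (K + 1) + k" arbitrary: X k v P rule: less_induct)
  case less
  have fin: "finite X" using less.prems(2) finite_subset by blast
  obtain i0 where i0: "i0 \<in> X" using less.prems(1) by blast
  have vG: "v \<in> verts G" using less.prems(4)[OF i0] by (auto simp: apath_def)
  have split_case: ?case if YZ: "X = Y \<union> Z" "Y \<inter> Z = {}" "Y \<noteq> {}" "Z \<noteq> {}"
    and dis: "\<And>i j. i \<in> Y \<Longrightarrow> j \<in> Z \<Longrightarrow> set (P i) \<inter> set (P j) = {}" for Y Z
  proof -
    have finYZ: "finite Y" "finite Z" using fin YZ by auto
    have cX: "card X = card Y + card Z" using YZ finYZ by (simp add: card_Un_disjoint)
    have cp: "0 < card Y" "0 < card Z" using YZ finYZ by (auto simp: card_gt_0_iff)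
    have m: "card Y * (K + 1) + K < card X * (K + 1) + k" "card Z * (K + 1) + K < card X * (K + 1) + k"
    proof -
      have "card Y + 1 \<le> card X" "card Z + 1 \<le> card X" using cX cp by auto
      then have "(card Y + 1) * (K + 1) \<le> card X * (K + 1)" "(card Z + 1) * (K + 1) \<le> card X * (K + 1)"
        using mult_le_mono1 by blast+
      then show "card Y * (K + 1) + K < card X * (K + 1) + k" "card Z * (K + 1) + K < card X * (K + 1) + k"
        by (simp_all add: algebra_simps)
    qed
    have "ok Y K v \<and> val Y K v \<le> family_cost P Y"
    proof (rule less.hyps[OF m(1)])
      have sub: "Y \<subseteq> X" using YZ(1) by auto
      show "Y \<noteq> {}" "Y \<subseteq> {..<length terms}" "K \<le> K" using YZ sub less.prems(2) by auto
      show "apath v (P i) (terms ! i)" if "i \<in> Y" for i using less.prems(4) sub that by auto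
      show "length (P i) \<le> K" if "i \<in> Y" for i
        using less.prems(5)[of i] less.prems(3) sub that by auto
      show "tree_like P Y" using less.prems(6) sub unfolding tree_like_def by (meson subsetD)
    qed
    moreover have "ok Z K v \<and> val Z K v \<le> family_cost P Z"
    proof (rule less.hyps[OF m(2)])
      have sub: "Z \<subseteq> X" using YZ(1) by auto
      show "Z \<noteq> {}" "Z \<subseteq> {..<length terms}" "K \<le> K" using YZ sub less.prems(2) by auto
      show "apath v (P i) (terms ! i)" if "i \<in> Z" for i using less.prems(4) sub that by auto
      show "length (P i) \<le> K" if "i \<in> Z" for i
        using less.prems(5)[of i] less.prems(3) sub that by auto
      show "tree_like P Z" using less.prems(6) sub unfolding tree_like_def by (meson subsetD)
    qed
    moreover have "family_cost P X = family_cost P Y + family_cost P Z"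
      unfolding YZ(1) by (rule family_cost_Un_eq) (use finYZ YZ dis in auto)
    ultimately show ?thesis
      using split[of Y Z k v] YZ less.prems(2,3) vG by auto
  qed
  show ?case
  proof (cases "P i0")
    case Nil
    have t: "v = terms ! i0" using less.prems(4)[OF i0] Nil by (simp add: apath_Nil_iff)
    show ?thesis
    proof (cases "X = {i0}")
      case True
      then show ?thesis using base[of i0 k] less.prems(2,3) t family_cost_nonneg[of P X] by auto
    next
      case False
      \<comment> \<open>The path of \<open>i0\<close> is empty, hence arc-disjoint from all others,
        and \<open>i0\<close> can be split off.\<close>
      show ?thesis by (rule split_case[of "{i0}" "X - {i0}"]) (use i0 False Nil in auto)
    qed
  next
    case (Cons e p0)
    define Y where "Y = {i \<in> X. \<exists>p. P i = e # p}"
    \<comment> \<open>So \<open>Y\<close> and its complement in \<open>X\<close> are arc-disjoint.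
      The prefixes before the common arc \<open>f\<close> have the same arcs, so \<open>e\<close>
      occurs in \<open>P i\<close>; and a simple path from \<open>v\<close> can use an arc leaving
      \<open>v\<close> only at its very beginning.\<close>
    have same: "i \<in> Y" if ij: "i \<in> X" "j \<in> Y" and f: "f \<in> set (P i)" "f \<in> set (P j)" for i j f
    proof -
      obtain a b where ab: "P i = a @ f # b" using f(1) by (meson split_list)
      obtain a' b' where ab': "P j = a' @ f # b'" using f(2) by (meson split_list)
      have jX: "j \<in> X" and ej: "\<exists>p. P j = e # p" using ij by (auto simp: Y_def)
      have aa: "set a = set a'" using less.prems(6) ij(1) jX ab ab' unfolding tree_like_def by blast
      have ap: "apath v (P i) (terms ! i)" using less.prems(4) ij by auto
      have "hd (P i) = e"
      proof (cases "a' = []")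
        case True
        then show ?thesis using aa ab ab' ej by auto
      next
        case False
        then have "e \<in> set a'" using ej ab' by (cases a') auto
        then have "e \<in> set (P i)" using aa ab by auto
        then obtain c d where cd: "P i = c @ e # d" by (meson split_list)
        have te: "tail G e = v" using less.prems(4)[OF jX] ej by (auto simp: apath_Cons_iff)
        have "c = []"
        proof (rule ccontr)
          assume "c \<noteq> []"
          then obtain g c' where c: "c = g # c'" by (cases c) auto
          have "awalk_verts v (P i) = map (tail G) (P i) @ [head G (last (P i))]"
            by (simp add: awalk_verts_conv cd)
          moreover have "tail G g = v" using ap by (auto simp: cd c apath_Cons_iff)
          ultimately show False using ap te by (auto simp: apath_def cd c)
        qed
        then show ?thesis using cd by simp
      qed
      then show ?thesis using ij f(1) by (cases "P i") (auto simp: Y_def)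
    qed
    show ?thesis
    proof (cases "Y = X")
      case False
      have i0Y: "i0 \<in> Y" using i0 Cons by (simp add: Y_def)
      show ?thesis
      proof (rule split_case[of Y "X - Y"])
        have sub: "Y \<subseteq> X" by (auto simp: Y_def)
        show "X = Y \<union> (X - Y)" "Y \<inter> (X - Y) = {}" "Y \<noteq> {}" "X - Y \<noteq> {}"
          using sub i0Y False by auto
        show "set (P i) \<inter> set (P j) = {}" if "i \<in> Y" "j \<in> X - Y" for i j
          using same[of j i] that by blast
      qed
    next
      case True
      define Q where "Q i = tl (P i)" for i
      have PQ: "P i = e # Q i" if "i \<in> X" for i
      proof -
        have "i \<in> Y" using that True by simp
        then show ?thesis by (auto simp: Y_def Q_def)
      qed
      have eA: "e \<in> arcs G" "tail G e = v" using less.prems(4)[OF i0] by (auto simp: PQ i0 apath_Cons_iff)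
      obtain k' where k': "k = Suc k'" using less.prems(5)[OF i0] Cons by (cases k) auto
      have Qp: "apath (head G e) (Q i) (terms ! i)" "e \<notin> set (Q i)" if "i \<in> X" for i
        using less.prems(4)[OF that] apath_distinct[OF less.prems(4)[OF that]] by (auto simp: PQ that apath_Cons_iff)
      have tQ: "tree_like Q X"
        unfolding tree_like_def
      proof (intro ballI allI impI)
        fix i j a b a' b' f
        assume "i \<in> X" "j \<in> X" "Q i = a @ f # b" "Q j = a' @ f # b'"
        then have "P i = (e # a) @ f # b" "P j = (e # a') @ f # b'" "e \<notin> set a" "e \<notin> set a'"
          using PQ Qp(2)[of i] Qp(2)[of j] by auto
        moreover have "set (e # a) = set (e # a')"
          using calculation \<open>i \<in> X\<close> \<open>j \<in> X\<close> less.prems(6) unfolding tree_like_def by blast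
        ultimately show "set a = set a'" by auto
      qed
      have "ok X k' (head G e) \<and> val X k' (head G e) \<le> family_cost Q X"
        by (rule less.hyps) (use less.prems k' Qp tQ PQ in \<open>auto simp: PQ\<close>)
      moreover have "family_cost P X = family_cost (\<lambda>i. e # Q i) X"
        by (rule family_cost_cong) (simp add: PQ)
      moreover have "\<dots> = cost_sum e (card X) + family_cost Q X"
        by (rule family_cost_Cons(2)) (use eA Qp in auto)
      ultimately show ?thesis using arc[of X e k'] less.prems eA k' by auto
    qed
  qed
qed

end

section \<open>Verifying programs of the unit-cost machine\<close>

text \<open>A total-correctness triple with a time bound. A stuck run has no \<open>exec\<close>
  derivation, so the triple also asserts that the word bound is respected.\<close>

definition runs :: "(nat \<Rightarrow> nat \<Rightarrow> real) \<Rightarrow> nat \<Rightarrow> com \<Rightarrow> state \<Rightarrow> nat \<Rightarrow> (state \<Rightarrow> bool) \<Rightarrow> bool" where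
  "runs c W p st n Q \<longleftrightarrow> (\<exists>t st'. exec c W p st t st' \<and> t \<le> n \<and> Q st')"

lemma runs_weaken:
  assumes "runs c W p st n Q" "n \<le> n'" "\<And>st'. Q st' \<Longrightarrow> Q' st'"
  shows "runs c W p st n' Q'"
  using assms unfolding runs_def by (meson order_trans)

lemma runs_Seq:
  assumes "runs c W p st n1 R" "\<And>st'. R st' \<Longrightarrow> runs c W q st' n2 Q" "n1 + n2 \<le> n"
  shows "runs c W (Seq p q) st n Q"
proof -
  obtain t st' where 1: "exec c W p st t st'" "t \<le> n1" "R st'" using assms(1) by (auto simp: runs_def)
  obtain t' st'' where 2: "exec c W q st' t' st''" "t' \<le> n2" "Q st''"
    using assms(2)[OF 1(3)] by (auto simp: runs_def)
  show ?thesis unfolding runs_def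
    using exec.Seq[OF 1(1) 2(1)] 1(2) 2(2,3) assms(3) by (meson add_mono order_trans)
qed

lemma runs_If:
  assumes "bfits W st b" "bval c st b \<Longrightarrow> runs c W p st m Q" "\<not> bval c st b \<Longrightarrow> runs c W q st m Q"
    "1 + bsteps b + m \<le> n"
  shows "runs c W (IfThen b p q) st n Q"
proof (cases "bval c st b")
  case True
  then obtain t st' where "exec c W p st t st'" "t \<le> m" "Q st'" using assms(2) by (auto simp: runs_def)
  then show ?thesis unfolding runs_def
    using exec.IfTrue[OF assms(1) True, of p t st' q] assms(4)
    by (intro exI[of _ "1 + bsteps b + t"] exI[of _ st']) auto
next
  case False
  then obtain t st' where "exec c W q st t st'" "t \<le> m" "Q st'" using assms(3) by (auto simp: runs_def)
  then show ?thesis unfolding runs_def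
    using exec.IfFalse[OF assms(1) False, of q t st' p] assms(4)
    by (intro exI[of _ "1 + bsteps b + t"] exI[of _ st']) auto
qed

text \<open>\<open>\<mu>\<close> is a budget of steps rather than a bare termination measure: each
  iteration pays for its body and its guard out of the decrease.\<close>

lemma runs_While_measure:
  assumes inv: "I st"
    and fits: "\<And>st. I st \<Longrightarrow> bfits W st b"
    and body: "\<And>st. I st \<Longrightarrow> bval c st b \<Longrightarrow> \<exists>f. runs c W p st f (\<lambda>st'. I st' \<and> \<mu> st' + f + 1 + bsteps b \<le> \<mu> st)"
  shows "runs c W (While b p) st (\<mu> st + 1 + bsteps b) (\<lambda>st'. I st' \<and> \<not> bval c st' b)"
  using inv
proof (induction "\<mu> st" arbitrary: st rule: less_induct)
  case less
  show ?case
  proof (cases "bval c st b")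
    case False
    then show ?thesis unfolding runs_def
      using exec.WhileFalse[OF fits[OF less.prems] False] less.prems
      by (intro exI[of _ "1 + bsteps b"] exI[of _ st]) auto
  next
    case True
    obtain f where "runs c W p st f (\<lambda>st'. I st' \<and> \<mu> st' + f + 1 + bsteps b \<le> \<mu> st)"
      using body[OF less.prems True] by blast
    then obtain t st' where 1: "exec c W p st t st'" "t \<le> f" "I st'" "\<mu> st' + f + 1 + bsteps b \<le> \<mu> st"
      by (auto simp: runs_def)
    then have "\<mu> st' < \<mu> st" by simp
    from less.hyps[OF this 1(3)] obtain t' st'' where
      2: "exec c W (While b p) st' t' st''" "t' \<le> \<mu> st' + 1 + bsteps b" "I st''" "\<not> bval c st'' b"
      by (auto simp: runs_def)
    show ?thesis unfolding runs_def
      using exec.WhileTrue[OF fits[OF less.prems] True 1(1) 2(1)] 1(2,4) 2(2,3,4)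
      by (intro exI[of _ "1 + bsteps b + t + t'"] exI[of _ st'']) auto
  qed
qed

section \<open>Frame conditions and loop rules\<close>

fun nwrites :: "com \<Rightarrow> string set" where
  "nwrites Skip = {}"
| "nwrites (NAssign x a b) = {x}"
| "nwrites (RAssign x a q) = {}"
| "nwrites (Seq p q) = nwrites p \<union> nwrites q"
| "nwrites (IfThen b p q) = nwrites p \<union> nwrites q"
| "nwrites (While b p) = nwrites p"

fun rwrites :: "com \<Rightarrow> string set" where
  "rwrites Skip = {}"
| "rwrites (NAssign x a b) = {}"
| "rwrites (RAssign x a q) = {x}"
| "rwrites (Seq p q) = rwrites p \<union> rwrites q"
| "rwrites (IfThen b p q) = rwrites p \<union> rwrites q"
| "rwrites (While b p) = rwrites p"

text \<open>Changes are tracked per array name and not per cell, so that the frame can be read off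
  from the program text.\<close>

definition frame :: "com \<Rightarrow> state \<Rightarrow> state \<Rightarrow> bool" where
  "frame p st st' \<longleftrightarrow> (\<forall>y. y \<notin> nwrites p \<longrightarrow> nmem st' y = nmem st y) \<and>
     (\<forall>y. y \<notin> rwrites p \<longrightarrow> rmem st' y = rmem st y)"

lemma nmem_nput [simp]: "nmem (nput x i v st) = (nmem st)(x := (nmem st x)(i := v))"
  and rmem_nput [simp]: "rmem (nput x i v st) = rmem st"
  and nmem_rput [simp]: "nmem (rput x i w st) = nmem st"
  and rmem_rput [simp]: "rmem (rput x i w st) = (rmem st)(x := (rmem st x)(i := w))"
  by (simp_all add: nput_def rput_def)

lemma exec_frame: "exec c W p st t st' \<Longrightarrow> frame p st st'"
  by (induction rule: exec.induct) (auto simp: frame_def)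

lemma frame_refl: "frame p st st"
  by (simp add: frame_def)

lemma frame_trans: "frame p st st' \<Longrightarrow> frame p st' st'' \<Longrightarrow> frame p st st''"
  by (simp add: frame_def)

lemma frame_nmem: "frame p st st' \<Longrightarrow> y \<notin> nwrites p \<Longrightarrow> nmem st' y = nmem st y"
  and frame_rmem: "frame p st st' \<Longrightarrow> y \<notin> rwrites p \<Longrightarrow> rmem st' y = rmem st y"
  by (auto simp: frame_def)

lemma runs_frame: "runs c W p st n Q \<Longrightarrow> runs c W p st n (\<lambda>st'. Q st' \<and> frame p st st')"
  unfolding runs_def using exec_frame by blast

text \<open>Every obligation receives the frame relative to the initial state, so an invariant has
  to mention only what the body changes.\<close>

lemma runs_While:
  assumes inv: "I st0"
    and fits: "\<And>st. frame p st0 st \<Longrightarrow> I st \<Longrightarrow> bfits W st b"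
    and body: "\<And>st. frame p st0 st \<Longrightarrow> I st \<Longrightarrow> bval c st b \<Longrightarrow>
      \<exists>f. runs c W p st f (\<lambda>st'. I st' \<and> \<mu> st' + f + 1 + bsteps b \<le> \<mu> st)"
    and post: "\<And>st. frame p st0 st \<Longrightarrow> I st \<Longrightarrow> \<not> bval c st b \<Longrightarrow> Q st"
    and time: "\<mu> st0 + 1 + bsteps b \<le> n"
  shows "runs c W (While b p) st0 n Q"
proof -
  have "runs c W (While b p) st0 (\<mu> st0 + 1 + bsteps b)
    (\<lambda>st'. (I st' \<and> frame p st0 st') \<and> \<not> bval c st' b)"
  proof (rule runs_While_measure)
    fix st assume st: "I st \<and> frame p st0 st" and b: "bval c st b"
    then obtain f where "runs c W p st f (\<lambda>st'. I st' \<and> \<mu> st' + f + 1 + bsteps b \<le> \<mu> st)"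
      using body by blast
    from runs_frame[OF this] have "runs c W p st f (\<lambda>st'. (I st' \<and> frame p st0 st') \<and> \<mu> st' + f + 1 + bsteps b \<le> \<mu> st)"
      by (rule runs_weaken) (use st frame_trans in auto)
    then show "\<exists>f. runs c W p st f (\<lambda>st'. (I st' \<and> frame p st0 st') \<and> \<mu> st' + f + 1 + bsteps b \<le> \<mu> st)"
      by blast
  qed (use inv fits frame_refl in auto)
  then show ?thesis by (rule runs_weaken) (use time post in auto)
qed

text \<open>The cost of an iteration may depend on the counter. Filling the table needs this: an
  entry costs about \<open>2 ^ card (set_decode S)\<close> steps, and only the sum over all masks
  yields \<open>3 ^ l\<close>.\<close>

lemma runs_For:
  fixes I :: "nat \<Rightarrow> state \<Rightarrow> bool"
  assumes inv: "I 0 st0"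
    and fits: "\<And>i st. frame p st0 st \<Longrightarrow> I i st \<Longrightarrow> i \<le> N \<Longrightarrow> bfits W st b \<and> (bval c st b \<longleftrightarrow> i < N)"
    and body: "\<And>i st. frame p st0 st \<Longrightarrow> I i st \<Longrightarrow> i < N \<Longrightarrow> runs c W p st (f i) (I (Suc i))"
    and post: "\<And>st. frame p st0 st \<Longrightarrow> I N st \<Longrightarrow> Q st"
    and time: "(\<Sum>i<N. f i + 1 + bsteps b) + 1 + bsteps b \<le> n"
  shows "runs c W (While b p) st0 n Q"
proof -
  have "runs c W (While b p) st ((\<Sum>i=k..<N. f i + 1 + bsteps b) + 1 + bsteps b) (\<lambda>st'. I N st' \<and> frame p st0 st')"
    if "k \<le> N" "I k st" "frame p st0 st" for k st
    using that
  proof (induction k arbitrary: st rule: inc_induct)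
    case base
    then show ?case
      using exec.WhileFalse[of W st b c p] fits[of st N] unfolding runs_def
      by (intro exI[of _ "1 + bsteps b"] exI[of _ st]) auto
  next
    case (step k)
    have "runs c W p st (f k) (\<lambda>st'. I (Suc k) st' \<and> frame p st st')"
      using body[of st k] step.prems step.hyps by (intro runs_frame) auto
    then obtain t st' where 1: "exec c W p st t st'" "t \<le> f k" "I (Suc k) st'" "frame p st st'"
      by (auto simp: runs_def)
    from step.IH[OF 1(3)] obtain t' st'' where
      2: "exec c W (While b p) st' t' st''" "t' \<le> (\<Sum>i=Suc k..<N. f i + 1 + bsteps b) + 1 + bsteps b"
        "I N st''" "frame p st0 st''"
      using frame_trans[OF step.prems(2) 1(4)] by (auto simp: runs_def)
    have "(\<Sum>i=k..<N. f i + 1 + bsteps b) = f k + 1 + bsteps b + (\<Sum>i=Suc k..<N. f i + 1 + bsteps b)"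
      using step.hyps by (simp add: sum.atLeast_Suc_lessThan)
    then show ?case unfolding runs_def
      using exec.WhileTrue[of W st b c p, OF _ _ 1(1) 2(1)] fits[of st k] step.prems step.hyps 1(2) 2(2,3,4)
      by (intro exI[of _ "1 + bsteps b + t + t'"] exI[of _ st'']) auto
  qed
  from this[of 0 st0] have "runs c W (While b p) st0 ((\<Sum>i<N. f i + 1 + bsteps b) + 1 + bsteps b)
      (\<lambda>st'. I N st' \<and> frame p st0 st')"
    using inv frame_refl by (simp add: atLeast0LessThan)
  then show ?thesis by (rule runs_weaken) (use time post in auto)
qed

text \<open>The simplifier executes loop-free programs by unfolding \<open>post\<close>, \<open>safe\<close> and \<open>dur\<close>.\<close>

fun loopfree :: "com \<Rightarrow> bool" where
  "loopfree (Seq p q) \<longleftrightarrow> loopfree p \<and> loopfree q"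
| "loopfree (IfThen b p q) \<longleftrightarrow> loopfree p \<and> loopfree q"
| "loopfree (While b p) \<longleftrightarrow> False"
| "loopfree _ \<longleftrightarrow> True"

fun post :: "(nat \<Rightarrow> nat \<Rightarrow> real) \<Rightarrow> com \<Rightarrow> state \<Rightarrow> state" where
  "post c Skip st = st"
| "post c (NAssign x a b) st = nput x (nval st a) (nval st b) st"
| "post c (RAssign x a q) st = rput x (nval st a) (rval c st q) st"
| "post c (Seq p q) st = post c q (post c p st)"
| "post c (IfThen b p q) st = (if bval c st b then post c p st else post c q st)"
| "post c (While b p) st = st"

fun safe :: "(nat \<Rightarrow> nat \<Rightarrow> real) \<Rightarrow> nat \<Rightarrow> com \<Rightarrow> state \<Rightarrow> bool" where
  "safe c W Skip st \<longleftrightarrow> True"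
| "safe c W (NAssign x a b) st \<longleftrightarrow> nfits W st a \<and> nfits W st b"
| "safe c W (RAssign x a q) st \<longleftrightarrow> nfits W st a \<and> rfits W st q"
| "safe c W (Seq p q) st \<longleftrightarrow> safe c W p st \<and> safe c W q (post c p st)"
| "safe c W (IfThen b p q) st \<longleftrightarrow> bfits W st b \<and> (if bval c st b then safe c W p st else safe c W q st)"
| "safe c W (While b p) st \<longleftrightarrow> False"

text \<open>Both branches of a conditional are charged. This upper bound remains a plain sum that
  the simplifier can evaluate.\<close>

fun dur :: "com \<Rightarrow> nat" where
  "dur Skip = 1"
| "dur (NAssign x a b) = 1 + nsteps a + nsteps b"
| "dur (RAssign x a q) = 1 + nsteps a + rsteps q"
| "dur (Seq p q) = dur p + dur q"
| "dur (IfThen b p q) = 1 + bsteps b + dur p + dur q"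
| "dur (While b p) = 0"

lemma exec_post:
  assumes "loopfree p" "safe c W p st"
  shows "\<exists>t \<le> dur p. exec c W p st t (post c p st)"
  using assms
proof (induction p arbitrary: st)
  case (Seq p q)
  then obtain t t' where "t \<le> dur p" "exec c W p st t (post c p st)"
    "t' \<le> dur q" "exec c W q (post c p st) t' (post c q (post c p st))" by fastforce
  then show ?case using exec.Seq by (intro exI[of _ "t + t'"]) auto
next
  case (IfThen b p q)
  show ?case
  proof (cases "bval c st b")
    case True
    then obtain t where "t \<le> dur p" "exec c W p st t (post c p st)" using IfThen by fastforce
    then show ?thesis using True IfThen.prems exec.IfTrue[of W st b c p t "post c p st" q]
      by (intro exI[of _ "1 + bsteps b + t"]) auto
  next
    case False
    then obtain t where "t \<le> dur q" "exec c W q st t (post c q st)" using IfThen by fastforce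
    then show ?thesis using False IfThen.prems exec.IfFalse[of W st b c q t "post c q st" p]
      by (intro exI[of _ "1 + bsteps b + t"]) auto
  qed
next
  case (NAssign x a b)
  then show ?case using exec.NAssign[of W st a b c x] by auto
next
  case (RAssign x a q)
  then show ?case using exec.RAssign[of W st a q c x] by auto
next
  case Skip
  then show ?case using exec.Skip[of c W st] by auto
qed simp

lemma runs_loopfree:
  assumes "loopfree p" "safe c W p st" "dur p \<le> n" "Q (post c p st)"
  shows "runs c W p st n Q"
  using exec_post[OF assms(1,2)] assms(3,4) unfolding runs_def by (meson order_trans)

lemma nfits_imp_le: "nfits W st e \<Longrightarrow> nval st e \<le> W"
  by (cases e) auto

section \<open>Player sets as bit masks\<close>

lemma set_decode_and: "set_decode (and x y) = set_decode x \<inter> set_decode y"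
  by (auto simp: set_decode_def simp flip: bit_iff_odd simp: bit_and_iff)

lemma and_nat_le: "and (x::nat) y \<le> x"
  by (rule subset_decode_imp_le) (simp add: set_decode_and)

text \<open>\<open>and (Y - 1) S\<close> is the largest submask of \<open>S\<close> below
  \<open>Y\<close>, so iterating it lists the submasks of \<open>S\<close> downwards without gaps.
  The induction strips the lowest bit.\<close>

lemma less_iff_le_and_pred:
  assumes "set_decode Z \<subseteq> set_decode S" "set_decode Y \<subseteq> set_decode S" "0 < Y"
  shows "Z < Y \<longleftrightarrow> Z \<le> and (Y - 1) S"
proof
  assume "Z \<le> and (Y - 1) S"
  also have "\<dots> \<le> Y - 1" by (rule and_nat_le)
  finally show "Z < Y" using assms(3) by simp
next
  assume "Z < Y"
  then show "Z \<le> and (Y - 1) S"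
    using assms
  proof (induction Y arbitrary: Z S rule: less_induct)
    case (less Y)
    have sub: "set_decode (Z div 2) \<subseteq> set_decode (S div 2)" "set_decode (Y div 2) \<subseteq> set_decode (S div 2)"
      using less.prems(2,3) by (auto simp: set_decode_div_2)
    have oddS: "odd Z \<Longrightarrow> odd S" "odd Y \<Longrightarrow> odd S"
      using less.prems(2,3) by (metis set_decode_0 subsetD)+
    have rec: "and (Y - 1) S = of_bool (odd (Y - 1) \<and> odd S) + 2 * and ((Y - 1) div 2) (S div 2)"
      by (rule and_rec)
    show ?case
    proof (cases "odd Y")
      case True
      \<comment> \<open>For odd \<open>Y\<close>, subtracting 1 merely clears the lowest
        bit.\<close>
      then have "(Y - 1) div 2 = Y div 2" by (auto elim: oddE)
      moreover have "and (Y div 2) (S div 2) = Y div 2"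
        using sub(2) by (metis inf.absorb1 set_decode_and set_decode_inverse)
      moreover have "Z \<le> 2 * (Y div 2)" using less.prems(1) True by presburger
      ultimately show ?thesis unfolding rec by simp
    next
      case False
      then have pos: "0 < Y div 2" "Y div 2 < Y" using less.prems(4) by auto
      \<comment> \<open>For even \<open>Y\<close>, the borrow sets the lowest bit of
        \<open>Y - 1\<close>, so the conjunction keeps the lowest bit of \<open>S\<close>.\<close>
      have 1: "(Y - 1) div 2 = Y div 2 - 1" "odd (Y - 1)" using False less.prems(4) by presburger+
      have "Z div 2 < Y div 2" using less.prems(1) False by presburger
      then have "Z div 2 \<le> and (Y div 2 - 1) (S div 2)"
        by (rule less.IH[OF pos(2) _ sub pos(1)])
      moreover have "Z = of_bool (odd Z) + 2 * (Z div 2)" by simp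
      ultimately show ?thesis unfolding rec 1(1) using oddS 1(2) by (cases "odd Z") auto
    qed
  qed
qed

text \<open>Subtracting a submask never borrows, so the machine obtains the complementary group by
  one subtraction.\<close>

lemma set_decode_diff:
  assumes "set_decode Y \<subseteq> set_decode S"
  shows "set_decode (S - Y) = set_decode S - set_decode Y"
proof -
  have "S - Y = set_encode (set_decode S) - set_encode (set_decode Y)" by simp
  also have "\<dots> = set_encode (set_decode S - set_decode Y)"
    unfolding set_encode_def by (rule sum_diff_nat[symmetric]) (use assms in \<open>auto intro: finite_subset\<close>)
  finally show ?thesis by simp
qed

section \<open>Counting player sets and their subsets\<close>

lemma card_submasks: "card {Z. set_decode Z \<subseteq> set_decode S} = 2 ^ card (set_decode S)"
  and finite_submasks: "finite {Z. set_decode Z \<subseteq> set_decode S}"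
proof -
  have "{Z. set_decode Z \<subseteq> set_decode S} = set_encode ` Pow (set_decode S)"
  proof (intro set_eqI iffI)
    fix Z assume "Z \<in> {Z. set_decode Z \<subseteq> set_decode S}"
    then show "Z \<in> set_encode ` Pow (set_decode S)" by (intro image_eqI[of _ _ "set_decode Z"]) auto
  next
    fix Z assume "Z \<in> set_encode ` Pow (set_decode S)"
    then obtain A where "A \<subseteq> set_decode S" "Z = set_encode A" by auto
    moreover then have "finite A" using finite_set_decode finite_subset by blast
    ultimately show "Z \<in> {Z. set_decode Z \<subseteq> set_decode S}" by simp
  qed
  moreover have "inj_on set_encode (Pow (set_decode S))"
    by (rule inj_on_subset[OF inj_on_set_encode]) (auto intro: finite_subset[OF _ finite_set_decode])
  ultimately show "card {Z. set_decode Z \<subseteq> set_decode S} = 2 ^ card (set_decode S)"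
    "finite {Z. set_decode Z \<subseteq> set_decode S}" by (simp_all add: card_image card_Pow)
qed

lemma card_set_decode_rec: "card (set_decode S) = card (set_decode (S div 2)) + S mod 2"
proof -
  have "set_decode S = Suc ` set_decode (S div 2) \<union> (if odd S then {0} else {})"
  proof (rule set_eqI)
    fix k show "k \<in> set_decode S \<longleftrightarrow> k \<in> Suc ` set_decode (S div 2) \<union> (if odd S then {0} else {})"
      by (cases k) auto
  qed
  also have "card \<dots> = card (Suc ` set_decode (S div 2)) + card (if odd S then {0::nat} else {})"
    by (rule card_Un_disjoint) auto
  also have "\<dots> = card (set_decode (S div 2)) + S mod 2"
    by (auto simp: card_image odd_iff_mod_2_eq_one)
  finally show ?thesis .
qed

lemma sum_lessThan_double: "(\<Sum>S<2 * N. f S) = (\<Sum>S<N. f (2 * S) + f (Suc (2 * S)))" for f :: "nat \<Rightarrow> nat"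
  by (induction N) auto

text \<open>Each player is outside \<open>S\<close>, in the chosen subset, or in the rest of
  \<open>S\<close>. In the induction a mask \<open>S\<close> has the extensions \<open>2 * S\<close>
  and \<open>Suc (2 * S)\<close>, which contribute the factors 1 and 2.\<close>

lemma sum_two_power_card: "(\<Sum>S<2 ^ l. 2 ^ card (set_decode S)) = (3 ^ l :: nat)"
proof (induction l)
  case (Suc l)
  have "card (set_decode (2 * S)) = card (set_decode S)"
    "card (set_decode (Suc (2 * S))) = Suc (card (set_decode S))" for S
    by (subst card_set_decode_rec; simp)+
  then have "(\<Sum>S<2 ^ Suc l. 2 ^ card (set_decode S)) = (\<Sum>S<2 ^ l. 3 * (2::nat) ^ card (set_decode S))"
    by (simp add: sum_lessThan_double)
  then show ?case using Suc by (simp flip: sum_distrib_left)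
qed simp

lemma set_decode_full: "set_decode (2 ^ l - 1) = {..<l}"
  by (auto simp: set_decode_def bit_mask_iff simp flip: bit_iff_odd mask_eq_exp_minus_1 simp del: One_nat_def)

lemma less_two_power_iff: "S < 2 ^ l \<longleftrightarrow> set_decode S \<subseteq> {..<l}"
proof
  show "set_decode S \<subseteq> {..<l}" if "S < 2 ^ l"
  proof
    fix i assume "i \<in> set_decode S"
    then have "odd (S div 2 ^ i)" by (simp add: set_decode_def)
    then have "S div 2 ^ i \<noteq> 0" by (metis even_zero)
    then have "2 ^ i \<le> S" by (metis div_less not_le_imp_less)
    then have "2 ^ i < (2::nat) ^ l" using that by (rule le_less_trans)
    then show "i \<in> {..<l}" by simp
  qed
next
  assume "set_decode S \<subseteq> {..<l}"
  moreover have "set_decode (2 ^ l - 1) = {..<l}" by (rule set_decode_full)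
  ultimately have "S \<le> 2 ^ l - 1" by (intro subset_decode_imp_le) simp
  moreover have "0 < (2::nat) ^ l" by simp
  ultimately show "S < 2 ^ l" by linarith
qed


lemma set_decode_two_power: "set_decode (2 ^ i) = {i}"
  by (auto simp: set_decode_def simp flip: bit_iff_odd simp: bit_exp_iff)

lemma and_two_power_pos_iff: "0 < and Y (2 ^ i) \<longleftrightarrow> i \<in> set_decode Y"
proof -
  have "and Y (2 ^ i) = 0 \<longleftrightarrow> set_decode (and Y (2 ^ i)) = {}"
    by (metis set_decode_inverse set_decode_zero set_encode_empty)
  then show ?thesis by (auto simp: set_decode_and set_decode_two_power)
qed

text \<open>Following \<open>l\<close> players through a table of \<open>2 ^ l * row\<close> entries
  costs a factor \<open>l * 2 ^ l\<close>; this keeps it within \<open>3 ^ l\<close> up to a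
  constant.\<close>

lemma mult_two_power_le: "l * 2 ^ l \<le> 2 * (3 ^ l :: nat)"
proof (induction l)
  case (Suc l)
  have "Suc l * 2 ^ Suc l = 2 * (l * 2 ^ l) + 2 * 2 ^ l" by simp
  also have "\<dots> \<le> 2 * (2 * 3 ^ l) + 2 * 3 ^ l" by (intro add_mono mult_le_mono2 Suc power_mono) auto
  finally show ?case by simp
qed simp

lemma less_three_power: "l < 3 ^ l"
  by (rule less_exp[THEN less_le_trans]) (simp add: power_mono)

section \<open>The dynamic programming table\<close>

text \<open>The running minimum over the candidates \<open>U\<close>. The machine stores finite
  reals only, so an infinite minimum is encoded by \<open>c = 0\<close>, with \<open>d\<close>
  arbitrary.\<close>

definition best :: "(nat \<times> real) set \<Rightarrow> nat \<Rightarrow> real \<Rightarrow> bool" where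
  "best U c d \<longleftrightarrow> (if c = 0 then U = {} else (c, d) \<in> U \<and> (\<forall>(c', d') \<in> U. d \<le> d'))"

lemma best_insert:
  assumes "best U c d" "0 < c'"
  shows "if c = 0 \<or> d' < d then best (insert (c', d') U) c' d' else best (insert (c', d') U) c d"
  using assms by (force simp: best_def split: if_splits)

locale numbered_arena = arena G r terms cost
  for G :: "(nat, nat) pre_digraph" and r terms cost +
  assumes numbered: "numbered G"
begin

abbreviation "n \<equiv> card (verts G)"
abbreviation "m \<equiv> card (arcs G)"
abbreviation "l \<equiv> length terms"

lemma verts_iff: "v \<in> verts G \<longleftrightarrow> v < n" and arcs_iff: "e \<in> arcs G \<longleftrightarrow> e < m"
  using numbered unfolding numbered_def by (metis lessThan_iff)+

lemma tail_less: "e < m \<Longrightarrow> tail G e < n" and head_less: "e < m \<Longrightarrow> head G e < n"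
  using head_in_verts tail_in_verts by (simp_all only: arcs_iff[symmetric] verts_iff[symmetric])

lemma root_less: "r < n" and n_pos: "0 < n" and terms_less: "i < l \<Longrightarrow> terms ! i < n"
proof -
  show "r < n" using root_in_verts verts_iff by simp
  then show "0 < n" by simp
  show "terms ! i < n" if "i < l" using terms_in_verts verts_iff nth_mem[OF that] by blast
qed

definition row :: nat where "row = (n + 1) * n"

text \<open>The mask is the most significant digit and the hop bound the next one. An arc leads from
  \<open>k\<close> to \<open>k - 1\<close> under the same mask, a split to smaller masks, so both go
  to smaller indices: the table can be filled in increasing order, and tracing back
  terminates.\<close>

definition idx :: "nat \<Rightarrow> nat \<Rightarrow> nat \<Rightarrow> nat" where
  "idx S k v = S * row + k * n + v"

lemma offset_less: assumes "k \<le> n" "v < n" shows "k * n + v < row"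
proof -
  have "k * n \<le> n * n" using assms(1) by (rule mult_le_mono1)
  then have "k * n + v < n * n + n" using assms(2) by linarith
  then show ?thesis by (simp add: row_def)
qed

lemma idx_decode:
  assumes "k \<le> n" "v < n"
  shows "idx S k v div row = S" "idx S k v mod row div n = k" "idx S k v mod n = v"
proof -
  have o: "k * n + v < row" using offset_less assms by blast
  have "idx S k v = S * row + (k * n + v)" by (simp add: idx_def)
  moreover have "(k * n + v) div n = k"
    using div_mult_self3[of n k v] assms(2) by (metis add_0_right div_less less_nat_zero_code)
  ultimately show "idx S k v div row = S" "idx S k v mod row div n = k" using o by simp_all
  have "idx S k v = v + (S * (n + 1) + k) * n" by (simp add: idx_def row_def algebra_simps)
  then show "idx S k v mod n = v" using assms(2) by (metis mod_mult_self1 mod_less)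
qed

lemma idx_encode:
  assumes "x < 2 ^ l * row"
  obtains S k v where "S < 2 ^ l" "k \<le> n" "v < n" "x = idx S k v"
proof
  have row: "0 < row" using n_pos by (simp add: row_def)
  show "x div row < 2 ^ l" using assms row by (simp add: less_mult_imp_div_less)
  have "x mod row < (n + 1) * n" 
    unfolding row_def by (rule mod_less_divisor) (use row in \<open>simp only: row_def\<close>)
  then have "x mod row div n < n + 1" by (simp add: less_mult_imp_div_less)
  then show "x mod row div n \<le> n" by simp
  show "x mod row mod n < n" using n_pos by simp
  show "x = idx (x div row) (x mod row div n) (x mod row mod n)" by (simp add: idx_def)
qed

lemma idx_less: assumes "S < 2 ^ l" "k \<le> n" "v < n" shows "idx S k v < 2 ^ l * row"
proof -
  have "(S + 1) * row \<le> 2 ^ l * row" using assms(1) by (intro mult_le_mono1) simp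
  then show ?thesis using offset_less[OF assms(2,3)] by (simp add: idx_def)
qed

lemma idx_less_mask: assumes "S' < S" "k \<le> n" "v < n" shows "idx S' k v < idx S k' v'"
proof -
  have "(S' + 1) * row \<le> S * row" using assms(1) by (intro mult_le_mono1) simp
  then show ?thesis using offset_less[OF assms(2,3)] by (simp add: idx_def)
qed

text \<open>The address arithmetic of the machine for following an arc. With \<open>k = 0\<close>
  the subtraction of \<open>n\<close> would leave the block of the mask \<open>S\<close>.\<close>

lemma idx_pred:
  assumes "0 < k" "k \<le> n" "v < n"
  shows "idx S k v - v - n + w = idx S (k - 1) w" and "w < n \<Longrightarrow> idx S (k - 1) w < idx S k v"
  using assms by (cases k; simp add: idx_def)+

text \<open>Code \<open>1\<close> of a table entry stands for the end of a path, \<open>e + 2\<close> for the arc \<open>e\<close>, and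
  \<open>Y + m + 2\<close> for splitting off the players in \<open>Y\<close>; code \<open>0\<close> marks an infinite entry.\<close>

definition end_opts :: "nat \<Rightarrow> nat \<Rightarrow> (nat \<times> real) set" where
  "end_opts S v = {(1, 0) | i. i < l \<and> S = 2 ^ i \<and> v = terms ! i}"

definition arc_opt :: "(nat \<Rightarrow> nat) \<Rightarrow> (nat \<Rightarrow> real) \<Rightarrow> nat \<Rightarrow> nat \<Rightarrow> nat \<Rightarrow> nat \<Rightarrow> (nat \<times> real) set" where
  "arc_opt ch D S k v e =
     (if tail G e = v \<and> 0 < ch (idx S (k - 1) (head G e))
      then {(e + 2, cost_sum e (card (set_decode S)) + D (idx S (k - 1) (head G e)))} else {})"

definition split_opt :: "(nat \<Rightarrow> nat) \<Rightarrow> (nat \<Rightarrow> real) \<Rightarrow> nat \<Rightarrow> nat \<Rightarrow> nat \<Rightarrow> (nat \<times> real) set" where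
  "split_opt ch D S v Y =
     (if 0 < ch (idx Y n v) \<and> 0 < ch (idx (S - Y) n v)
      then {(Y + m + 2, D (idx Y n v) + D (idx (S - Y) n v))} else {})"

definition opts :: "(nat \<Rightarrow> nat) \<Rightarrow> (nat \<Rightarrow> real) \<Rightarrow> nat \<Rightarrow> nat \<Rightarrow> nat \<Rightarrow> (nat \<times> real) set" where
  "opts ch D S k v = end_opts S v \<union> (\<Union>e \<in> {e. e < m \<and> 0 < k}. arc_opt ch D S k v e) \<union>
     (\<Union>Y \<in> {Y. set_decode Y \<subseteq> set_decode S \<and> 0 < Y \<and> Y < S}. split_opt ch D S v Y)"

text \<open>A fixpoint condition: the options of an entry are evaluated in the very arrays that hold
  the entry.\<close>

definition filled :: "nat \<Rightarrow> (nat \<Rightarrow> nat) \<Rightarrow> (nat \<Rightarrow> real) \<Rightarrow> bool" where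
  "filled x ch D \<longleftrightarrow> (\<forall>S<2 ^ l. \<forall>k\<le>n. \<forall>v<n. idx S k v < x \<longrightarrow>
     best (opts ch D S k v) (ch (idx S k v)) (D (idx S k v)))"

text \<open>Options read smaller indices only, so writing the current entry leaves the options of
  this entry and of all earlier ones unchanged.\<close>

lemma opts_cong:
  assumes "k \<le> n" "v < n" "\<And>y. y < idx S k v \<Longrightarrow> ch' y = ch y \<and> D' y = D y"
  shows "opts ch' D' S k v = opts ch D S k v"
proof -
  have "arc_opt ch' D' S k v e = arc_opt ch D S k v e" if "e < m" "0 < k" for e
    using assms(3)[OF idx_pred(2)[OF that(2) assms(1,2) head_less[OF that(1)]]]
    by (simp add: arc_opt_def)
  moreover have "split_opt ch' D' S v Y = split_opt ch D S v Y" if "0 < Y" "Y < S" for Y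
    using assms(3)[OF idx_less_mask[of Y S n v k v]] assms(3)[OF idx_less_mask[of "S - Y" S n v k v]] assms(2) that
    by (simp add: split_opt_def)
  ultimately show ?thesis by (auto simp: opts_def)
qed

section \<open>The table bounds every profile from below\<close>

lemma full_mask_less: "2 ^ l - 1 < (2::nat) ^ l"
  by simp

abbreviation "apex \<equiv> idx (2 ^ l - 1) n r"

context
  fixes ch :: "nat \<Rightarrow> nat" and D :: "nat \<Rightarrow> real"
  assumes filled: "filled (2 ^ l * row) ch D"
begin

lemma table_best:
  assumes "S < 2 ^ l" "k \<le> n" "v < n"
  shows "best (opts ch D S k v) (ch (idx S k v)) (D (idx S k v))"
  using filled assms idx_less[OF assms] by (auto simp: filled_def)

lemma table_le:
  assumes "S < 2 ^ l" "k \<le> n" "v < n" "(c, d) \<in> opts ch D S k v"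
  shows "0 < ch (idx S k v) \<and> D (idx S k v) \<le> d"
  using table_best[OF assms(1-3)] assms(4) by (auto simp: best_def split: if_splits)

text \<open>The recursion inequalities are applied to a tree-like optimum \<open>s'\<close>, since
  \<open>s\<close> itself need not be tree-like; optimality of \<open>s'\<close> then transfers the
  bound to \<open>s\<close>.\<close>

lemma table_le_potential:
  assumes s: "s \<in> profiles" and l: "0 < l"
  shows "0 < ch apex \<and> D apex \<le> potential s"
proof -
  obtain s' where s': "optimal_profile s'" "tree_like (\<lambda>i. s' ! i) {..<l}"
    using tree_like_optimum s by blast
  then have p: "s' \<in> profiles" and le: "potential s' \<le> potential s" using s by (auto simp: optimal_profile_def)
  have enc: "set_encode X < 2 ^ l" if "X \<subseteq> {..<l}" for X
    using that finite_subset[OF that] by (simp add: less_two_power_iff)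
  have ap: "apath r (s' ! i) (terms ! i)" if "i < l" for i using p that by (auto simp: profiles_def)
  have "0 < ch (idx (set_encode {..<l}) n r) \<and>
    D (idx (set_encode {..<l}) n r) \<le> family_cost (\<lambda>i. s' ! i) {..<l}"
  proof (rule table_le_tree_like[where K = n and ok = "\<lambda>X k v. 0 < ch (idx (set_encode X) k v)"
        and val = "\<lambda>X k v. D (idx (set_encode X) k v)" and k = n])
    fix i k assume i: "i < l" and k: "k \<le> n"
    have "set_encode {i} = 2 ^ i" by simp
    moreover have "(1, 0) \<in> opts ch D (2 ^ i) k (terms ! i)"
      using i by (auto simp: opts_def end_opts_def)
    moreover have "2 ^ i < (2::nat) ^ l" using i by simp
    ultimately show "0 < ch (idx (set_encode {i}) k (terms ! i)) \<and> D (idx (set_encode {i}) k (terms ! i)) \<le> 0"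
      using table_le[of "2 ^ i" k "terms ! i"] k terms_less[OF i] by simp
  next
    fix X k e assume h: "X \<subseteq> {..<l}" "e \<in> arcs G" "k < n" "0 < ch (idx (set_encode X) k (head G e))"
    then have e: "e < m" using arcs_iff by simp
    have "finite X" using h(1) finite_subset by blast
    then have "(e + 2, cost_sum e (card X) + D (idx (set_encode X) k (head G e)))
      \<in> arc_opt ch D (set_encode X) (Suc k) (tail G e) e" using h(4) by (simp add: arc_opt_def)
    then have "(e + 2, cost_sum e (card X) + D (idx (set_encode X) k (head G e)))
      \<in> opts ch D (set_encode X) (Suc k) (tail G e)" using e unfolding opts_def by blast
    then show "0 < ch (idx (set_encode X) (Suc k) (tail G e)) \<and>
      D (idx (set_encode X) (Suc k) (tail G e)) \<le> cost_sum e (card X) + D (idx (set_encode X) k (head G e))"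
      using table_le[OF enc[OF h(1)] _ tail_less[OF e]] h(3) by simp
  next
    fix Y Z k v
    assume h: "Y \<subseteq> {..<l}" "Z \<subseteq> {..<l}" "Y \<inter> Z = {}" "Y \<noteq> {}" "Z \<noteq> {}" "k \<le> n" "v \<in> verts G"
      "0 < ch (idx (set_encode Y) n v)" "0 < ch (idx (set_encode Z) n v)"
    have fin: "finite Y" "finite Z" using h(1,2) finite_subset by blast+
    \<comment> \<open>Encodings of disjoint sets add up, so subtracting the mask of \<open>Y\<close>
      from that of \<open>Y \<union> Z\<close> gives the mask of \<open>Z\<close>, as
      \<open>split_opt\<close> expects.\<close>
    have e: "set_encode (Y \<union> Z) = set_encode Y + set_encode Z"
      unfolding set_encode_def using fin h(3) by (simp add: sum.union_disjoint)
    have pos: "0 < set_encode X" if "finite X" "X \<noteq> {}" for X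
      using that by (metis gr0I set_encode_inverse set_decode_zero)
    have "(set_encode Y + m + 2, D (idx (set_encode Y) n v) + D (idx (set_encode Z) n v))
      \<in> split_opt ch D (set_encode (Y \<union> Z)) v (set_encode Y)"
      using h(8,9) by (simp add: split_opt_def e)
    moreover have "set_decode (set_encode Y) \<subseteq> set_decode (set_encode (Y \<union> Z))"
      using fin by (subst (1 2) set_encode_inverse) auto
    moreover have "0 < set_encode Y" "set_encode Y < set_encode (Y \<union> Z)"
      using pos[OF fin(1) h(4)] pos[OF fin(2) h(5)] e by simp_all
    ultimately have "(set_encode Y + m + 2, D (idx (set_encode Y) n v) + D (idx (set_encode Z) n v))
      \<in> opts ch D (set_encode (Y \<union> Z)) k v" unfolding opts_def by blast
    then show "0 < ch (idx (set_encode (Y \<union> Z)) k v) \<and>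
      D (idx (set_encode (Y \<union> Z)) k v) \<le> D (idx (set_encode Y) n v) + D (idx (set_encode Z) n v)"
      using table_le[OF enc[of "Y \<union> Z"] h(6)] h(1,2,7) verts_iff by simp
  next
    \<comment> \<open>A simple path has at most \<open>n\<close> arcs, so the hop bound
      \<open>n\<close> excludes none.\<close>
    show "length (s' ! i) \<le> n" if "i \<in> {..<l}" for i using length_apath[OF ap[of i]] that by simp
  qed (use l ap s'(2) in auto)
  moreover have "set_encode {..<l} = 2 ^ l - 1"
    by (metis set_decode_full set_decode_inverse)
  ultimately show ?thesis using le potential_eq_family_cost[OF p] by simp
qed

end

section \<open>Following one player from the apex of the table\<close>

definition nxt :: "(nat \<Rightarrow> nat) \<Rightarrow> nat \<Rightarrow> nat \<Rightarrow> nat" where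
  "nxt ch i x = (if ch x < m + 2 then x - x mod n - n + head G (ch x - 2)
     else (let Y = ch x - (m + 2) in
       (if i \<in> set_decode Y then Y else x div row - Y) * row + n * n + x mod n))"

text \<open>The test \<open>x \<le> nxt ch i x\<close> forces termination for an arbitrary array
  \<open>ch\<close>. In a filled table it never fires at a finite entry with code above 1, since
  arcs and splits lead to smaller indices.\<close>

function trace :: "(nat \<Rightarrow> nat) \<Rightarrow> nat \<Rightarrow> nat \<Rightarrow> nat list" where
  "trace ch i x = (if ch x < 2 \<or> x \<le> nxt ch i x then []
     else if ch x < m + 2 then (ch x - 2) # trace ch i (nxt ch i x) else trace ch i (nxt ch i x))"
  by auto
termination by (relation "measure (\<lambda>(ch, i, x). x)") auto

declare trace.simps [simp del]

context
  fixes ch :: "nat \<Rightarrow> nat" and D :: "nat \<Rightarrow> real"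
  assumes filled: "filled (2 ^ l * row) ch D"
begin

text \<open>Inverts a finite entry: the option attaining the minimum is tied to the next index and
  to one step of \<open>trace\<close>. The abstract argument and the machine steps share this case
  analysis.\<close>

lemma table_cases:
  assumes "S < 2 ^ l" "k \<le> n" "v < n" and x: "x = idx S k v" and ch: "0 < ch x"
  obtains (End) i where "ch x = 1" "D x = 0" "i < l" "S = 2 ^ i" "v = terms ! i"
  | (Arc) e where "ch x = e + 2" "e < m" "tail G e = v" "0 < k"
      "0 < ch (idx S (k - 1) (head G e))" "D x = cost_sum e (card (set_decode S)) + D (idx S (k - 1) (head G e))"
      "\<And>i. nxt ch i x = idx S (k - 1) (head G e)" "idx S (k - 1) (head G e) < x"
      "\<And>i. trace ch i x = e # trace ch i (idx S (k - 1) (head G e))"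
  | (Split) Y where "ch x = Y + m + 2" "set_decode Y \<subseteq> set_decode S" "0 < Y" "Y < S"
      "0 < ch (idx Y n v)" "0 < ch (idx (S - Y) n v)" "D x = D (idx Y n v) + D (idx (S - Y) n v)"
      "idx Y n v < x" "idx (S - Y) n v < x"
      "\<And>i. nxt ch i x = (if i \<in> set_decode Y then idx Y n v else idx (S - Y) n v)"
      "\<And>i. trace ch i x = (if i \<in> set_decode Y then trace ch i (idx Y n v) else trace ch i (idx (S - Y) n v))"
proof -
  note dec = idx_decode[OF assms(2,3), of S]
  have "(ch x, D x) \<in> opts ch D S k v"
    using table_best[OF filled assms(1-3)] ch unfolding x by (auto simp: best_def)
  then consider "(ch x, D x) \<in> end_opts S v"
    | e where "e < m" "0 < k" "(ch x, D x) \<in> arc_opt ch D S k v e"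
    | Y where "set_decode Y \<subseteq> set_decode S" "0 < Y" "Y < S" "(ch x, D x) \<in> split_opt ch D S v Y"
    unfolding opts_def by blast
  then show ?thesis
  proof cases
    case 1
    then show ?thesis using End by (auto simp: end_opts_def)
  next
    case (2 e)
    have ce: "ch x = e + 2" "tail G e = v" using 2(3) by (auto simp: arc_opt_def split: if_splits)
    have nx: "nxt ch i x = idx S (k - 1) (head G e)" for i
      using ce 2(1) idx_pred(1)[OF 2(2) assms(2,3)] by (simp add: nxt_def x dec)
    have less: "idx S (k - 1) (head G e) < x"
      using idx_pred(2)[OF 2(2) assms(2,3) head_less[OF 2(1)]] x by simp
    have "trace ch i x = e # trace ch i (idx S (k - 1) (head G e))" for i
      using ce 2(1) nx less by (subst trace.simps) simp
    then show ?thesis using Arc[of e] 2 ce nx less by (auto simp: arc_opt_def split: if_splits)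
  next
    case (3 Y)
    have ce: "ch x = Y + m + 2" using 3(4) by (auto simp: split_opt_def split: if_splits)
    have nx: "nxt ch i x = (if i \<in> set_decode Y then idx Y n v else idx (S - Y) n v)" for i
      using ce dec by (simp add: nxt_def x[symmetric]) (simp add: idx_def)
    have less: "idx Y n v < x" "idx (S - Y) n v < x"
      unfolding x using 3 assms(3) by (auto intro!: idx_less_mask)
    have "trace ch i x = (if i \<in> set_decode Y then trace ch i (idx Y n v) else trace ch i (idx (S - Y) n v))" for i
      using ce nx less by (subst trace.simps) auto
    then show ?thesis using Split[of Y] 3 ce nx less by (auto simp: split_opt_def split: if_splits)
  qed
qed

text \<open>The upper bound, by induction on the table index. Both sources of slack go in the right
  direction: a walk may repeat an arc, and the two groups of a split may share arcs later.\<close>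

lemma trace_walks:
  assumes "S < 2 ^ l" "k \<le> n" "v < n" "0 < ch (idx S k v)"
  shows "(\<forall>i \<in> set_decode S. awalk v (trace ch i (idx S k v)) (terms ! i)) \<and>
    family_cost (\<lambda>i. trace ch i (idx S k v)) (set_decode S) \<le> D (idx S k v)"
  using assms
proof (induction "idx S k v" arbitrary: S k v rule: less_induct)
  case less
  have vG: "v \<in> verts G" using less.prems(3) verts_iff by simp
  from less.prems(1-3) refl less.prems(4) show ?case
  proof (cases rule: table_cases)
    case (End i)
    have "trace ch j (idx S k v) = []" for j using End by (subst trace.simps) simp
    moreover have "set_decode S = {i}" using End set_decode_two_power by simp
    ultimately show ?thesis using End vG by (simp add: awalk_Nil_iff family_cost_def load_def)
  next
    case (Arc e)
    have eG: "e \<in> arcs G" using Arc(2) arcs_iff by simp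
    let ?y = "idx S (k - 1) (head G e)"
    have IH: "(\<forall>i \<in> set_decode S. awalk (head G e) (trace ch i ?y) (terms ! i)) \<and>
      family_cost (\<lambda>i. trace ch i ?y) (set_decode S) \<le> D ?y"
      by (rule less.hyps) (use Arc less.prems head_less in auto)
    moreover have "family_cost (\<lambda>i. trace ch i (idx S k v)) (set_decode S) \<le>
      cost_sum e (card (set_decode S)) + family_cost (\<lambda>i. trace ch i ?y) (set_decode S)"
      unfolding Arc(9) by (rule family_cost_Cons(1)) (rule eG)
    ultimately show ?thesis using Arc(3,6) eG vG by (auto simp: Arc(9) awalk_Cons_iff)
  next
    case (Split Y)
    let ?A = "set_decode Y" and ?B = "set_decode (S - Y)"
    have B: "?B = set_decode S - ?A" using set_decode_diff[OF Split(2)] .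
    have "(\<forall>i \<in> ?A. awalk v (trace ch i (idx Y n v)) (terms ! i)) \<and>
      family_cost (\<lambda>i. trace ch i (idx Y n v)) ?A \<le> D (idx Y n v)"
      by (rule less.hyps) (use Split less.prems in auto)
    moreover have "(\<forall>i \<in> ?B. awalk v (trace ch i (idx (S - Y) n v)) (terms ! i)) \<and>
      family_cost (\<lambda>i. trace ch i (idx (S - Y) n v)) ?B \<le> D (idx (S - Y) n v)"
      by (rule less.hyps) (use Split less.prems in auto)
    moreover have "family_cost (\<lambda>i. trace ch i (idx S k v)) (?A \<union> ?B) \<le>
      family_cost (\<lambda>i. trace ch i (idx S k v)) ?A + family_cost (\<lambda>i. trace ch i (idx S k v)) ?B"
      by (rule family_cost_Un_le) (auto simp: B)
    moreover have "family_cost (\<lambda>i. trace ch i (idx S k v)) ?A = family_cost (\<lambda>i. trace ch i (idx Y n v)) ?A"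
      by (rule family_cost_cong) (simp add: Split(11))
    moreover have "family_cost (\<lambda>i. trace ch i (idx S k v)) ?B = family_cost (\<lambda>i. trace ch i (idx (S - Y) n v)) ?B"
      by (rule family_cost_cong) (simp add: Split(11) B)
    moreover have "?A \<union> ?B = set_decode S" using Split(2) B by auto
    ultimately show ?thesis using Split(7) B by (auto simp: Split(11))
  qed
qed

text \<open>Only inclusion in the arcs of the trace is required, so it does not matter how cycles
  are removed. The upper bound for \<open>s\<close> and the lower bound for all profiles meet at
  \<open>D apex\<close>.\<close>

lemma optimal_from_table:
  assumes "0 < l" "0 < ch apex" "length s = l"
    and "\<And>i. i < l \<Longrightarrow> apath r (s ! i) (terms ! i)"
    and "\<And>i. i < l \<Longrightarrow> set (s ! i) \<subseteq> set (trace ch i apex)"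
  shows "optimal_profile s \<and> potential s = D apex"
proof -
  have s: "s \<in> profiles" using assms by (simp add: profiles_def)
  have "family_cost (\<lambda>i. s ! i) {..<l} \<le> family_cost (\<lambda>i. trace ch i apex) {..<l}"
    by (rule family_cost_mono) (use assms in auto)
  also have "\<dots> \<le> D apex"
    using trace_walks[OF full_mask_less order_refl root_less assms(2)] by (simp only: set_decode_full)
  finally have "potential s \<le> D apex" using potential_eq_family_cost[OF s] by simp
  then show ?thesis
    using s table_le_potential[OF filled _ assms(1)] unfolding optimal_profile_def
    by (meson order.antisym order_trans)
qed

end

end

section \<open>Preprocessing\<close>

abbreviation V :: "string \<Rightarrow> nexp" where "V x \<equiv> NCell x (Const 0)"
abbreviation NSet :: "string \<Rightarrow> nexp \<Rightarrow> com" where "NSet x a \<equiv> NAssign x (Const 0) a"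
abbreviation NEq :: "nexp \<Rightarrow> nexp \<Rightarrow> bexp" where "NEq a b \<equiv> BConj (BNot (NLess a b)) (BNot (NLess b a))"
abbreviation Inc :: "nexp \<Rightarrow> nexp" where "Inc a \<equiv> Op Plus a (Const 1)"
notation Seq (infixr ";;" 60)

text \<open>Terminals are stored shifted by one at the singleton masks, so that 0 means "not a
  singleton". Whether a mask is that of one player with terminal \<open>v\<close> then takes one
  comparison. On exit \<open>p\<close> holds \<open>2 ^ l\<close>.\<close>

definition mask_body :: com where
  "mask_body = NAssign ''tv'' (V ''p'') (Inc (NCell ''term'' (V ''i''))) ;;
     NSet ''p'' (Op Plus (V ''p'') (V ''p'')) ;; NSet ''i'' (Inc (V ''i''))"

definition mask_prog :: com where
  "mask_prog = NSet ''p'' (Const 1) ;; NSet ''i'' (Const 0) ;; While (NLess (V ''i'') (V ''l'')) mask_body"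

text \<open>The size of a player set comes from the size for the mask shifted right by one. Counting
  bits afresh for each mask would cost a factor \<open>l\<close>.\<close>

definition count_body :: com where
  "count_body = NAssign ''cnt'' (V ''S'')
       (Op Plus (NCell ''cnt'' (Op Div (V ''S'') (Const 2))) (Op Mod (V ''S'') (Const 2))) ;;
     NSet ''S'' (Inc (V ''S''))"

definition count_prog :: com where
  "count_prog = NSet ''S'' (Const 0) ;; While (NLess (V ''S'') (V ''p'')) count_body"

text \<open>Cell \<open>k * m + e\<close> of \<open>CS\<close> holds \<open>cost_sum e k\<close>.
  Row 0 consists of the initial zeros, and step \<open>x\<close> writes the cell one row above
  \<open>x\<close>.\<close>

definition cost_body :: com where
  "cost_body = RAssign ''CS'' (Op Plus (V ''x'') (V ''m''))
       (RPlus (RCell ''CS'' (V ''x'')) (Cost (Op Mod (V ''x'') (V ''m'')) (Inc (Op Div (V ''x'') (V ''m''))))) ;;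
     NSet ''x'' (Inc (V ''x''))"

definition cost_prog :: com where
  "cost_prog = NSet ''x'' (Const 0) ;; NSet ''q'' (Op Times (V ''l'') (V ''m'')) ;;
     While (NLess (V ''x'') (V ''q'')) cost_body"

lemma writes_bodies [simp]:
  "nwrites mask_body = {''tv'', ''p'', ''i''}" "rwrites mask_body = {}"
  "nwrites count_body = {''cnt'', ''S''}" "rwrites count_body = {}"
  "nwrites cost_body = {''x''}" "rwrites cost_body = {''CS''}"
  by (auto simp: mask_body_def count_body_def cost_body_def)

lemma writes_progs [simp]:
  "nwrites mask_prog = {''tv'', ''p'', ''i''}" "rwrites mask_prog = {}"
  "nwrites count_prog = {''cnt'', ''S''}" "rwrites count_prog = {}"
  "nwrites cost_prog = {''x'', ''q''}" "rwrites cost_prog = {''CS''}"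
  by (auto simp: mask_prog_def count_prog_def cost_prog_def)

declare nfits.simps(3) [simp del]

lemma nfits_growing [simp]:
  "nfits W st (Op Plus a b) \<longleftrightarrow> nfits W st a \<and> nfits W st b \<and> nval st a + nval st b \<le> W"
  "nfits W st (Op Times a b) \<longleftrightarrow> nfits W st a \<and> nfits W st b \<and> nval st a * nval st b \<le> W"
  by (simp_all add: nfits.simps(3))

text \<open>The result of these operations never exceeds the left operand, so only sums and products
  give rise to new word bound obligations.\<close>

lemma nfits_shrinking [simp]:
  "nfits W st (Op Minus a b) \<longleftrightarrow> nfits W st a \<and> nfits W st b"
  "nfits W st (Op Div a b) \<longleftrightarrow> nfits W st a \<and> nfits W st b"
  "nfits W st (Op Mod a b) \<longleftrightarrow> nfits W st a \<and> nfits W st b"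
  "nfits W st (Op BitAnd a b) \<longleftrightarrow> nfits W st a \<and> nfits W st b"
  using nfits_imp_le[of W st a] le_trans[OF diff_le_self, of "nval st a"] le_trans[OF div_le_dividend, of "nval st a"]
    le_trans[OF mod_less_eq_dividend, of "nval st a"] le_trans[OF and_nat_le, of "nval st a"]
  by (auto simp: nfits.simps(3))

text \<open>The summands bound, in this order, the table indices, the cells of \<open>CS\<close> and
  \<open>path\<close>, and the masks; \<open>2 ^ l + m\<close> together with the constant covers the
  codes.\<close>

locale machine_run = numbered_arena +
  fixes W :: nat
  assumes W: "2 ^ l * row + (l + 1) * (m + n + 1) + 2 ^ l + m + 10 \<le> W"
begin

lemma index_le: "x \<le> 2 ^ l * row \<Longrightarrow> x \<le> W"
  and mask_le: "S \<le> 2 ^ l \<Longrightarrow> S \<le> W"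
  and code_le: "c \<le> 2 ^ l + m + 2 \<Longrightarrow> c \<le> W"
  and cell_le: "y \<le> (l + 1) * (m + n + 1) \<Longrightarrow> y \<le> W"
  using W by linarith+

lemma small_le: "l + 1 \<le> W" "m \<le> W" "n \<le> W" "row \<le> W" "1 \<le> W" "2 \<le> W" "n * n \<le> W"
proof -
  show "l + 1 \<le> W" "m \<le> W" "n \<le> W" "1 \<le> W" by (rule cell_le; simp)+
  show "2 \<le> W" by (rule code_le) simp
  show "row \<le> W" by (rule index_le) simp
  then show "n * n \<le> W" by (simp add: row_def)
qed

section \<open>Correctness of the preprocessing loops\<close>

definition inp :: "state \<Rightarrow> bool" where
  "inp st \<longleftrightarrow> nmem st ''n'' 0 = n \<and> nmem st ''m'' 0 = m \<and>
     nmem st ''tail'' = contents (map (tail G) [0..<m]) \<and>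
     nmem st ''head'' = contents (map (head G) [0..<m]) \<and>
     nmem st ''root'' 0 = r \<and> nmem st ''l'' 0 = l \<and> nmem st ''term'' = contents terms"

lemma inpD:
  assumes "inp st"
  shows "nmem st ''n'' 0 = n" "nmem st ''m'' 0 = m" "nmem st ''root'' 0 = r" "nmem st ''l'' 0 = l"
    "e < m \<Longrightarrow> nmem st ''tail'' e = tail G e" "e < m \<Longrightarrow> nmem st ''head'' e = head G e"
    "i < l \<Longrightarrow> nmem st ''term'' i = terms ! i" "nmem st ''tail'' y \<le> W"
  using assms tail_less[of y] small_le(3) by (auto simp: inp_def contents_def)

lemma inp_frame:
  assumes "inp st" "frame p st st'"
    "nwrites p \<inter> {''n'', ''m'', ''tail'', ''head'', ''root'', ''l'', ''term''} = {}"
  shows "inp st'"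
proof -
  have "nmem st' y = nmem st y" if "y \<in> {''n'', ''m'', ''tail'', ''head'', ''root'', ''l'', ''term''}" for y
    using assms(2,3) that by (intro frame_nmem) auto
  then show ?thesis using assms(1) by (simp add: inp_def)
qed

definition marks :: "nat \<Rightarrow> state \<Rightarrow> bool" where
  "marks i st \<longleftrightarrow> (\<forall>S v. nmem st ''tv'' S = Suc v \<longleftrightarrow> (\<exists>j<i. S = 2 ^ j \<and> v = terms ! j))"

lemma runs_masks:
  assumes inp: "inp st" and tv: "nmem st ''tv'' = (\<lambda>_. 0)"
  shows "runs cost W mask_prog st (50 * l + 50) (\<lambda>st'. nmem st' ''p'' 0 = 2 ^ l \<and> marks l st')"
  unfolding mask_prog_def
proof (rule runs_Seq[of _ _ _ _ 10 "\<lambda>st'. inp st' \<and> nmem st' ''tv'' = (\<lambda>_. 0) \<and> nmem st' ''p'' 0 = 1"])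
  show "runs cost W (NSet ''p'' (Const 1)) st 10
     (\<lambda>st'. inp st' \<and> nmem st' ''tv'' = (\<lambda>_. 0) \<and> nmem st' ''p'' 0 = 1)"
    by (rule runs_loopfree) (use inp tv small_le in \<open>simp_all add: inp_def\<close>)
next
  fix st :: state assume st: "inp st \<and> nmem st ''tv'' = (\<lambda>_. 0) \<and> nmem st ''p'' 0 = 1"
  show "runs cost W (NSet ''i'' (Const 0) ;; While (NLess (V ''i'') (V ''l'')) mask_body) st (50 * l + 40)
    (\<lambda>st'. nmem st' ''p'' 0 = 2 ^ l \<and> marks l st')"
  proof (rule runs_Seq[of _ _ _ _ 10 "\<lambda>st'. inp st' \<and> nmem st' ''tv'' = (\<lambda>_. 0) \<and> nmem st' ''p'' 0 = 1 \<and> nmem st' ''i'' 0 = 0"])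
    show "runs cost W (NSet ''i'' (Const 0)) st 10
      (\<lambda>st'. inp st' \<and> nmem st' ''tv'' = (\<lambda>_. 0) \<and> nmem st' ''p'' 0 = 1 \<and> nmem st' ''i'' 0 = 0)"
      by (rule runs_loopfree) (use st in \<open>simp_all add: inp_def\<close>)
  next
    fix st0 :: state assume st0: "inp st0 \<and> nmem st0 ''tv'' = (\<lambda>_. 0) \<and> nmem st0 ''p'' 0 = 1 \<and> nmem st0 ''i'' 0 = 0"
    show "runs cost W (While (NLess (V ''i'') (V ''l'')) mask_body) st0 (50 * l + 30)
      (\<lambda>st'. nmem st' ''p'' 0 = 2 ^ l \<and> marks l st')"
    proof (rule runs_For[where N = l and f = "\<lambda>_. 40" and
          I = "\<lambda>i st. nmem st ''i'' 0 = i \<and> nmem st ''p'' 0 = 2 ^ i \<and> marks i st"])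
      show "nmem st0 ''i'' 0 = 0 \<and> nmem st0 ''p'' 0 = 2 ^ 0 \<and> marks 0 st0"
        using st0 by (simp add: marks_def)
    next
      fix i and st :: state assume fr: "frame mask_body st0 st" and I: "nmem st ''i'' 0 = i \<and> nmem st ''p'' 0 = 2 ^ i \<and> marks i st"
      have inp: "inp st" using st0 fr by (auto intro: inp_frame)
      note inpD[OF inp, simp]
      show "bfits W st (NLess (V ''i'') (V ''l'')) \<and> (bval cost st (NLess (V ''i'') (V ''l'')) \<longleftrightarrow> i < l)" if "i \<le> l"
        using I that small_le(1) by simp
      assume i: "i < l"
      have p: "2 ^ i \<le> W" "2 ^ i + 2 ^ i \<le> W"
        using power_increasing[of "Suc i" l "2::nat"] i by (auto intro!: mask_le)
      have t: "Suc (terms ! i) \<le> W" using terms_less[OF i] small_le(3) by simp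
      have "marks (Suc i) (nput ''i'' 0 (Suc i) (nput ''p'' 0 (2 ^ i + 2 ^ i) (nput ''tv'' (2 ^ i) (Suc (terms ! i)) st)))"
        using I unfolding marks_def by (auto simp: less_Suc_eq)
      then show "runs cost W mask_body st 40 (\<lambda>st. nmem st ''i'' 0 = Suc i \<and> nmem st ''p'' 0 = 2 ^ Suc i \<and> marks (Suc i) st)"
        unfolding mask_body_def
        by (intro runs_loopfree) (use I i p t small_le in \<open>simp_all\<close>)
    qed simp_all
  qed simp
qed simp

definition counted :: "state \<Rightarrow> bool" where
  "counted st \<longleftrightarrow> (\<forall>S<2 ^ l. nmem st ''cnt'' S = card (set_decode S))"

lemma card_mask_le: "S < 2 ^ l \<Longrightarrow> card (set_decode S) \<le> l"
  using card_mono[of "{..<l}" "set_decode S"] by (simp add: less_two_power_iff)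

lemma runs_count:
  assumes p: "nmem st ''p'' 0 = 2 ^ l" and c0: "nmem st ''cnt'' 0 = 0"
  shows "runs cost W count_prog st (50 * 2 ^ l + 50) counted"
  unfolding count_prog_def
proof (rule runs_Seq[of _ _ _ _ 10 "\<lambda>st'. nmem st' ''p'' 0 = 2 ^ l \<and> nmem st' ''cnt'' 0 = 0 \<and> nmem st' ''S'' 0 = 0"])
  show "runs cost W (NSet ''S'' (Const 0)) st 10
    (\<lambda>st'. nmem st' ''p'' 0 = 2 ^ l \<and> nmem st' ''cnt'' 0 = 0 \<and> nmem st' ''S'' 0 = 0)"
    by (rule runs_loopfree) (use p c0 in simp_all)
next
  fix st0 :: state assume st0: "nmem st0 ''p'' 0 = 2 ^ l \<and> nmem st0 ''cnt'' 0 = 0 \<and> nmem st0 ''S'' 0 = 0"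
  show "runs cost W (While (NLess (V ''S'') (V ''p'')) count_body) st0 (50 * 2 ^ l + 30) counted"
  proof (rule runs_For[where N = "2 ^ l" and f = "\<lambda>_. 40" and
      I = "\<lambda>i st. nmem st ''S'' 0 = i \<and> nmem st ''cnt'' 0 = 0 \<and> (\<forall>S<i. nmem st ''cnt'' S = card (set_decode S))"])
    show "nmem st0 ''S'' 0 = 0 \<and> nmem st0 ''cnt'' 0 = 0 \<and> (\<forall>S<0. nmem st0 ''cnt'' S = card (set_decode S))"
      using st0 by simp
  next
    fix i and st :: state assume fr: "frame count_body st0 st"
      and I: "nmem st ''S'' 0 = i \<and> nmem st ''cnt'' 0 = 0 \<and> (\<forall>S<i. nmem st ''cnt'' S = card (set_decode S))"
    have p: "nmem st ''p'' 0 = 2 ^ l" using frame_nmem[OF fr, of "''p''"] st0 by simp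
    show "bfits W st (NLess (V ''S'') (V ''p'')) \<and> (bval cost st (NLess (V ''S'') (V ''p'')) \<longleftrightarrow> i < 2 ^ l)" if "i \<le> 2 ^ l"
      using I p that mask_le by simp
    assume i: "i < 2 ^ l"
    \<comment> \<open>For \<open>i = 0\<close> the halved mask is 0 itself and not yet processed;
      the initial zero in that cell is already the right value.\<close>
    have half: "nmem st ''cnt'' (i div 2) = card (set_decode (i div 2))"
    proof (cases "i = 0")
      case False
      then show ?thesis using I by simp
    qed (use I in simp)
    have full: "nmem st ''cnt'' (i div 2) + i mod 2 = card (set_decode i)"
      unfolding half by (rule card_set_decode_rec[symmetric])
    have le: "card (set_decode i) \<le> W" using card_mask_le[OF i] small_le(1) by simp
    have le2: "nmem st ''cnt'' (i div 2) \<le> W" using full le by linarith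
    have z: "card (set_decode 0) = 0" by simp
    show "runs cost W count_body st 40 (\<lambda>st. nmem st ''S'' 0 = Suc i \<and> nmem st ''cnt'' 0 = 0 \<and>
        (\<forall>S<Suc i. nmem st ''cnt'' S = card (set_decode S)))"
      unfolding count_body_def
      by (intro runs_loopfree)
        (use I i le le2 full mask_le[of i] mask_le[of "Suc i"] small_le z in \<open>auto simp: less_Suc_eq\<close>)
  next
    fix st :: state assume "nmem st ''S'' 0 = 2 ^ l \<and> nmem st ''cnt'' 0 = 0 \<and> (\<forall>S<2 ^ l. nmem st ''cnt'' S = card (set_decode S))"
    then show "counted st" by (simp add: counted_def)
  qed simp_all
qed simp

definition summed :: "state \<Rightarrow> bool" where
  "summed st \<longleftrightarrow> (\<forall>k\<le>l. \<forall>e<m. rmem st ''CS'' (k * m + e) = cost_sum e k)"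

lemma runs_cost:
  assumes inp: "inp st" and CS: "rmem st ''CS'' = (\<lambda>_. 0)"
  shows "runs cost W cost_prog st (50 * (l * m) + 50) summed"
  unfolding cost_prog_def
proof (rule runs_Seq[of _ _ _ _ 10 "\<lambda>st'. inp st' \<and> rmem st' ''CS'' = (\<lambda>_. 0) \<and> nmem st' ''x'' 0 = 0"])
  show "runs cost W (NSet ''x'' (Const 0)) st 10
    (\<lambda>st'. inp st' \<and> rmem st' ''CS'' = (\<lambda>_. 0) \<and> nmem st' ''x'' 0 = 0)"
    by (rule runs_loopfree) (use inp CS in \<open>simp_all add: inp_def\<close>)
next
  have lm: "l * m \<le> W" by (rule cell_le) (simp add: algebra_simps)
  fix st :: state assume st: "inp st \<and> rmem st ''CS'' = (\<lambda>_. 0) \<and> nmem st ''x'' 0 = 0"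
  then have inp: "inp st" by simp
  show "runs cost W (NSet ''q'' (Op Times (V ''l'') (V ''m'')) ;; While (NLess (V ''x'') (V ''q'')) cost_body) st
    (50 * (l * m) + 40) summed"
  proof (rule runs_Seq[of _ _ _ _ 10 "\<lambda>st'. inp st' \<and> rmem st' ''CS'' = (\<lambda>_. 0) \<and> nmem st' ''x'' 0 = 0 \<and> nmem st' ''q'' 0 = l * m"])
    show "runs cost W (NSet ''q'' (Op Times (V ''l'') (V ''m''))) st 10
      (\<lambda>st'. inp st' \<and> rmem st' ''CS'' = (\<lambda>_. 0) \<and> nmem st' ''x'' 0 = 0 \<and> nmem st' ''q'' 0 = l * m)"
      by (rule runs_loopfree) (use st inpD[OF inp] small_le lm in \<open>simp_all add: inp_def\<close>)
  next
    fix st0 :: state assume st0: "inp st0 \<and> rmem st0 ''CS'' = (\<lambda>_. 0) \<and> nmem st0 ''x'' 0 = 0 \<and> nmem st0 ''q'' 0 = l * m"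
    show "runs cost W (While (NLess (V ''x'') (V ''q'')) cost_body) st0 (50 * (l * m) + 30) summed"
    \<comment> \<open>Iteration \<open>i\<close> writes cell \<open>i + m\<close>, so after
      \<open>i\<close> iterations the first \<open>i + m\<close> cells are final.\<close>
    proof (rule runs_For[where N = "l * m" and f = "\<lambda>_. 40" and
        I = "\<lambda>i st. nmem st ''x'' 0 = i \<and> (\<forall>y<i + m. rmem st ''CS'' y = cost_sum (y mod m) (y div m))"])
      show "nmem st0 ''x'' 0 = 0 \<and> (\<forall>y<0 + m. rmem st0 ''CS'' y = cost_sum (y mod m) (y div m))"
        using st0 by simp
    next
      fix i and st :: state assume fr: "frame cost_body st0 st"
        and I: "nmem st ''x'' 0 = i \<and> (\<forall>y<i + m. rmem st ''CS'' y = cost_sum (y mod m) (y div m))"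
      have inp: "inp st" using st0 fr by (auto intro: inp_frame)
      note inpD[OF inp, simp]
      have q: "nmem st ''q'' 0 = l * m" using frame_nmem[OF fr, of "''q''"] st0 by simp
      show "bfits W st (NLess (V ''x'') (V ''q'')) \<and> (bval cost st (NLess (V ''x'') (V ''q'')) \<longleftrightarrow> i < l * m)" if "i \<le> l * m"
        using I q that lm by simp
      assume i: "i < l * m"
      then have m: "0 < m" by (cases "m = 0") auto
      have im: "i + m \<le> W" by (rule cell_le) (use i in \<open>simp add: algebra_simps\<close>)
      have "i div m < l" using i m by (simp add: less_mult_imp_div_less)
      then have dv: "Suc (i div m) \<le> W" using small_le(1) by simp
      have new: "cost_sum ((i + m) mod m) ((i + m) div m) = cost_sum (i mod m) (i div m) + cost (i mod m) (Suc (i div m))"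
      proof -
        have "(i + m) div m = Suc (i div m)" using div_add_self2[of m i] m by linarith
        then show ?thesis by (simp add: cost_sum_Suc)
      qed
      have si: "Suc i \<le> W" using i lm by simp
      show "runs cost W cost_body st 40 (\<lambda>st. nmem st ''x'' 0 = Suc i \<and>
          (\<forall>y<Suc i + m. rmem st ''CS'' y = cost_sum (y mod m) (y div m)))"
        unfolding cost_body_def
        by (intro runs_loopfree) (use I i im dv si m new small_le in \<open>auto simp: less_Suc_eq\<close>)
    next
      fix st :: state assume I: "nmem st ''x'' 0 = l * m \<and> (\<forall>y<l * m + m. rmem st ''CS'' y = cost_sum (y mod m) (y div m))"
      show "summed st" unfolding summed_def
      proof (intro allI impI)
        fix k e assume k: "k \<le> l" and e: "e < m"
        have "k * m \<le> l * m" using k by (rule mult_le_mono1)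
        then have "k * m + e < l * m + m" using e by linarith
        moreover have "(k * m + e) mod m = e" using e by simp
        moreover have "(k * m + e) div m = k"
          using div_mult_self3[of m k e] e by (metis add_0_right div_less less_nat_zero_code)
        ultimately show "rmem st ''CS'' (k * m + e) = cost_sum e k" using I by simp
      qed
    qed simp_all
  qed simp
qed simp

end

section \<open>Filling the table\<close>

text \<open>The language has no disjunction; the guard says that the entry is still infinite or that
  \<open>q\<close> is smaller. On ties the older code is kept.\<close>

definition relax :: "nexp \<Rightarrow> rexp \<Rightarrow> com" where
  "relax a q = IfThen (BNot (BConj (NLess (Const 0) (NCell ''ch'' (V ''x''))) (BNot (RLess q (RCell ''D'' (V ''x''))))))
     (RAssign ''D'' (V ''x'') q ;; NAssign ''ch'' (V ''x'') a) Skip"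

definition arc_body :: com where
  "arc_body = IfThen (NEq (NCell ''tail'' (V ''e'')) (V ''v''))
       (NSet ''y'' (Op Plus (Op Minus (Op Minus (V ''x'') (V ''v'')) (V ''n'')) (NCell ''head'' (V ''e''))) ;;
        IfThen (NLess (Const 0) (NCell ''ch'' (V ''y'')))
          (relax (Op Plus (V ''e'') (Const 2))
            (RPlus (RCell ''CS'' (Op Plus (Op Times (NCell ''cnt'' (V ''S'')) (V ''m'')) (V ''e''))) (RCell ''D'' (V ''y''))))
          Skip)
       Skip ;;
     NSet ''e'' (Inc (V ''e''))"

definition split_body :: com where
  "split_body =
     NSet ''y'' (Op Plus (Op Plus (Op Times (V ''Y'') (V ''row'')) (Op Times (V ''n'') (V ''n''))) (V ''v'')) ;;
     NSet ''z'' (Op Plus (Op Plus (Op Times (Op Minus (V ''S'') (V ''Y'')) (V ''row'')) (Op Times (V ''n'') (V ''n''))) (V ''v'')) ;;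
     IfThen (BConj (NLess (Const 0) (NCell ''ch'' (V ''y''))) (NLess (Const 0) (NCell ''ch'' (V ''z''))))
       (relax (Op Plus (Op Plus (V ''Y'') (V ''m'')) (Const 2)) (RPlus (RCell ''D'' (V ''y'')) (RCell ''D'' (V ''z''))))
       Skip ;;
     NSet ''Y'' (Op BitAnd (Op Minus (V ''Y'') (Const 1)) (V ''S''))"

text \<open>\<open>Y\<close> starts at the largest proper submask of \<open>S\<close>, or at 0 if
  \<open>S = 0\<close>. There are no real constants, so 0 is read from the cell \<open>zero\<close>,
  which is never written.\<close>

definition entry_init :: com where
  "entry_init =
     NSet ''S'' (Op Div (V ''x'') (V ''row'')) ;;
     NSet ''k'' (Op Div (Op Mod (V ''x'') (V ''row'')) (V ''n'')) ;;
     NSet ''v'' (Op Mod (V ''x'') (V ''n'')) ;;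
     NSet ''e'' (Const 0) ;;
     NSet ''Y'' (Op BitAnd (Op Minus (V ''S'') (Const 1)) (V ''S'')) ;;
     IfThen (NEq (NCell ''tv'' (V ''S'')) (Inc (V ''v'')))
       (NAssign ''ch'' (V ''x'') (Const 1) ;; RAssign ''D'' (V ''x'') (RCell ''zero'' (Const 0)))
       (NAssign ''ch'' (V ''x'') (Const 0))"

definition arc_loop :: com where
  "arc_loop = IfThen (NLess (Const 0) (V ''k'')) (While (NLess (V ''e'') (V ''m'')) arc_body) Skip"

definition split_loop :: com where
  "split_loop = While (NLess (Const 0) (V ''Y'')) split_body"

definition entry_body :: com where
  "entry_body = entry_init ;; arc_loop ;; split_loop ;; NSet ''x'' (Inc (V ''x''))"

definition table_prog :: com where
  "table_prog = NSet ''row'' (Op Times (Inc (V ''n'')) (V ''n'')) ;; NSet ''tot'' (Op Times (V ''p'') (V ''row'')) ;;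
     NSet ''x'' (Const 0) ;; While (NLess (V ''x'') (V ''tot'')) entry_body"

lemma writes_relax [simp]: "nwrites (relax a q) = {''ch''}" "rwrites (relax a q) = {''D''}"
  by (auto simp: relax_def)

lemma writes_table_bodies [simp]:
  "nwrites arc_body = {''y'', ''ch'', ''e''}" "rwrites arc_body = {''D''}"
  "nwrites split_body = {''y'', ''z'', ''ch'', ''Y''}" "rwrites split_body = {''D''}"
  "nwrites entry_init = {''S'', ''k'', ''v'', ''e'', ''Y'', ''ch''}" "rwrites entry_init = {''D''}"
  by (auto simp: arc_body_def split_body_def entry_init_def)

lemma writes_table_loops [simp]:
  "nwrites arc_loop = {''y'', ''ch'', ''e''}" "rwrites arc_loop = {''D''}"
  "nwrites split_loop = {''y'', ''z'', ''ch'', ''Y''}" "rwrites split_loop = {''D''}"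
  by (auto simp: arc_loop_def split_loop_def)

lemma writes_entry_body [simp]:
  "nwrites entry_body = {''S'', ''k'', ''v'', ''e'', ''Y'', ''ch'', ''y'', ''z'', ''x''}" "rwrites entry_body = {''D''}"
  by (auto simp: entry_body_def)

lemma writes_table_prog [simp]:
  "nwrites table_prog = {''S'', ''k'', ''v'', ''e'', ''Y'', ''ch'', ''y'', ''z'', ''x'', ''row'', ''tot''}"
  "rwrites table_prog = {''D''}"
  by (auto simp: table_prog_def)

lemma nval_rput [simp]: "nval (rput x i w st) e = nval st e"
  by (induction e) auto

lemma nfits_rput [simp]: "nfits W (rput x i w st) e = nfits W st e"
  by (induction e) (auto simp: nfits.simps(3))

lemma put_same: "nput x i (nmem st x i) st = st" "rput x i (rmem st x i) st = st"
  by (simp_all add: nput_def rput_def)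

text \<open>\<open>Q\<close> has to be checked only for states in which both cells are written:
  leaving them alone is the same as writing the old values back.\<close>

lemma runs_relax:
  assumes X: "nmem st ''x'' 0 = X" "X \<le> W" and ch: "nmem st ''ch'' X \<le> W"
    and a: "nfits W st a" "nval st a = k" "0 < k" and q: "rfits W st q" "rval c st q = d"
    and best: "best U (nmem st ''ch'' X) (rmem st ''D'' X)" and n: "30 + nsteps a + 2 * rsteps q \<le> n"
    and post: "\<And>k' d'. best (insert (k, d) U) k' d' \<Longrightarrow> k' \<le> W \<Longrightarrow> Q (nput ''ch'' X k' (rput ''D'' X d' st))"
  shows "runs c W (relax a q) st n Q"
proof (rule runs_loopfree)
  show "loopfree (relax a q)" by (simp add: relax_def)
  show "safe c W (relax a q) st" using X ch a q by (simp add: relax_def)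
  show "dur (relax a q) \<le> n" using n by (simp add: relax_def)
  have k: "k \<le> W" using a nfits_imp_le by blast
  let ?c = "nmem st ''ch'' X" and ?d = "rmem st ''D'' X"
  show "Q (post c (relax a q) st)"
  proof (cases "?c = 0 \<or> d < ?d")
    case True
    then have "best (insert (k, d) U) k d" using best_insert[OF best a(3), of d] by auto
    then have "Q (nput ''ch'' X k (rput ''D'' X d st))" using post k by blast
    moreover have "post c (relax a q) st = nput ''ch'' X k (rput ''D'' X d st)"
      using True X a q by (auto simp: relax_def)
    ultimately show ?thesis by simp
  next
    case False
    then have "best (insert (k, d) U) ?c ?d" using best_insert[OF best a(3), of d] by auto
    then have "Q (nput ''ch'' X ?c (rput ''D'' X ?d st))" using post ch by blast
    moreover have "nput ''ch'' X ?c (rput ''D'' X ?d st) = st"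
      using put_same(1)[of "''ch''" X st] by (simp add: put_same)
    moreover have "post c (relax a q) st = st" using False X q by (auto simp: relax_def)
    ultimately show ?thesis by simp
  qed
qed

context machine_run
begin

text \<open>\<open>U\<close> is the set of options for the entry \<open>x\<close> that have been examined so far.\<close>

definition entry :: "(nat \<Rightarrow> nat) \<Rightarrow> (nat \<Rightarrow> real) \<Rightarrow> nat \<Rightarrow> (nat \<times> real) set \<Rightarrow> state \<Rightarrow> bool" where
  "entry ch D x U st \<longleftrightarrow> (\<forall>y. y \<noteq> x \<longrightarrow> nmem st ''ch'' y = ch y \<and> rmem st ''D'' y = D y) \<and>
     (\<forall>y. nmem st ''ch'' y \<le> W) \<and> best U (nmem st ''ch'' x) (rmem st ''D'' x)"

definition ready :: "nat \<Rightarrow> nat \<Rightarrow> nat \<Rightarrow> state \<Rightarrow> bool" where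
  "ready S k v st \<longleftrightarrow> inp st \<and> counted st \<and> summed st \<and> S < 2 ^ l \<and> k \<le> n \<and> v < n \<and>
     nmem st ''x'' 0 = idx S k v \<and> nmem st ''S'' 0 = S \<and> nmem st ''k'' 0 = k \<and> nmem st ''v'' 0 = v \<and>
     nmem st ''row'' 0 = row"

lemma ready_frame:
  assumes "ready S k v st" "frame p st st'"
    "nwrites p \<inter> {''n'', ''m'', ''tail'', ''head'', ''root'', ''l'', ''term'', ''cnt'', ''x'', ''S'', ''k'', ''v'', ''row''} = {}"
    "''CS'' \<notin> rwrites p"
  shows "ready S k v st'"
proof -
  have "nmem st' y = nmem st y" if "y \<in> {''cnt'', ''x'', ''S'', ''k'', ''v'', ''row''}" for y
    using assms(2,3) that by (intro frame_nmem) auto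
  moreover have "rmem st' ''CS'' = rmem st ''CS''" using assms(2,4) by (rule frame_rmem)
  moreover have "inp st'" using assms(1) by (intro inp_frame[OF _ assms(2)]) (use assms(3) in \<open>auto simp: ready_def\<close>)
  ultimately show ?thesis using assms(1) by (simp add: ready_def counted_def summed_def)
qed

lemma readyD:
  assumes "ready S k v st"
  shows "nmem st ''x'' 0 = idx S k v" "nmem st ''S'' 0 = S" "nmem st ''k'' 0 = k" "nmem st ''v'' 0 = v"
    "nmem st ''row'' 0 = row" "nmem st ''cnt'' S = card (set_decode S)"
    "inp st" "S < 2 ^ l" "k \<le> n" "v < n" "e < m \<Longrightarrow> rmem st ''CS'' (card (set_decode S) * m + e) = cost_sum e (card (set_decode S))"
    "idx S k v \<le> W" "S \<le> W" "k \<le> W" "v \<le> W"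
  using assms card_mask_le[of S] idx_less[of S k v] index_le[of "idx S k v"] mask_le[of S] small_le(3)
  by (auto simp: ready_def counted_def summed_def)

lemma entry_put:
  assumes "entry ch D x U st" "best U' k' d'" "k' \<le> W"
    "nmem st' ''ch'' = nmem st ''ch''" "rmem st' ''D'' = rmem st ''D''"
  shows "entry ch D x U' (nput ''ch'' x k' (rput ''D'' x d' st'))"
proof -
  have "nmem st' ''ch'' y \<le> W" for y using assms(1,4) by (simp add: entry_def)
  then have "((nmem st' ''ch'')(x := k')) y \<le> W" for y using assms(3) by (simp only: fun_upd_apply split: if_split) simp
  then show ?thesis using assms unfolding entry_def by simp
qed

lemma runs_arc_body:
  assumes rd: "ready S k v st" and k: "0 < k" and e: "nmem st ''e'' 0 = e" "e < m"
    and ent: "entry ch D (idx S k v) U st"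
  shows "runs cost W arc_body st 150 (\<lambda>st'. nmem st' ''e'' 0 = Suc e \<and>
    entry ch D (idx S k v) (U \<union> arc_opt ch D S k v e) st')"
proof -
  note rd' = readyD[OF rd]
  note rds = rd'(1-6,12-15) and inps = inpD[OF rd'(7)]
  let ?x = "idx S k v"
  let ?y = "idx S (k - 1) (head G e)"
  let ?U = "U \<union> arc_opt ch D S k v e"
  have eW: "e \<le> W" "Suc e \<le> W" using e(2) small_le(2) by auto
  have hW: "head G e \<le> W" "tail G e \<le> W" using head_less[OF e(2)] tail_less[OF e(2)] small_le(3) by auto
  have y: "?x - v - n + head G e = ?y" by (rule idx_pred(1)[OF k rd'(9,10)])
  have yx: "?y < ?x" using idx_pred(2)[OF k rd'(9,10) head_less[OF e(2)]] .
  then have yW: "?y \<le> W" using rd'(12) by simp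
  have chW: "nmem st ''ch'' z \<le> W" for z using ent by (simp add: entry_def)
  have chy: "nmem st ''ch'' ?y = ch ?y" "rmem st ''D'' ?y = D ?y" using ent yx by (simp_all add: entry_def)
  have cW: "card (set_decode S) \<le> W" using card_mask_le[OF rd'(8)] small_le(1) by simp
  have "card (set_decode S) * m \<le> l * m" using card_mask_le[OF rd'(8)] by (rule mult_le_mono1)
  moreover have "(l + 1) * m \<le> (l + 1) * (m + n + 1)" by (rule mult_le_mono2) simp
  moreover have "(l + 1) * m = l * m + m" by simp
  ultimately have "card (set_decode S) * m + e \<le> (l + 1) * (m + n + 1)" using e(2) by linarith
  from cell_le[OF this] have cm: "card (set_decode S) * m + e \<le> W" "card (set_decode S) * m \<le> W" by linarith+
  show ?thesis
    unfolding arc_body_def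
  proof (rule runs_Seq[of _ _ _ _ 140 "\<lambda>st'. nmem st' ''e'' 0 = e \<and> entry ch D ?x ?U st'"])
    show "runs cost W (NSet ''e'' (Inc (V ''e''))) st' 10
        (\<lambda>st'. nmem st' ''e'' 0 = Suc e \<and> entry ch D ?x ?U st')"
      if "nmem st' ''e'' 0 = e \<and> entry ch D ?x ?U st'" for st'
      by (rule runs_loopfree) (use that small_le eW in \<open>simp_all add: entry_def\<close>)
    show "runs cost W (IfThen (NEq (NCell ''tail'' (V ''e'')) (V ''v''))
       (NSet ''y'' (Op Plus (Op Minus (Op Minus (V ''x'') (V ''v'')) (V ''n'')) (NCell ''head'' (V ''e''))) ;;
        IfThen (NLess (Const 0) (NCell ''ch'' (V ''y'')))
          (relax (Op Plus (V ''e'') (Const 2))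
            (RPlus (RCell ''CS'' (Op Plus (Op Times (NCell ''cnt'' (V ''S'')) (V ''m'')) (V ''e''))) (RCell ''D'' (V ''y''))))
          Skip)
       Skip) st 140 (\<lambda>st'. nmem st' ''e'' 0 = e \<and> entry ch D ?x ?U st')"
    proof (rule runs_If[where m = 120])
      show "bfits W st (NEq (NCell ''tail'' (V ''e'')) (V ''v''))"
        using rds inps e eW hW by simp
    next
      assume "\<not> bval cost st (NEq (NCell ''tail'' (V ''e'')) (V ''v''))"
      then have "arc_opt ch D S k v e = {}" using rds inps e by (auto simp: arc_opt_def)
      then show "runs cost W Skip st 120 (\<lambda>st'. nmem st' ''e'' 0 = e \<and> entry ch D ?x ?U st')"
        by (intro runs_loopfree) (use ent e in simp_all)
    next
      assume "bval cost st (NEq (NCell ''tail'' (V ''e'')) (V ''v''))"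
      then have te: "tail G e = v" using rds inps e by simp
      define st1 where "st1 = nput ''y'' 0 ?y st"
      have rd1: "ready S k v st1" using rd by (simp add: st1_def ready_def inp_def counted_def summed_def)
      note rd1' = readyD[OF rd1]
      note rds1 = rd1'(1-6,12-15) and inps1 = inpD[OF rd1'(7)]
      have ent1: "entry ch D ?x U st1" using ent by (simp add: st1_def entry_def)
      have e1: "nmem st1 ''e'' 0 = e" "nmem st1 ''y'' 0 = ?y" "nmem st1 ''ch'' = nmem st ''ch''"
        "rmem st1 = rmem st" using e by (simp_all add: st1_def)
      have inner: "runs cost W (IfThen (NLess (Const 0) (NCell ''ch'' (V ''y'')))
          (relax (Op Plus (V ''e'') (Const 2))
            (RPlus (RCell ''CS'' (Op Plus (Op Times (NCell ''cnt'' (V ''S'')) (V ''m'')) (V ''e''))) (RCell ''D'' (V ''y''))))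
          Skip) st1 100 (\<lambda>st'. nmem st' ''e'' 0 = e \<and> entry ch D ?x ?U st')"
      proof (rule runs_If[where m = 80])
        show "bfits W st1 (NLess (Const 0) (NCell ''ch'' (V ''y'')))"
          using e1 yW chW by simp
      next
        assume "\<not> bval cost st1 (NLess (Const 0) (NCell ''ch'' (V ''y'')))"
        then have "arc_opt ch D S k v e = {}" using e1 chy by (simp add: arc_opt_def)
        then show "runs cost W Skip st1 80 (\<lambda>st'. nmem st' ''e'' 0 = e \<and> entry ch D ?x ?U st')"
          by (intro runs_loopfree) (use ent1 e1 in simp_all)
      next
        assume "bval cost st1 (NLess (Const 0) (NCell ''ch'' (V ''y'')))"
        then have opt: "?U = insert (e + 2, cost_sum e (card (set_decode S)) + D ?y) U"
          using e1 chy te by (simp add: arc_opt_def)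
        show "runs cost W (relax (Op Plus (V ''e'') (Const 2))
            (RPlus (RCell ''CS'' (Op Plus (Op Times (NCell ''cnt'' (V ''S'')) (V ''m'')) (V ''e''))) (RCell ''D'' (V ''y''))))
          st1 80 (\<lambda>st'. nmem st' ''e'' 0 = e \<and> entry ch D ?x ?U st')"
        proof (rule runs_relax[where X = ?x and k = "e + 2" and U = U
              and d = "cost_sum e (card (set_decode S)) + D ?y"])
          have "e + 2 \<le> W" by (rule code_le) (use e(2) in simp)
          then show "nfits W st1 (Op Plus (V ''e'') (Const 2))" "nval st1 (Op Plus (V ''e'') (Const 2)) = e + 2"
            using e1 eW small_le by simp_all
          show "rfits W st1 (RPlus (RCell ''CS'' (Op Plus (Op Times (NCell ''cnt'' (V ''S'')) (V ''m'')) (V ''e''))) (RCell ''D'' (V ''y'')))"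
            using rds1 inps1 e1 eW cm cW yW small_le by simp
          show "rval cost st1 (RPlus (RCell ''CS'' (Op Plus (Op Times (NCell ''cnt'' (V ''S'')) (V ''m'')) (V ''e''))) (RCell ''D'' (V ''y'')))
            = cost_sum e (card (set_decode S)) + D ?y"
            using rds1 inps1 e1 rd1'(11)[OF e(2)] chy by simp
          fix k' d'
          assume "best (insert (e + 2, cost_sum e (card (set_decode S)) + D ?y) U) k' d'" "k' \<le> W"
          from entry_put[OF ent1 this refl refl]
          show "nmem (nput ''ch'' ?x k' (rput ''D'' ?x d' st1)) ''e'' 0 = e \<and>
            entry ch D ?x ?U (nput ''ch'' ?x k' (rput ''D'' ?x d' st1))"
            using e1 unfolding opt by simp
        qed (use rds1 e1 chW ent1 in \<open>simp_all add: entry_def\<close>)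
      qed simp
      show "runs cost W (NSet ''y'' (Op Plus (Op Minus (Op Minus (V ''x'') (V ''v'')) (V ''n'')) (NCell ''head'' (V ''e''))) ;;
        IfThen (NLess (Const 0) (NCell ''ch'' (V ''y'')))
          (relax (Op Plus (V ''e'') (Const 2))
            (RPlus (RCell ''CS'' (Op Plus (Op Times (NCell ''cnt'' (V ''S'')) (V ''m'')) (V ''e''))) (RCell ''D'' (V ''y''))))
          Skip) st 120 (\<lambda>st'. nmem st' ''e'' 0 = e \<and> entry ch D ?x ?U st')"
      proof (rule runs_Seq[of _ _ _ _ 20 "\<lambda>st'. st' = st1" _ 100])
        show "runs cost W (NSet ''y'' (Op Plus (Op Minus (Op Minus (V ''x'') (V ''v'')) (V ''n'')) (NCell ''head'' (V ''e'')))) st 20 (\<lambda>st'. st' = st1)"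
          by (rule runs_loopfree) (use rds inps e eW hW y yW small_le in \<open>simp_all add: st1_def\<close>)
      qed (use inner in simp_all)
    qed simp
  qed simp
qed

lemma runs_arc_loop:
  assumes rd: "ready S k v st" and e: "nmem st ''e'' 0 = 0" and ent: "entry ch D (idx S k v) U st"
  shows "runs cost W arc_loop st (160 * m + 30)
    (entry ch D (idx S k v) (U \<union> (\<Union>e \<in> {e. e < m \<and> 0 < k}. arc_opt ch D S k v e)))"
  unfolding arc_loop_def
proof (rule runs_If[where m = "160 * m + 20"])
  note rd' = readyD[OF rd]
  note rds = rd'(1-6,12-15)
  show "bfits W st (NLess (Const 0) (V ''k''))" using rds by simp
  show "runs cost W Skip st (160 * m + 20)
      (entry ch D (idx S k v) (U \<union> (\<Union>e \<in> {e. e < m \<and> 0 < k}. arc_opt ch D S k v e)))"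
    if "\<not> bval cost st (NLess (Const 0) (V ''k''))"
    by (rule runs_loopfree) (use that rds ent in simp_all)
  assume "bval cost st (NLess (Const 0) (V ''k''))"
  then have k: "0 < k" using rds by simp
  show "runs cost W (While (NLess (V ''e'') (V ''m'')) arc_body) st (160 * m + 20)
      (entry ch D (idx S k v) (U \<union> (\<Union>e \<in> {e. e < m \<and> 0 < k}. arc_opt ch D S k v e)))"
  proof (rule runs_For[where N = m and f = "\<lambda>_. 150" and
        I = "\<lambda>i st. nmem st ''e'' 0 = i \<and> entry ch D (idx S k v) (U \<union> (\<Union>e<i. arc_opt ch D S k v e)) st"])
    show "nmem st ''e'' 0 = 0 \<and> entry ch D (idx S k v) (U \<union> (\<Union>e<0. arc_opt ch D S k v e)) st"
      using e ent by simp
  next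
    fix i st' assume fr: "frame arc_body st st'"
      and I: "nmem st' ''e'' 0 = i \<and> entry ch D (idx S k v) (U \<union> (\<Union>e<i. arc_opt ch D S k v e)) st'"
    have rd1: "ready S k v st'" using rd fr by (rule ready_frame) simp_all
    note inps = inpD[OF readyD(7)[OF rd1]]
    show "bfits W st' (NLess (V ''e'') (V ''m'')) \<and> (bval cost st' (NLess (V ''e'') (V ''m'')) \<longleftrightarrow> i < m)" if "i \<le> m"
      using I inps that small_le(2) by simp
    assume "i < m"
    from runs_arc_body[OF rd1 k _ this] I
    have "runs cost W arc_body st' 150 (\<lambda>st'. nmem st' ''e'' 0 = Suc i \<and>
       entry ch D (idx S k v) (U \<union> (\<Union>e<i. arc_opt ch D S k v e) \<union> arc_opt ch D S k v i) st')" by blast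
    then show "runs cost W arc_body st' 150 (\<lambda>st'. nmem st' ''e'' 0 = Suc i \<and>
       entry ch D (idx S k v) (U \<union> (\<Union>e<Suc i. arc_opt ch D S k v e)) st')"
      by (rule runs_weaken) (simp_all add: lessThan_Suc Un_ac)
  next
    fix st' :: state
    assume "nmem st' ''e'' 0 = m \<and> entry ch D (idx S k v) (U \<union> (\<Union>e<m. arc_opt ch D S k v e)) st'"
    moreover have "{e. e < m \<and> 0 < k} = {..<m}" using k by auto
    ultimately show "entry ch D (idx S k v) (U \<union> (\<Union>e \<in> {e. e < m \<and> 0 < k}. arc_opt ch D S k v e)) st'" by simp
  qed simp
qed simp

lemma runs_split_body:
  assumes rd: "ready S k v st" and Y: "nmem st ''Y'' 0 = Y" "0 < Y" "Y < S"
    and ent: "entry ch D (idx S k v) U st"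
  shows "runs cost W split_body st 200 (\<lambda>st'. nmem st' ''Y'' 0 = and (Y - 1) S \<and>
    entry ch D (idx S k v) (U \<union> split_opt ch D S v Y) st')"
proof -
  note rd' = readyD[OF rd]
  note rds = rd'(1-6,12-15) and inps = inpD[OF rd'(7)]
  let ?x = "idx S k v" and ?y = "idx Y n v" and ?z = "idx (S - Y) n v"
  let ?U = "U \<union> split_opt ch D S v Y"
  have YW: "Y \<le> W" using Y(3) rd'(13) by simp
  \<comment> \<open>Both parts lie strictly below the current entry, so relaxing that entry has not
    disturbed them.\<close>
  have yx: "?y < ?x" "?z < ?x" using idx_less_mask[of Y S n v k v] idx_less_mask[of "S - Y" S n v k v] Y rd'(10) by auto
  then have yW: "?y \<le> W" "?z \<le> W" using rd'(12) by simp_all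
  have eq: "Y * row + n * n + v = ?y" "(S - Y) * row + n * n + v = ?z" by (simp_all add: idx_def)
  have pW: "Y * row \<le> W" "Y * row + n * n \<le> W" "(S - Y) * row \<le> W" "(S - Y) * row + n * n \<le> W"
    using yW eq by linarith+
  have chW: "nmem st ''ch'' u \<le> W" for u using ent by (simp add: entry_def)
  have chy: "nmem st ''ch'' ?y = ch ?y" "rmem st ''D'' ?y = D ?y" "nmem st ''ch'' ?z = ch ?z" "rmem st ''D'' ?z = D ?z"
    using ent yx by (simp_all add: entry_def)
  define st1 where "st1 = nput ''y'' 0 ?y st"
  define st2 where "st2 = nput ''z'' 0 ?z st1"
  have rd2: "ready S k v st2" using rd by (simp add: st1_def st2_def ready_def inp_def counted_def summed_def)
  note rd2' = readyD[OF rd2]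
  note rds2 = rd2'(1-6,12-15) and inps2 = inpD[OF rd2'(7)]
  have ent2: "entry ch D ?x U st2" using ent by (simp add: st1_def st2_def entry_def)
  have Y2: "nmem st2 ''Y'' 0 = Y" "nmem st2 ''y'' 0 = ?y" "nmem st2 ''z'' 0 = ?z" "nmem st2 ''ch'' = nmem st ''ch''"
    "rmem st2 = rmem st" using Y by (simp_all add: st1_def st2_def)
  show ?thesis
    unfolding split_body_def
  proof (rule runs_Seq[of _ _ _ _ 20 "\<lambda>st'. st' = st1" _ 170], goal_cases)
    case 1
    show ?case by (rule runs_loopfree) (use rds inps Y YW eq yW pW small_le in \<open>simp_all add: st1_def\<close>)
  next
    case (2 st')
    then have [simp]: "st' = st1" .
    show ?case
    proof (rule runs_Seq[of _ _ _ _ 20 "\<lambda>st'. st' = st2" _ 145], goal_cases)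
      case 1
      show ?case by (rule runs_loopfree) (use rds inps Y YW eq yW pW small_le in \<open>simp_all add: st1_def st2_def\<close>)
    next
      case (2 st')
      then have [simp]: "st' = st2" .
      show ?case
      proof (rule runs_Seq[of _ _ _ _ 120 "\<lambda>st'. nmem st' ''Y'' 0 = Y \<and> nmem st' ''S'' 0 = S \<and> entry ch D ?x ?U st'" _ 20], goal_cases)
        case 1
        show ?case
        proof (rule runs_If[where m = 100], goal_cases)
          case 1
          show ?case using Y2 yW chW by simp
        next
          case 2
          then have opt: "?U = insert (Y + m + 2, D ?y + D ?z) U"
            using Y2 chy by (simp add: split_opt_def)
          show ?case
          proof (rule runs_relax[where X = ?x and k = "Y + m + 2" and U = U and d = "D ?y + D ?z"], goal_cases)
            case 4
            have "Y + m + 2 \<le> W" by (rule code_le) (use Y rd'(8) in simp)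
            then show ?case using Y2 inps2 small_le YW by simp
          next
            case (11 k' d')
            then show ?case using Y2 rds2 entry_put[OF ent2 11 refl refl] unfolding opt by simp
          qed (use rds2 inps2 Y2 chW chy yW ent2 in \<open>simp_all add: entry_def\<close>)
        next
          case 3
          then have "split_opt ch D S v Y = {}" using Y2 chy by (auto simp: split_opt_def)
          then show ?case by (intro runs_loopfree) (use ent2 Y2 rds2 in simp_all)
        qed simp
      next
        case (2 st')
        then show ?case
          by (intro runs_loopfree) (use YW rd'(13) small_le in \<open>simp_all add: entry_def\<close>)
      qed simp
    qed simp
  qed simp
qed

text \<open>Each iteration moves to the next smaller submask, so the number of remaining nonempty
  submasks drops by exactly one.\<close>

lemma runs_split_loop:
  assumes rd: "ready S k v st" and Y: "nmem st ''Y'' 0 = and (S - 1) S" and ent: "entry ch D (idx S k v) U st"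
  shows "runs cost W split_loop st (210 * 2 ^ card (set_decode S) + 30)
    (entry ch D (idx S k v) (U \<union> (\<Union>Y \<in> {Y. set_decode Y \<subseteq> set_decode S \<and> 0 < Y \<and> Y < S}. split_opt ch D S v Y)))"
  unfolding split_loop_def
\<comment> \<open>The submasks strictly between the current \<open>Y\<close> and \<open>S\<close>
  have been examined. The disjunct \<open>S = 0\<close> covers the mask without proper submasks,
  where \<open>Y\<close> starts at 0.\<close>
proof (rule runs_While[where
      I = "\<lambda>st. set_decode (nmem st ''Y'' 0) \<subseteq> set_decode S \<and> (S = 0 \<or> nmem st ''Y'' 0 < S) \<and> entry ch D (idx S k v)
        (U \<union> (\<Union>Y \<in> {Y. set_decode Y \<subseteq> set_decode S \<and> nmem st ''Y'' 0 < Y \<and> Y < S}. split_opt ch D S v Y)) st" and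
      \<mu> = "\<lambda>st. 210 * card {Z. set_decode Z \<subseteq> set_decode S \<and> 0 < Z \<and> Z \<le> nmem st ''Y'' 0}"])
  have empty: "{Y. set_decode Y \<subseteq> set_decode S \<and> and (S - 1) S < Y \<and> Y < S} = {}"
    using less_iff_le_and_pred[of _ S S] by (cases "S = 0") (auto simp: not_le)
  have less: "S = 0 \<or> and (S - 1) S < S"
    using and_nat_le[of "S - 1" S] by (cases "S = 0") auto
  show "set_decode (nmem st ''Y'' 0) \<subseteq> set_decode S \<and> (S = 0 \<or> nmem st ''Y'' 0 < S) \<and> entry ch D (idx S k v)
        (U \<union> (\<Union>Y \<in> {Y. set_decode Y \<subseteq> set_decode S \<and> nmem st ''Y'' 0 < Y \<and> Y < S}. split_opt ch D S v Y)) st"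
    using ent less unfolding Y empty by (simp add: set_decode_and)
  have "card {Z. set_decode Z \<subseteq> set_decode S \<and> 0 < Z \<and> Z \<le> nmem st ''Y'' 0} \<le> card {Z. set_decode Z \<subseteq> set_decode S}"
    by (rule card_mono) (use finite_submasks in auto)
  then show "210 * card {Z. set_decode Z \<subseteq> set_decode S \<and> 0 < Z \<and> Z \<le> nmem st ''Y'' 0} + 1 +
      bsteps (NLess (Const 0) (V ''Y'')) \<le> 210 * 2 ^ card (set_decode S) + 30"
    by (simp add: card_submasks)
next
  fix st' assume fr: "frame split_body st st'"
    and I: "set_decode (nmem st' ''Y'' 0) \<subseteq> set_decode S \<and> (S = 0 \<or> nmem st' ''Y'' 0 < S) \<and> entry ch D (idx S k v)
        (U \<union> (\<Union>Y \<in> {Y. set_decode Y \<subseteq> set_decode S \<and> nmem st' ''Y'' 0 < Y \<and> Y < S}. split_opt ch D S v Y)) st'"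
  have rd1: "ready S k v st'" using rd fr by (rule ready_frame) simp_all
  note rd1' = readyD[OF rd1]
  define Y where "Y = nmem st' ''Y'' 0"
  have "Y \<le> S" using I unfolding Y_def by (intro subset_decode_imp_le) simp
  then have YW: "Y \<le> W" using rd1'(13) by simp
  show "bfits W st' (NLess (Const 0) (V ''Y''))" using YW by (simp add: Y_def)
  assume "bval cost st' (NLess (Const 0) (V ''Y''))"
  then have Y0: "0 < Y" by (simp add: Y_def)
  then have S0: "S \<noteq> 0" using \<open>Y \<le> S\<close> by simp
  have YS: "Y < S" "set_decode Y \<subseteq> set_decode S" using I S0 by (auto simp: Y_def)
  let ?Y' = "and (Y - 1) S"
  let ?U = "\<lambda>Y'. U \<union> (\<Union>Y \<in> {Y. set_decode Y \<subseteq> set_decode S \<and> Y' < Y \<and> Y < S}. split_opt ch D S v Y)"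
  have le: "?Y' < Y" using and_nat_le[of "Y - 1" S] Y0 by simp
  have step: "Z < Y \<longleftrightarrow> Z \<le> ?Y'" if "set_decode Z \<subseteq> set_decode S" for Z
    by (rule less_iff_le_and_pred[OF that YS(2) Y0])
  have "{Z. set_decode Z \<subseteq> set_decode S \<and> ?Y' < Z \<and> Z < S} = insert Y {Z. set_decode Z \<subseteq> set_decode S \<and> Y < Z \<and> Z < S}"
  proof (rule set_eqI)
    fix Z
    have "set_decode Z \<subseteq> set_decode S \<Longrightarrow> ?Y' < Z \<longleftrightarrow> Z = Y \<or> Y < Z" using step[of Z] by linarith
    then show "Z \<in> {Z. set_decode Z \<subseteq> set_decode S \<and> ?Y' < Z \<and> Z < S} \<longleftrightarrow>
        Z \<in> insert Y {Z. set_decode Z \<subseteq> set_decode S \<and> Y < Z \<and> Z < S}"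
      using YS by blast
  qed
  then have U: "?U ?Y' = ?U Y \<union> split_opt ch D S v Y" by auto
  have cs: "{Z. set_decode Z \<subseteq> set_decode S \<and> 0 < Z \<and> Z \<le> Y} = insert Y {Z. set_decode Z \<subseteq> set_decode S \<and> 0 < Z \<and> Z \<le> ?Y'}"
  proof (rule set_eqI)
    fix Z
    have "set_decode Z \<subseteq> set_decode S \<Longrightarrow> Z \<le> Y \<longleftrightarrow> Z = Y \<or> Z \<le> ?Y'" using step[of Z] by linarith
    then show "Z \<in> {Z. set_decode Z \<subseteq> set_decode S \<and> 0 < Z \<and> Z \<le> Y} \<longleftrightarrow>
        Z \<in> insert Y {Z. set_decode Z \<subseteq> set_decode S \<and> 0 < Z \<and> Z \<le> ?Y'}"
      using YS Y0 by blast
  qed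
  have "finite {Z. set_decode Z \<subseteq> set_decode S \<and> 0 < Z \<and> Z \<le> ?Y'}"
    by (rule finite_subset[OF _ finite_submasks[of S]]) auto
  then have card: "card {Z. set_decode Z \<subseteq> set_decode S \<and> 0 < Z \<and> Z \<le> Y}
      = Suc (card {Z. set_decode Z \<subseteq> set_decode S \<and> 0 < Z \<and> Z \<le> ?Y'})"
    unfolding cs using le by (subst card_insert_disjoint) auto
  have "runs cost W split_body st' 200 (\<lambda>st'. nmem st' ''Y'' 0 = ?Y' \<and>
      entry ch D (idx S k v) (?U Y \<union> split_opt ch D S v Y) st')"
    using I by (intro runs_split_body[OF rd1 _ Y0 YS(1)]) (simp_all add: Y_def)
  then have "runs cost W split_body st' 200 (\<lambda>st''. (set_decode (nmem st'' ''Y'' 0) \<subseteq> set_decode S \<and>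
      (S = 0 \<or> nmem st'' ''Y'' 0 < S) \<and> entry ch D (idx S k v) (?U (nmem st'' ''Y'' 0)) st'') \<and>
      210 * card {Z. set_decode Z \<subseteq> set_decode S \<and> 0 < Z \<and> Z \<le> nmem st'' ''Y'' 0} + 200 + 1 + bsteps (NLess (Const 0) (V ''Y''))
      \<le> 210 * card {Z. set_decode Z \<subseteq> set_decode S \<and> 0 < Z \<and> Z \<le> nmem st' ''Y'' 0})"
  proof (rule runs_weaken)
    fix st'' :: state
    assume a: "nmem st'' ''Y'' 0 = ?Y' \<and> entry ch D (idx S k v) (?U Y \<union> split_opt ch D S v Y) st''"
    show "(set_decode (nmem st'' ''Y'' 0) \<subseteq> set_decode S \<and>
      (S = 0 \<or> nmem st'' ''Y'' 0 < S) \<and> entry ch D (idx S k v) (?U (nmem st'' ''Y'' 0)) st'') \<and>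
      210 * card {Z. set_decode Z \<subseteq> set_decode S \<and> 0 < Z \<and> Z \<le> nmem st'' ''Y'' 0} + 200 + 1 + bsteps (NLess (Const 0) (V ''Y''))
      \<le> 210 * card {Z. set_decode Z \<subseteq> set_decode S \<and> 0 < Z \<and> Z \<le> nmem st' ''Y'' 0}"
      using a le YS unfolding conjunct1[OF a] Y_def[symmetric] card U by (simp add: set_decode_and)
  qed simp
  then show "\<exists>f. runs cost W split_body st' f (\<lambda>st''. (set_decode (nmem st'' ''Y'' 0) \<subseteq> set_decode S \<and>
      (S = 0 \<or> nmem st'' ''Y'' 0 < S) \<and> entry ch D (idx S k v) (?U (nmem st'' ''Y'' 0)) st'') \<and>
      210 * card {Z. set_decode Z \<subseteq> set_decode S \<and> 0 < Z \<and> Z \<le> nmem st'' ''Y'' 0} + f + 1 + bsteps (NLess (Const 0) (V ''Y''))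
      \<le> 210 * card {Z. set_decode Z \<subseteq> set_decode S \<and> 0 < Z \<and> Z \<le> nmem st' ''Y'' 0})"
    by blast
qed auto

end

text \<open>A mask owns \<open>R\<close> consecutive table indices, so a sum over indices becomes a
  sum over masks.\<close>

lemma sum_div: "(\<Sum>x<N * R. f (x div R)) = R * (\<Sum>S<N. f S)" for f :: "nat \<Rightarrow> nat"
proof (cases "R = 0")
  case False
  have "(\<Sum>x = S * R..<S * R + R. f (x div R)) = R * f S" for S
  proof -
    have "(\<Sum>x = S * R..<S * R + R. f (x div R)) = (\<Sum>x = S * R..<S * R + R. f S)"
    proof (rule sum.cong)
      fix x assume "x \<in> {S * R..<S * R + R}"
      then have "x div R = S" by (intro div_nat_eqI) (auto simp: algebra_simps)
      then show "f (x div R) = f S" by simp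
    qed simp
    then show ?thesis by simp
  qed
  then show ?thesis by (simp flip: sum.nat_group add: sum_distrib_left)
qed simp

context machine_run
begin

section \<open>One table entry, and the whole table\<close>

lemma end_opts_marks:
  assumes "marks l st"
  shows "end_opts S v = (if nmem st ''tv'' S = Suc v then {(1, 0)} else {})"
  using assms by (auto simp: end_opts_def marks_def)

lemma marks_le:
  assumes "marks l st"
  shows "nmem st ''tv'' S \<le> W"
proof (cases "nmem st ''tv'' S")
  case (Suc v)
  then obtain j where "j < l" "v = terms ! j" using assms by (auto simp: marks_def)
  then show ?thesis using Suc terms_less[of j] small_le(3) by simp
qed simp

lemma runs_entry_init:
  assumes st: "inp st" "counted st" "summed st" "marks l st" "rmem st ''zero'' 0 = 0" "nmem st ''row'' 0 = row"
    and x: "nmem st ''x'' 0 = idx S k v" and S: "S < 2 ^ l" and k: "k \<le> n" and v: "v < n"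
    and ch: "\<And>y. nmem st ''ch'' y \<le> W"
  shows "runs cost W entry_init st 100 (\<lambda>st'. ready S k v st' \<and> nmem st' ''e'' 0 = 0 \<and>
    nmem st' ''Y'' 0 = and (S - 1) S \<and> entry (nmem st ''ch'') (rmem st ''D'') (idx S k v) (end_opts S v) st')"
proof (rule runs_loopfree)
  note dec = idx_decode[OF k v, of S]
  have le: "idx S k v \<le> W" "S \<le> W" "v \<le> W" "Suc v \<le> W" "and (S - Suc 0) S \<le> W"
    using index_le[of "idx S k v"] idx_less[OF S k v] mask_le[of S] S v small_le(3)
      le_trans[OF and_nat_le, of "S - Suc 0" W S] by simp_all
  note facts = st(5,6) inpD(1)[OF st(1)] x dec le small_le marks_le[OF st(4)]
  show "loopfree entry_init" by (simp add: entry_init_def)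
  show "dur entry_init \<le> 100" by (simp add: entry_init_def)
  show "safe cost W entry_init st" unfolding entry_init_def using facts by simp
  define st1 where "st1 = nput ''Y'' 0 (and (S - 1) S) (nput ''e'' 0 0 (nput ''v'' 0 v (nput ''k'' 0 k (nput ''S'' 0 S st))))"
  have post: "post cost entry_init st = (if nmem st ''tv'' S = Suc v then rput ''D'' (idx S k v) 0 (nput ''ch'' (idx S k v) 1 st1)
      else nput ''ch'' (idx S k v) 0 st1)"
    unfolding entry_init_def using facts by (auto simp: st1_def)
  show "ready S k v (post cost entry_init st) \<and> nmem (post cost entry_init st) ''e'' 0 = 0 \<and>
      nmem (post cost entry_init st) ''Y'' 0 = and (S - 1) S \<and>
      entry (nmem st ''ch'') (rmem st ''D'') (idx S k v) (end_opts S v) (post cost entry_init st)"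
    unfolding post end_opts_marks[OF st(4)] using st S k v x ch small_le
    by (auto simp: st1_def ready_def inp_def counted_def summed_def entry_def best_def)
qed

lemma runs_entry_body:
  assumes st: "inp st" "counted st" "summed st" "marks l st" "rmem st ''zero'' 0 = 0" "nmem st ''row'' 0 = row"
    and x: "nmem st ''x'' 0 = x" "x < 2 ^ l * row"
    and fil: "filled x (nmem st ''ch'') (rmem st ''D'')"
    and ch: "\<And>y. nmem st ''ch'' y \<le> W"
  shows "runs cost W entry_body st (160 * m + 210 * 2 ^ card (set_decode (x div row)) + 200)
    (\<lambda>st'. nmem st' ''x'' 0 = Suc x \<and> filled (Suc x) (nmem st' ''ch'') (rmem st' ''D'') \<and> (\<forall>y. nmem st' ''ch'' y \<le> W))"
proof -
  obtain S k v where S: "S < 2 ^ l" and k: "k \<le> n" and v: "v < n" and xe: "x = idx S k v"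
    using idx_encode[OF x(2)] by blast
  let ?ch = "nmem st ''ch''" and ?D = "rmem st ''D''"
  let ?U1 = "end_opts S v \<union> (\<Union>e \<in> {e. e < m \<and> 0 < k}. arc_opt ?ch ?D S k v e)"
  let ?U2 = "opts ?ch ?D S k v"
  have xS: "x div row = S" unfolding xe by (rule idx_decode[OF k v])
  have xW: "Suc x \<le> W" using x(2) by (intro index_le) simp
  show ?thesis
    unfolding entry_body_def xS
  proof (rule runs_Seq[of _ _ _ _ 100 "\<lambda>st'. ready S k v st' \<and> nmem st' ''e'' 0 = 0 \<and>
      nmem st' ''Y'' 0 = and (S - 1) S \<and> entry ?ch ?D x (end_opts S v) st'" _ "160 * m + 210 * 2 ^ card (set_decode S) + 100"])
    show "runs cost W entry_init st 100 (\<lambda>st'. ready S k v st' \<and> nmem st' ''e'' 0 = 0 \<and>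
      nmem st' ''Y'' 0 = and (S - 1) S \<and> entry ?ch ?D x (end_opts S v) st')"
      unfolding xe by (rule runs_entry_init) (use st x xe S k v ch in auto)
  next
    fix st1 assume st1: "ready S k v st1 \<and> nmem st1 ''e'' 0 = 0 \<and>
      nmem st1 ''Y'' 0 = and (S - 1) S \<and> entry ?ch ?D x (end_opts S v) st1"
    show "runs cost W (arc_loop ;; split_loop ;; NSet ''x'' (Inc (V ''x''))) st1
      (160 * m + 210 * 2 ^ card (set_decode S) + 100)
      (\<lambda>st'. nmem st' ''x'' 0 = Suc x \<and> filled (Suc x) (nmem st' ''ch'') (rmem st' ''D'') \<and> (\<forall>y. nmem st' ''ch'' y \<le> W))"
    proof (rule runs_Seq[of _ _ _ _ "160 * m + 30" "\<lambda>st'. entry ?ch ?D x ?U1 st' \<and> frame arc_loop st1 st'" _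
          "210 * 2 ^ card (set_decode S) + 70"])
      show "runs cost W arc_loop st1 (160 * m + 30) (\<lambda>st'. entry ?ch ?D x ?U1 st' \<and> frame arc_loop st1 st')"
        unfolding xe by (rule runs_frame, rule runs_arc_loop) (use st1 xe in auto)
    next
      fix st2 assume st2: "entry ?ch ?D x ?U1 st2 \<and> frame arc_loop st1 st2"
      have rd2: "ready S k v st2" by (rule ready_frame[of _ _ _ st1 arc_loop]) (use st1 st2 in simp_all)
      have Y2: "nmem st2 ''Y'' 0 = and (S - 1) S" using st1 frame_nmem[of arc_loop st1 st2 "''Y''"] st2 by simp
      show "runs cost W (split_loop ;; NSet ''x'' (Inc (V ''x''))) st2 (210 * 2 ^ card (set_decode S) + 70)
        (\<lambda>st'. nmem st' ''x'' 0 = Suc x \<and> filled (Suc x) (nmem st' ''ch'') (rmem st' ''D'') \<and> (\<forall>y. nmem st' ''ch'' y \<le> W))"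
      proof (rule runs_Seq[of _ _ _ _ "210 * 2 ^ card (set_decode S) + 30"
            "\<lambda>st'. entry ?ch ?D x ?U2 st' \<and> frame split_loop st2 st'" _ 40])
        show "runs cost W split_loop st2 (210 * 2 ^ card (set_decode S) + 30)
            (\<lambda>st'. entry ?ch ?D x ?U2 st' \<and> frame split_loop st2 st')"
          unfolding xe opts_def by (rule runs_frame, rule runs_split_loop) (use rd2 Y2 st2 xe in auto)
      next
        fix st3 assume st3: "entry ?ch ?D x ?U2 st3 \<and> frame split_loop st2 st3"
        have rd3: "ready S k v st3" by (rule ready_frame[of _ _ _ st2 split_loop]) (use rd2 st3 in simp_all)
        have x3: "nmem st3 ''x'' 0 = x" using readyD(1)[OF rd3] xe by simp
        have below: "nmem st3 ''ch'' y = ?ch y \<and> rmem st3 ''D'' y = ?D y" if "y < x" for y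
          using st3 that by (simp add: entry_def)
        have "filled (Suc x) (nmem st3 ''ch'') (rmem st3 ''D'')"
          unfolding filled_def
        proof (intro allI impI)
          fix S' k' v' assume h: "S' < 2 ^ l" "k' \<le> n" "v' < n" "idx S' k' v' < Suc x"
          \<comment> \<open>The arrays differ only from index \<open>x\<close> on, and no option of
            an entry up to \<open>x\<close> looks there.\<close>
          have o: "opts (nmem st3 ''ch'') (rmem st3 ''D'') S' k' v' = opts ?ch ?D S' k' v'"
            by (rule opts_cong) (use h below in auto)
          show "best (opts (nmem st3 ''ch'') (rmem st3 ''D'') S' k' v')
            (nmem st3 ''ch'' (idx S' k' v')) (rmem st3 ''D'' (idx S' k' v'))"
          proof (cases "idx S' k' v' < x")
            case True
            then show ?thesis using fil h below[OF True] unfolding o by (simp add: filled_def)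
          next
            case False
            then have eq: "idx S' k' v' = x" using h(4) by simp
            then have "S' = S" "k' = k" "v' = v"
              using idx_decode[OF k v, of S] idx_decode[OF h(2,3), of S'] unfolding xe by auto
            then show ?thesis using st3 unfolding o eq by (simp add: entry_def)
          qed
        qed
        then show "runs cost W (NSet ''x'' (Inc (V ''x''))) st3 40
          (\<lambda>st'. nmem st' ''x'' 0 = Suc x \<and> filled (Suc x) (nmem st' ''ch'') (rmem st' ''D'') \<and> (\<forall>y. nmem st' ''ch'' y \<le> W))"
          by (intro runs_loopfree) (use st3 x3 xW in \<open>simp_all add: entry_def\<close>)
      qed simp
    qed simp
  qed simp
qed

definition tabled :: "state \<Rightarrow> bool" where
  "tabled st \<longleftrightarrow> filled (2 ^ l * row) (nmem st ''ch'') (rmem st ''D'') \<and> (\<forall>y. nmem st ''ch'' y \<le> W) \<and>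
     nmem st ''row'' 0 = row \<and> nmem st ''tot'' 0 = 2 ^ l * row"

lemma runs_table:
  assumes st: "inp st" "counted st" "summed st" "marks l st" "rmem st ''zero'' 0 = 0" "nmem st ''p'' 0 = 2 ^ l"
    "nmem st ''ch'' = (\<lambda>_. 0)"
  shows "runs cost W table_prog st (row * (2 ^ l * (160 * m + 250) + 210 * 3 ^ l) + 100) tabled"
  unfolding table_prog_def
proof (rule runs_Seq[of _ _ _ _ 20 "\<lambda>st'. st' = nput ''row'' 0 row st" _ "row * (2 ^ l * (160 * m + 250) + 210 * 3 ^ l) + 80"])
  have r: "Suc n * n = row" by (simp add: row_def)
  have sn: "Suc n \<le> W" using cell_le[of "Suc n"] by simp
  show "runs cost W (NSet ''row'' (Op Times (Inc (V ''n'')) (V ''n''))) st 20 (\<lambda>st'. st' = nput ''row'' 0 row st)"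
    by (rule runs_loopfree) (use inpD(1)[OF st(1)] small_le sn r in simp_all)
next
  fix st1 assume st1: "st1 = nput ''row'' 0 row st"
  define st2 where "st2 = nput ''tot'' 0 (2 ^ l * row) st1"
  define st3 where "st3 = nput ''x'' 0 0 st2"
  have tW: "2 ^ l * row \<le> W" "2 ^ l \<le> W" using index_le mask_le by simp_all
  show "runs cost W (NSet ''tot'' (Op Times (V ''p'') (V ''row'')) ;; NSet ''x'' (Const 0) ;;
      While (NLess (V ''x'') (V ''tot'')) entry_body) st1 (row * (2 ^ l * (160 * m + 250) + 210 * 3 ^ l) + 80) tabled"
  proof (rule runs_Seq[of _ _ _ _ 20 "\<lambda>st'. st' = st2" _ "row * (2 ^ l * (160 * m + 250) + 210 * 3 ^ l) + 60"])
    show "runs cost W (NSet ''tot'' (Op Times (V ''p'') (V ''row''))) st1 20 (\<lambda>st'. st' = st2)"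
      by (rule runs_loopfree) (use st st1 small_le tW in \<open>simp_all add: st2_def\<close>)
  next
    fix st' assume [simp]: "st' = st2"
    show "runs cost W (NSet ''x'' (Const 0) ;; While (NLess (V ''x'') (V ''tot'')) entry_body) st'
      (row * (2 ^ l * (160 * m + 250) + 210 * 3 ^ l) + 60) tabled"
    proof (rule runs_Seq[of _ _ _ _ 20 "\<lambda>st'. st' = st3" _ "row * (2 ^ l * (160 * m + 250) + 210 * 3 ^ l) + 40"])
      show "runs cost W (NSet ''x'' (Const 0)) st' 20 (\<lambda>st'. st' = st3)"
        by (rule runs_loopfree) (simp_all add: st3_def)
    next
      fix st' assume [simp]: "st' = st3"
      have s3: "inp st3" "counted st3" "summed st3" "marks l st3" "rmem st3 ''zero'' 0 = 0"
        "nmem st3 ''ch'' = (\<lambda>_. 0)" "nmem st3 ''row'' 0 = row" "nmem st3 ''tot'' 0 = 2 ^ l * row" "nmem st3 ''x'' 0 = 0"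
        using st by (simp_all add: st3_def st2_def st1 inp_def counted_def summed_def marks_def)
      show "runs cost W (While (NLess (V ''x'') (V ''tot'')) entry_body) st'
        (row * (2 ^ l * (160 * m + 250) + 210 * 3 ^ l) + 40) tabled"
      proof (rule runs_For[where N = "2 ^ l * row" and f = "\<lambda>x. 160 * m + 210 * 2 ^ card (set_decode (x div row)) + 200" and
            I = "\<lambda>i st. nmem st ''x'' 0 = i \<and> filled i (nmem st ''ch'') (rmem st ''D'') \<and> (\<forall>y. nmem st ''ch'' y \<le> W)"])
        show "nmem st' ''x'' 0 = 0 \<and> filled 0 (nmem st' ''ch'') (rmem st' ''D'') \<and> (\<forall>y. nmem st' ''ch'' y \<le> W)"
          using s3 by (simp add: filled_def)
      next
        fix i and st4 :: state assume fr: "frame entry_body st' st4"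
          and I: "nmem st4 ''x'' 0 = i \<and> filled i (nmem st4 ''ch'') (rmem st4 ''D'') \<and> (\<forall>y. nmem st4 ''ch'' y \<le> W)"
        have inp4: "inp st4" by (rule inp_frame[OF _ fr]) (use s3 in simp_all)
        have keep: "nmem st4 ''cnt'' = nmem st3 ''cnt''" "nmem st4 ''tv'' = nmem st3 ''tv''" "nmem st4 ''row'' = nmem st3 ''row''"
          "nmem st4 ''tot'' = nmem st3 ''tot''" "rmem st4 ''CS'' = rmem st3 ''CS''" "rmem st4 ''zero'' = rmem st3 ''zero''"
          using frame_nmem[OF fr] frame_rmem[OF fr] by simp_all
        show "bfits W st4 (NLess (V ''x'') (V ''tot'')) \<and> (bval cost st4 (NLess (V ''x'') (V ''tot'')) \<longleftrightarrow> i < 2 ^ l * row)"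
          if "i \<le> 2 ^ l * row"
          using I that tW keep s3 by simp
        assume i: "i < 2 ^ l * row"
        show "runs cost W entry_body st4 (160 * m + 210 * 2 ^ card (set_decode (i div row)) + 200)
          (\<lambda>st. nmem st ''x'' 0 = Suc i \<and> filled (Suc i) (nmem st ''ch'') (rmem st ''D'') \<and> (\<forall>y. nmem st ''ch'' y \<le> W))"
          by (rule runs_entry_body) (use inp4 keep s3 I i in \<open>simp_all add: counted_def summed_def marks_def\<close>)
      next
        fix st4 :: state assume fr: "frame entry_body st' st4"
          and I: "nmem st4 ''x'' 0 = 2 ^ l * row \<and> filled (2 ^ l * row) (nmem st4 ''ch'') (rmem st4 ''D'') \<and>
            (\<forall>y. nmem st4 ''ch'' y \<le> W)"
        have "nmem st4 ''row'' = nmem st3 ''row''" "nmem st4 ''tot'' = nmem st3 ''tot''"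
          using frame_nmem[OF fr] by simp_all
        then show "tabled st4" using I s3 by (simp add: tabled_def)
      next
        let ?b = "bsteps (NLess (V ''x'') (V ''tot''))"
        have b: "?b = 5" by simp
        \<comment> \<open>All \<open>row\<close> entries of a mask have the same cost; summing over
          the masks turns \<open>2 ^ card\<close> into \<open>3 ^ l\<close>. The 206 is 200 plus 6
          steps of loop control.\<close>
        have "(\<Sum>x<2 ^ l * row. 160 * m + 210 * 2 ^ card (set_decode (x div row)) + 200 + 1 + ?b)
           = row * (\<Sum>S<2 ^ l. 160 * m + 206 + 210 * 2 ^ card (set_decode S))"
          unfolding b sum_div[symmetric] by (rule sum.cong) simp_all
        also have "\<dots> = row * (2 ^ l * (160 * m + 206) + 210 * 3 ^ l)"
          unfolding sum.distrib sum_distrib_left[symmetric] sum_two_power_card by (simp add: algebra_simps)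
        also have "\<dots> \<le> row * (2 ^ l * (160 * m + 250) + 210 * 3 ^ l)"
          by (intro mult_le_mono2 add_mono) auto
        finally show "(\<Sum>x<2 ^ l * row. 160 * m + 210 * 2 ^ card (set_decode (x div row)) + 200 + 1 + ?b) + 1 + ?b
          \<le> row * (2 ^ l * (160 * m + 250) + 210 * 3 ^ l) + 40" unfolding b by linarith
      qed
    qed simp
  qed simp
qed simp

end

section \<open>Reading off a profile\<close>

definition path_cell :: "nexp \<Rightarrow> nexp" where
  "path_cell a = Op Plus (Op Times (V ''i'') (V ''n'')) a"

text \<open>The bound on \<open>j\<close> is \<open>len + 1\<close> because the arc just appended
  sits at position \<open>len\<close>, outside the recorded length.\<close>

definition erase_guard :: bexp where
  "erase_guard = BConj (NLess (V ''j'') (Inc (NCell ''len'' (V ''i''))))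
     (BNot (NEq (NCell ''tail'' (NCell ''path'' (path_cell (V ''j'')))) (V ''w'')))"

text \<open>A cycle is erased as soon as an arc closes it: the path is cut at the first arc that
  leaves the new vertex. The row thus always holds a simple path and never outgrows its
  \<open>n\<close> cells, however long the trace is.\<close>

definition arc_step :: com where
  "arc_step =
     (NSet ''e'' (Op Minus (NCell ''ch'' (V ''x'')) (Const 2)) ;;
      NSet ''x'' (Op Plus (Op Minus (Op Minus (V ''x'') (V ''v'')) (V ''n'')) (NCell ''head'' (V ''e''))) ;;
      NAssign ''path'' (path_cell (NCell ''len'' (V ''i''))) (V ''e'') ;;
      NSet ''w'' (NCell ''head'' (V ''e'')) ;;
      NSet ''j'' (Const 0)) ;;
     While erase_guard (NSet ''j'' (Inc (V ''j''))) ;;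
     NAssign ''len'' (V ''i'') (V ''j'')"

text \<open>The current player set is not stored but recovered as \<open>x div row\<close>. The cell
  \<open>b\<close> holds \<open>2 ^ i\<close>, so one bitwise operation tells which group contains
  player \<open>i\<close>.\<close>

definition split_step :: com where
  "split_step =
     NSet ''Y'' (Op Minus (NCell ''ch'' (V ''x'')) (Op Plus (V ''m'') (Const 2))) ;;
     IfThen (NLess (Const 0) (Op BitAnd (V ''Y'') (V ''b'')))
       (NSet ''x'' (Op Plus (Op Plus (Op Times (V ''Y'') (V ''row'')) (Op Times (V ''n'') (V ''n''))) (V ''v'')))
       (NSet ''x'' (Op Plus (Op Plus (Op Times (Op Minus (Op Div (V ''x'') (V ''row'')) (V ''Y'')) (V ''row''))
          (Op Times (V ''n'') (V ''n''))) (V ''v'')))"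

definition trace_body :: com where
  "trace_body = NSet ''v'' (Op Mod (V ''x'') (V ''n'')) ;;
     IfThen (NLess (NCell ''ch'' (V ''x'')) (Op Plus (V ''m'') (Const 2))) arc_step split_step"

definition player_body :: com where
  "player_body = (NSet ''x'' (V ''apex'') ;; NAssign ''len'' (V ''i'') (Const 0)) ;;
     While (NLess (Const 1) (NCell ''ch'' (V ''x''))) trace_body ;;
     (NSet ''b'' (Op Plus (V ''b'') (V ''b'')) ;; NSet ''i'' (Inc (V ''i'')))"

definition profile_prog :: com where
  "profile_prog = (NSet ''feasible'' (Const 1) ;; RAssign ''value'' (Const 0) (RCell ''D'' (V ''apex'')) ;;
       NSet ''i'' (Const 0) ;; NSet ''b'' (Const 1)) ;;
     While (NLess (V ''i'') (V ''l'')) player_body"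

text \<open>\<open>tot - row\<close> is the start of the block of the full mask
  \<open>2 ^ l - 1\<close>.\<close>

definition final_prog :: com where
  "final_prog = NSet ''apex'' (Op Plus (Op Plus (Op Minus (V ''tot'') (V ''row'')) (Op Times (V ''n'') (V ''n''))) (V ''root'')) ;;
     IfThen (NLess (V ''l'') (Const 1)) (NSet ''feasible'' (Const 1))
       (IfThen (NLess (Const 0) (NCell ''ch'' (V ''apex''))) profile_prog Skip)"

lemma writes_steps [simp]:
  "nwrites arc_step = {''e'', ''x'', ''path'', ''w'', ''j'', ''len''}" "rwrites arc_step = {}"
  "nwrites split_step = {''Y'', ''x''}" "rwrites split_step = {}"
  by (auto simp: arc_step_def split_step_def)

lemma writes_trace_body [simp]:
  "nwrites trace_body = {''v'', ''e'', ''x'', ''path'', ''w'', ''j'', ''len'', ''Y''}" "rwrites trace_body = {}"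
  by (auto simp: trace_body_def)

lemma writes_player_body [simp]:
  "nwrites player_body = {''v'', ''e'', ''x'', ''path'', ''w'', ''j'', ''len'', ''Y'', ''b'', ''i''}" "rwrites player_body = {}"
  by (auto simp: player_body_def)

section \<open>Loop erasure\<close>

lemma (in wf_digraph) awalk_verts_eq: "awalk u p v \<Longrightarrow> awalk_verts u p = map (tail G) p @ [v]"
  by (auto simp: awalk_verts_conv dest: awlast_if_cas simp flip: awlast_of_awalk)

text \<open>The tails along \<open>P @ [e]\<close> are distinct, as \<open>P\<close> is simple and
  ends in the tail of \<open>e\<close>. By the choice of \<open>j\<close>, the vertex
  \<open>w\<close> is no tail in the kept prefix, so appending it as the last vertex repeats
  nothing.\<close>

lemma (in wf_digraph) loop_erase:
  assumes P: "apath r P v" and e: "e \<in> arcs G" "tail G e = v" "head G e = w"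
    and j: "j \<le> Suc (length P)" "\<forall>k<j. tail G ((P @ [e]) ! k) \<noteq> w"
    and stop: "j = Suc (length P) \<or> tail G ((P @ [e]) ! j) = w"
  shows "apath r (take j (P @ [e])) w"
proof -
  let ?Q = "P @ [e]"
  have aw: "awalk r P v" using P by (simp add: apath_def)
  then have "awalk r ?Q w" using e by (auto simp: awalk_Cons_iff awalk_Nil_iff)
  have dist: "distinct (map (tail G) ?Q)"
    using P awalk_verts_eq[OF aw] e by (simp add: apath_def)
  have w: "awalk r (take j ?Q) w"
  proof (cases "j < length ?Q")
    case True
    then have "?Q = take j ?Q @ ?Q ! j # drop (Suc j) ?Q" by (rule id_take_nth_drop)
    then have "awalk r (take j ?Q @ ?Q ! j # drop (Suc j) ?Q) w" using \<open>awalk r ?Q w\<close> by simp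
    then have "awalk r (take j ?Q) (tail G (?Q ! j))" by (auto simp only: awalk_append_iff awalk_Cons_iff)
    then show ?thesis using stop True by auto
  qed (use \<open>awalk r ?Q w\<close> in simp)
  have "distinct (map (tail G) (take j ?Q))"
    unfolding take_map[symmetric] by (rule distinct_take) (rule dist)
  moreover have "w \<notin> set (map (tail G) (take j ?Q))"
  proof
    assume "w \<in> set (map (tail G) (take j ?Q))"
    then obtain k where k: "k < length (map (tail G) (take j ?Q))" "map (tail G) (take j ?Q) ! k = w"
      unfolding in_set_conv_nth by blast
    then have "k < j" "tail G (?Q ! k) = w" by (auto simp del: take_append)
    then show False using j(2) by blast
  qed
  ultimately have "distinct (awalk_verts r (take j ?Q))"
    unfolding awalk_verts_eq[OF w] by simp
  then show ?thesis using w by (simp add: apath_def)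
qed

context machine_run
begin

section \<open>Tracing the players on the machine\<close>

definition path_row :: "nat \<Rightarrow> state \<Rightarrow> nat list" where
  "path_row i st = map (\<lambda>j. nmem st ''path'' (i * n + j)) [0..<nmem st ''len'' i]"

lemma length_path_row [simp]: "length (path_row i st) = nmem st ''len'' i"
  by (simp add: path_row_def)

lemma path_cell_le: "i < l \<Longrightarrow> k \<le> n \<Longrightarrow> i * n + k \<le> W"
proof (rule cell_le)
  assume "i < l" "k \<le> n"
  have "(i + 1) * n \<le> l * n" using \<open>i < l\<close> by (intro mult_le_mono1) simp
  moreover have "l * n \<le> (l + 1) * (m + n + 1)" by (intro mult_le_mono) auto
  ultimately show "i * n + k \<le> (l + 1) * (m + n + 1)" using \<open>k \<le> n\<close> by simp
qed

context
  fixes ch :: "nat \<Rightarrow> nat" and D :: "nat \<Rightarrow> real"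
  assumes filled: "filled (2 ^ l * row) ch D"
    and ch_le: "\<And>y. ch y \<le> W"
    and apex_pos: "0 < ch apex"
begin

definition routed :: "nat \<Rightarrow> state \<Rightarrow> bool" where
  "routed j st \<longleftrightarrow> apath r (path_row j st) (terms ! j) \<and> set (path_row j st) \<subseteq> set (trace ch j apex)"

text \<open>A simple path has fewer than \<open>n\<close> arcs and stays within its own row; writing
  the rows of later players cannot damage it.\<close>

lemma routed_cong:
  assumes "routed j st" "nmem st' ''len'' j = nmem st ''len'' j"
    "\<And>y. y < (j + 1) * n \<Longrightarrow> nmem st' ''path'' y = nmem st ''path'' y"
  shows "routed j st'"
proof -
  have "length (path_row j st) < n" using assms(1) length_apath_less unfolding routed_def by blast
  then have "path_row j st' = path_row j st"
    unfolding path_row_def assms(2) length_path_row by (intro map_cong refl assms(3)) auto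
  then show ?thesis using assms(1) by (simp add: routed_def)
qed

definition context_ok :: "nat \<Rightarrow> state \<Rightarrow> bool" where
  "context_ok i st \<longleftrightarrow> inp st \<and> nmem st ''ch'' = ch \<and> nmem st ''row'' 0 = row \<and> nmem st ''apex'' 0 = apex \<and>
     nmem st ''i'' 0 = i \<and> nmem st ''b'' 0 = 2 ^ i \<and> i < l"

lemma context_ok_frame:
  assumes "context_ok i st" "frame p st st'"
    "nwrites p \<inter> {''n'', ''m'', ''tail'', ''head'', ''root'', ''l'', ''term'', ''ch'', ''row'', ''apex'', ''i'', ''b''} = {}"
  shows "context_ok i st'"
proof -
  have "nmem st' y = nmem st y" if "y \<in> {''ch'', ''row'', ''apex'', ''i'', ''b''}" for y
    using assms(2,3) that by (intro frame_nmem) auto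
  moreover have "inp st'"
    using assms(1) by (intro inp_frame[OF _ assms(2)]) (use assms(3) in \<open>auto simp: context_ok_def\<close>)
  ultimately show ?thesis using assms(1) by (simp add: context_ok_def)
qed

text \<open>Player \<open>i\<close> has reached the table entry \<open>x\<close>; the arcs passed so far, with all cycles removed,
  are in row \<open>i\<close> of the path array.\<close>

definition tracing :: "nat \<Rightarrow> nat \<Rightarrow> state \<Rightarrow> bool" where
  "tracing i x st \<longleftrightarrow> nmem st ''x'' 0 = x \<and> (\<forall>j<i. routed j st) \<and> (\<forall>y. nmem st ''path'' y \<le> W) \<and>
     (\<exists>S k v. x = idx S k v \<and> S < 2 ^ l \<and> k \<le> n \<and> v < n \<and> i \<in> set_decode S \<and> 0 < ch x \<and>
       apath r (path_row i st) v \<and> set (path_row i st) \<union> set (trace ch i x) \<subseteq> set (trace ch i apex))"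

lemma runs_arc_step:
  assumes ctx: "context_ok i st" and tr: "tracing i x st" and v: "nmem st ''v'' 0 = x mod n"
    and c: "1 < ch x" "ch x < m + 2"
  shows "runs cost W arc_step st (100 * n + 300) (\<lambda>st'. \<exists>y<x. tracing i y st')"
proof -
  obtain S k v where x: "x = idx S k v" and S: "S < 2 ^ l" and k: "k \<le> n" and vn: "v < n" and iS: "i \<in> set_decode S"
    and chx: "0 < ch x" and P: "apath r (path_row i st) v"
    and sub: "set (path_row i st) \<union> set (trace ch i x) \<subseteq> set (trace ch i apex)"
    using tr by (auto simp: tracing_def)
  have xs: "nmem st ''x'' 0 = x" and pW: "\<And>y. nmem st ''path'' y \<le> W" and rts: "\<forall>j<i. routed j st"
    using tr by (auto simp: tracing_def)
  have ctx': "inp st" "nmem st ''ch'' = ch" "nmem st ''i'' 0 = i" "i < l" using ctx by (auto simp: context_ok_def)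
  note inps = inpD[OF ctx'(1)]
  from filled S k vn x chx obtain e where e: "ch x = e + 2" "e < m" "tail G e = v" "0 < k" "0 < ch (idx S (k - 1) (head G e))"
    "idx S (k - 1) (head G e) < x" "trace ch i x = e # trace ch i (idx S (k - 1) (head G e))"
  proof (cases rule: table_cases)
    case (Arc e)
    then show ?thesis by (intro that[of e]) auto
  qed (use c in auto)
  let ?y = "idx S (k - 1) (head G e)" and ?w = "head G e" and ?L = "nmem st ''len'' i"
  have y: "x - v - n + ?w = ?y" unfolding x by (rule idx_pred(1)[OF e(4) k vn])
  \<comment> \<open>The recorded path is simple, so there is still room in row \<open>i\<close> for
    the arc to be appended.\<close>
  have L: "?L < n" using length_apath_less[OF P] by simp
  have xW: "x \<le> W" unfolding x by (rule index_le) (use idx_less[OF S k vn] in simp)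
  have lW: "e \<le> W" "?w \<le> W" "v \<le> W" "?y \<le> W" "i \<le> W" "i * n \<le> W" "?L \<le> W" "i * n + ?L \<le> W"
    using e(2,6) head_less[OF e(2)] vn small_le xW ctx'(4) L path_cell_le[OF ctx'(4), of 0] path_cell_le[OF ctx'(4), of ?L]
    by simp_all
  have vx: "nmem st ''v'' 0 = v" using v idx_decode(3)[OF k vn] x by simp
  define st1 where "st1 = nput ''j'' 0 0 (nput ''w'' 0 ?w (nput ''path'' (i * n + ?L) e (nput ''x'' 0 ?y (nput ''e'' 0 e st))))"
  let ?P = "path_row i st"
  let ?Q = "?P @ [e]"
  have Q: "nmem st1 ''path'' (i * n + a) = ?Q ! a" if "a \<le> ?L" for a
    using that by (auto simp: st1_def path_row_def nth_append)
  have lenQ: "length ?Q = Suc ?L" by simp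
  have Qm: "?Q ! a < m" if "a < Suc ?L" for a
  proof -
    have "set ?Q \<subseteq> arcs G" using P e(2) arcs_iff by (auto simp: apath_def)
    then show ?thesis using that lenQ arcs_iff by (metis nth_mem subsetD)
  qed
  have path1: "nmem st1 ''path'' a \<le> W" for a using pW lW by (simp add: st1_def)
  show ?thesis
    unfolding arc_step_def
  proof (rule runs_Seq[of _ _ _ _ 100 "\<lambda>st'. st' = st1" _ "100 * n + 200"])
    show "runs cost W (NSet ''e'' (Op Minus (NCell ''ch'' (V ''x'')) (Const 2)) ;;
      NSet ''x'' (Op Plus (Op Minus (Op Minus (V ''x'') (V ''v'')) (V ''n'')) (NCell ''head'' (V ''e''))) ;;
      NAssign ''path'' (path_cell (NCell ''len'' (V ''i''))) (V ''e'') ;;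
      NSet ''w'' (NCell ''head'' (V ''e'')) ;;
      NSet ''j'' (Const 0)) st 100 (\<lambda>st'. st' = st1)"
      by (rule runs_loopfree)
        (use ctx' inps xs ch_le[of x] e(1,2) y lW small_le vx xW in \<open>simp_all add: st1_def path_cell_def\<close>)
  next
    fix st' assume [simp]: "st' = st1"
    show "runs cost W (While erase_guard (NSet ''j'' (Inc (V ''j''))) ;; NAssign ''len'' (V ''i'') (V ''j'')) st'
      (100 * n + 200) (\<lambda>st'. \<exists>y<x. tracing i y st')"
    proof (rule runs_Seq[of _ _ _ _ "100 * n + 150" "\<lambda>st'. \<exists>j. st' = nput ''j'' 0 j st1 \<and> j \<le> Suc ?L \<and>
        (\<forall>a<j. tail G (?Q ! a) \<noteq> ?w) \<and> (j = Suc ?L \<or> tail G (?Q ! j) = ?w)" _ 20])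
      show "runs cost W (While erase_guard (NSet ''j'' (Inc (V ''j'')))) st' (100 * n + 150) (\<lambda>st'. \<exists>j. st' = nput ''j'' 0 j st1 \<and> j \<le> Suc ?L \<and>
        (\<forall>a<j. tail G (?Q ! a) \<noteq> ?w) \<and> (j = Suc ?L \<or> tail G (?Q ! j) = ?w))"
      \<comment> \<open>A linear search for the first arc that leaves the new vertex
        \<open>?w\<close>; it runs past the appended arc if there is none.\<close>
      proof (rule runs_While[where I = "\<lambda>st'. \<exists>j. st' = nput ''j'' 0 j st1 \<and> j \<le> Suc ?L \<and> (\<forall>a<j. tail G (?Q ! a) \<noteq> ?w)"
            and \<mu> = "\<lambda>st. 100 * (Suc ?L - nmem st ''j'' 0)"])
        show "\<exists>j. st' = nput ''j'' 0 j st1 \<and> j \<le> Suc ?L \<and> (\<forall>a<j. tail G (?Q ! a) \<noteq> ?w)"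
          by (intro exI[of _ 0]) (simp add: st1_def nput_def)
        show "100 * (Suc ?L - nmem st' ''j'' 0) + 1 + bsteps erase_guard \<le> 100 * n + 150"
          using L by (simp add: erase_guard_def path_cell_def)
      next
        fix st2 :: state assume "\<exists>j. st2 = nput ''j'' 0 j st1 \<and> j \<le> Suc ?L \<and> (\<forall>a<j. tail G (?Q ! a) \<noteq> ?w)"
        then obtain j where st2: "st2 = nput ''j'' 0 j st1" and j: "j \<le> Suc ?L" "\<forall>a<j. tail G (?Q ! a) \<noteq> ?w" by blast
        have inp2: "inp st2" using ctx'(1) by (simp add: st2 st1_def inp_def)
        have mem2: "nmem st2 ''j'' 0 = j" "nmem st2 ''i'' 0 = i" "nmem st2 ''len'' i = ?L" "nmem st2 ''w'' 0 = ?w"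
          "nmem st2 ''path'' = nmem st1 ''path''" using ctx' by (simp_all add: st2 st1_def)
        have jW: "j \<le> W" "Suc ?L \<le> W" "Suc j \<le> W \<or> j = Suc ?L" "i * n + j \<le> W"
          using j(1) L small_le(3) path_cell_le[OF ctx'(4), of j] by auto
        \<comment> \<open>\<open>BConj\<close> evaluates both conjuncts, so for
          \<open>j = Suc ?L\<close> the cell behind the appended arc is read as well. Hence the
          contents of all cells of \<open>path\<close> and \<open>tail\<close> must fit, not only
          those in use.\<close>
        show "bfits W st2 erase_guard"
          unfolding erase_guard_def path_cell_def
          using inpD[OF inp2] mem2 jW lW small_le path1 by simp
        have guard: "bval cost st2 erase_guard \<longleftrightarrow> j < Suc ?L \<and> tail G (?Q ! j) \<noteq> ?w"
        proof (cases "j < Suc ?L")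
          case True
          then have "nmem st2 ''tail'' (?Q ! j) = tail G (?Q ! j)" using inpD(5)[OF inp2 Qm[of j]] by simp
          then show ?thesis using True mem2 Q[of j] inpD(1)[OF inp2] by (auto simp: erase_guard_def path_cell_def)
        next
          case False
          then show ?thesis using mem2 by (simp add: erase_guard_def)
        qed
        show "\<exists>j. st2 = nput ''j'' 0 j st1 \<and> j \<le> Suc ?L \<and> (\<forall>a<j. tail G (?Q ! a) \<noteq> ?w) \<and> (j = Suc ?L \<or> tail G (?Q ! j) = ?w)"
          if "\<not> bval cost st2 erase_guard"
          using that st2 j guard by (intro exI[of _ j]) auto
        assume "bval cost st2 erase_guard"
        then have jL: "j < Suc ?L" "tail G (?Q ! j) \<noteq> ?w" using guard by auto
        have eq: "nput ''j'' 0 (Suc j) st2 = nput ''j'' 0 (Suc j) st1" by (simp add: st2 nput_def)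
        have "runs cost W (NSet ''j'' (Inc (V ''j''))) st2 10 (\<lambda>st'.
          (\<exists>j. st' = nput ''j'' 0 j st1 \<and> j \<le> Suc ?L \<and> (\<forall>a<j. tail G (?Q ! a) \<noteq> ?w)) \<and>
          100 * (Suc ?L - nmem st' ''j'' 0) + 10 + 1 + bsteps erase_guard \<le> 100 * (Suc ?L - nmem st2 ''j'' 0))"
        proof (rule runs_loopfree)
          show "safe cost W (NSet ''j'' (Inc (V ''j''))) st2" using mem2 jW jL small_le by simp
          have p: "post cost (NSet ''j'' (Inc (V ''j''))) st2 = nput ''j'' 0 (Suc j) st1" using mem2 eq by simp
          \<comment> \<open>One iteration takes at most \<open>10 + 1 + 80\<close> steps, within the
            100 reserved per position.\<close>
          have "bsteps erase_guard \<le> 80" by (simp add: erase_guard_def path_cell_def)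
          then show "(\<exists>j. post cost (NSet ''j'' (Inc (V ''j''))) st2 = nput ''j'' 0 j st1 \<and> j \<le> Suc ?L \<and> (\<forall>a<j. tail G (?Q ! a) \<noteq> ?w)) \<and>
            100 * (Suc ?L - nmem (post cost (NSet ''j'' (Inc (V ''j''))) st2) ''j'' 0) + 10 + 1 + bsteps erase_guard \<le> 100 * (Suc ?L - nmem st2 ''j'' 0)"
            unfolding p mem2 using jL j by (intro conjI exI[of _ "Suc j"]) (auto simp: less_Suc_eq)
        qed simp_all
        then show "\<exists>f. runs cost W (NSet ''j'' (Inc (V ''j''))) st2 f (\<lambda>st'.
          (\<exists>j. st' = nput ''j'' 0 j st1 \<and> j \<le> Suc ?L \<and> (\<forall>a<j. tail G (?Q ! a) \<noteq> ?w)) \<and>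
          100 * (Suc ?L - nmem st' ''j'' 0) + f + 1 + bsteps erase_guard \<le> 100 * (Suc ?L - nmem st2 ''j'' 0))" by blast
      qed
    next
      fix st2 assume "\<exists>j. st2 = nput ''j'' 0 j st1 \<and> j \<le> Suc ?L \<and>
        (\<forall>a<j. tail G (?Q ! a) \<noteq> ?w) \<and> (j = Suc ?L \<or> tail G (?Q ! j) = ?w)"
      then obtain j where st2: "st2 = nput ''j'' 0 j st1" and j: "j \<le> Suc ?L" "\<forall>a<j. tail G (?Q ! a) \<noteq> ?w"
        "j = Suc ?L \<or> tail G (?Q ! j) = ?w" by blast
      define st3 where "st3 = nput ''len'' i j st2"
      have row3: "path_row i st3 = take j ?Q"
      proof (rule nth_equalityI)
        show "length (path_row i st3) = length (take j ?Q)" using j(1) by (simp add: st3_def)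
        fix a assume "a < length (path_row i st3)"
        then have "a < j" by (simp add: st3_def)
        then show "path_row i st3 ! a = take j ?Q ! a"
          using Q[of a] j(1) by (simp add: path_row_def st3_def st2 del: take_append)
      qed
      have ap: "apath r (path_row i st3) ?w"
        unfolding row3 by (rule loop_erase[OF P _ e(3) refl]) (use e(2) arcs_iff j in auto)
      have "set (path_row i st3) \<subseteq> set ?Q" unfolding row3 by (rule set_take_subset)
      then have sub3: "set (path_row i st3) \<union> set (trace ch i ?y) \<subseteq> set (trace ch i apex)"
        using sub e(7) by auto
      have r3: "routed a st3" if "a < i" for a
      proof (rule routed_cong)
        show "routed a st" using rts that by blast
        show "nmem st3 ''len'' a = nmem st ''len'' a" using that by (simp add: st3_def st2 st1_def)
        have "(a + 1) * n \<le> i * n" using that by (intro mult_le_mono1) simp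
        then show "nmem st3 ''path'' z = nmem st ''path'' z" if "z < (a + 1) * n" for z
          using that by (simp add: st3_def st2 st1_def)
      qed
      have "tracing i ?y st3"
      proof -
        have 1: "nmem st3 ''x'' 0 = ?y" "\<forall>y. nmem st3 ''path'' y \<le> W" "\<forall>a<i. routed a st3" "k - 1 \<le> n"
          using path1 r3 k by (simp_all add: st3_def st2 st1_def)
        from 1 S head_less[OF e(2)] iS e(5) ap sub3 show ?thesis unfolding tracing_def by blast
      qed
      moreover have "j \<le> W" using j(1) L small_le(3) by simp
      ultimately show "runs cost W (NAssign ''len'' (V ''i'') (V ''j'')) st2 20 (\<lambda>st'. \<exists>y<x. tracing i y st')"
        by (intro runs_loopfree)
          (use e(6) ctx' lW in \<open>auto simp: st3_def st2 st1_def\<close>)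
    qed simp
  qed simp
qed

text \<open>A split changes neither the vertex nor the recorded path; \<open>S'\<close> is whichever
  group contains player \<open>i\<close>.\<close>

lemma tracing_jump:
  assumes tr: "tracing i x st" and S': "i \<in> set_decode S'" "S' < 2 ^ l" and v: "v < n" "x mod n = v"
    and ch: "0 < ch (idx S' n v)" and eq: "trace ch i x = trace ch i (idx S' n v)"
  shows "tracing i (idx S' n v) (nput ''x'' 0 (idx S' n v) (nput ''Y'' 0 Y st))" (is "tracing i ?y ?st")
proof -
  have rows: "path_row j ?st = path_row j st" for j by (simp add: path_row_def)
  obtain S k v' where x: "x = idx S k v'" "k \<le> n" "v' < n" and P: "apath r (path_row i st) v'"
    and sub: "set (path_row i st) \<union> set (trace ch i x) \<subseteq> set (trace ch i apex)"
    using tr unfolding tracing_def by blast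
  have "v' = v" using x idx_decode(3) v(2) by simp
  then have P': "apath r (path_row i ?st) v" using P rows by simp
  have sub': "set (path_row i ?st) \<union> set (trace ch i ?y) \<subseteq> set (trace ch i apex)"
    using sub by (simp only: rows eq)
  have 1: "\<forall>j<i. routed j ?st" using tr unfolding tracing_def routed_def rows by blast
  have 2: "nmem ?st ''x'' 0 = ?y" "\<forall>z. nmem ?st ''path'' z \<le> W" using tr by (simp_all add: tracing_def)
  from 1 2 P' sub' S' v(1) ch order_refl[of n] show ?thesis
    unfolding tracing_def by blast
qed

lemma runs_split_step:
  assumes ctx: "context_ok i st" and tr: "tracing i x st" and v: "nmem st ''v'' 0 = x mod n"
    and c: "m + 2 \<le> ch x"
  shows "runs cost W split_step st 100 (\<lambda>st'. \<exists>y<x. tracing i y st')"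
proof -
  obtain S k v where x: "x = idx S k v" and S: "S < 2 ^ l" and k: "k \<le> n" and vn: "v < n" and iS: "i \<in> set_decode S"
    and chx: "0 < ch x"
    using tr by (auto simp: tracing_def)
  have xs: "nmem st ''x'' 0 = x" using tr by (auto simp: tracing_def)
  have ctx': "inp st" "nmem st ''ch'' = ch" "nmem st ''b'' 0 = 2 ^ i" "nmem st ''row'' 0 = row" "i < l"
    using ctx by (auto simp: context_ok_def)
  note inps = inpD[OF ctx'(1)]
  note dec = idx_decode[OF k vn, of S, folded x]
  from filled S k vn x chx obtain Y where Y: "ch x = Y + m + 2" "set_decode Y \<subseteq> set_decode S" "0 < Y" "Y < S"
      "0 < ch (idx Y n v)" "0 < ch (idx (S - Y) n v)" "idx Y n v < x" "idx (S - Y) n v < x"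
      "trace ch i x = (if i \<in> set_decode Y then trace ch i (idx Y n v) else trace ch i (idx (S - Y) n v))"
  proof (cases rule: table_cases)
    case (Split Y)
    then show ?thesis by (intro that[of Y]) auto
  qed (use c in auto)
  have xW: "x \<le> W" unfolding x by (rule index_le) (use idx_less[OF S k vn] in simp)
  have eq: "Y * row + n * n + v = idx Y n v" "(S - Y) * row + n * n + v = idx (S - Y) n v" by (simp_all add: idx_def)
  have pW: "Y * row \<le> W" "Y * row + n * n \<le> W" "(S - Y) * row \<le> W" "(S - Y) * row + n * n \<le> W"
    "idx Y n v \<le> W" "idx (S - Y) n v \<le> W"
    using Y(7,8) xW eq by linarith+
  have mW: "m + 2 \<le> W" "Y \<le> W" "v \<le> W" "2 ^ i \<le> W"
    using code_le[of "m + 2"] ch_le[of x] Y(1) vn small_le(3) mask_le[of "2 ^ i"] ctx'(5) by simp_all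
  have vx: "nmem st ''v'' 0 = v" using v dec by simp
  have B: "set_decode (S - Y) = set_decode S - set_decode Y" by (rule set_decode_diff[OF Y(2)])
  show ?thesis
    unfolding split_step_def
  proof (rule runs_loopfree)
    let ?p = "NSet ''Y'' (Op Minus (NCell ''ch'' (V ''x'')) (Op Plus (V ''m'') (Const 2))) ;;
     IfThen (NLess (Const 0) (Op BitAnd (V ''Y'') (V ''b'')))
       (NSet ''x'' (Op Plus (Op Plus (Op Times (V ''Y'') (V ''row'')) (Op Times (V ''n'') (V ''n''))) (V ''v'')))
       (NSet ''x'' (Op Plus (Op Plus (Op Times (Op Minus (Op Div (V ''x'') (V ''row'')) (V ''Y'')) (V ''row''))
          (Op Times (V ''n'') (V ''n''))) (V ''v'')))"
    note facts = ctx' inps xs Y(1) eq pW mW small_le vx dec xW ch_le[of x]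
    show "loopfree ?p" "dur ?p \<le> 100" by simp_all
    show "safe cost W ?p st" using facts by simp
    define S' where "S' = (if i \<in> set_decode Y then Y else S - Y)"
    have "post cost ?p st = nput ''x'' 0 (idx S' n v) (nput ''Y'' 0 Y st)"
      using facts by (simp add: S'_def and_two_power_pos_iff)
    moreover have "tracing i (idx S' n v) (nput ''x'' 0 (idx S' n v) (nput ''Y'' 0 Y st))"
      by (rule tracing_jump[OF tr]) (use Y iS B S vn dec in \<open>auto simp: S'_def\<close>)
    moreover have "idx S' n v < x" using Y(7,8) by (simp add: S'_def)
    ultimately show "\<exists>y<x. tracing i y (post cost ?p st)" by auto
  qed
qed

lemma runs_trace_body:
  assumes ctx: "context_ok i st" and tr: "tracing i x st" and c: "1 < ch x"
  shows "runs cost W trace_body st (100 * n + 350) (\<lambda>st'. \<exists>y<x. tracing i y st')"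
  unfolding trace_body_def
proof (rule runs_Seq[of _ _ _ _ 10 "\<lambda>st'. st' = nput ''v'' 0 (x mod n) st" _ "100 * n + 340"])
  have ctx': "inp st" "nmem st ''ch'' = ch" "i < l" using ctx by (auto simp: context_ok_def)
  note inps = inpD[OF ctx'(1)]
  have xs: "nmem st ''x'' 0 = x" and xW: "x \<le> W"
    using tr idx_less index_le by (auto simp: tracing_def less_imp_le)
  show "runs cost W (NSet ''v'' (Op Mod (V ''x'') (V ''n''))) st 10 (\<lambda>st'. st' = nput ''v'' 0 (x mod n) st)"
    by (rule runs_loopfree) (use xs xW inps small_le in simp_all)
  fix st' assume st': "st' = nput ''v'' 0 (x mod n) st"
  have ctx1: "context_ok i st'" using ctx by (simp add: st' context_ok_def inp_def)
  have rows: "path_row j st' = path_row j st" for j by (simp add: path_row_def st')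
  have "routed j st' = routed j st" for j by (simp add: routed_def rows)
  then have tr1: "tracing i x st'" using tr unfolding tracing_def rows by (simp add: st')
  have v1: "nmem st' ''v'' 0 = x mod n" by (simp add: st')
  have cells: "nmem st' ''x'' 0 = x" "nmem st' ''ch'' = ch" "nmem st' ''m'' 0 = m"
    using xs ctx' inps by (simp_all add: st')
  have mW: "m + 2 \<le> W" using code_le[of "m + 2"] by simp
  show "runs cost W (IfThen (NLess (NCell ''ch'' (V ''x'')) (Op Plus (V ''m'') (Const 2))) arc_step split_step) st'
      (100 * n + 340) (\<lambda>st'. \<exists>y<x. tracing i y st')"
  proof (rule runs_If[where m = "100 * n + 300"])
    show "bfits W st' (NLess (NCell ''ch'' (V ''x'')) (Op Plus (V ''m'') (Const 2)))"
      using cells xW ch_le[of x] mW small_le by simp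
    show "runs cost W arc_step st' (100 * n + 300) (\<lambda>st'. \<exists>y<x. tracing i y st')"
      if "bval cost st' (NLess (NCell ''ch'' (V ''x'')) (Op Plus (V ''m'') (Const 2)))"
      by (rule runs_arc_step[OF ctx1 tr1 v1 c]) (use that cells in simp)
    show "runs cost W split_step st' (100 * n + 300) (\<lambda>st'. \<exists>y<x. tracing i y st')"
      if "\<not> bval cost st' (NLess (NCell ''ch'' (V ''x'')) (Op Plus (V ''m'') (Const 2)))"
      by (rule runs_weaken[OF runs_split_step[OF ctx1 tr1 v1]]) (use that cells in auto)
  qed simp
qed simp

lemma runs_player_body:
  assumes ctx: "context_ok i st" and routed: "\<forall>j<i. routed j st" and path: "\<forall>y. nmem st ''path'' y \<le> W"
  shows "runs cost W player_body st (2 ^ l * row * (100 * n + 400) + 100)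
    (\<lambda>st'. nmem st' ''i'' 0 = Suc i \<and> nmem st' ''b'' 0 = 2 ^ Suc i \<and> (\<forall>j<Suc i. routed j st') \<and>
      (\<forall>y. nmem st' ''path'' y \<le> W))"
  unfolding player_body_def
proof -
  have ctx': "inp st" "nmem st ''ch'' = ch" "i < l" "nmem st ''apex'' 0 = apex" "nmem st ''i'' 0 = i"
    using ctx by (auto simp: context_ok_def)
  have iW: "i \<le> W" "Suc i \<le> W" using ctx'(3) small_le(1) by simp_all
  have apexl: "apex < 2 ^ l * row" using idx_less[OF full_mask_less order_refl root_less] .
  then have aW: "apex \<le> W" by (intro index_le) simp
  define st1 where "st1 = nput ''len'' i 0 (nput ''x'' 0 apex st)"
  have ctx1: "context_ok i st1" using ctx by (simp add: st1_def context_ok_def inp_def)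
  have "routed j st1" if "j < i" for j
    by (rule routed_cong[of j st]) (use routed that in \<open>auto simp: st1_def\<close>)
  moreover have "path_row i st1 = []" by (simp add: path_row_def st1_def)
  moreover have "i \<in> set_decode (2 ^ l - 1)" using ctx'(3) by (simp only: set_decode_full lessThan_iff)
  ultimately have tr1: "tracing i apex st1"
    unfolding tracing_def using apex_pos path root_less root_in_verts
    by (intro conjI exI[of _ "2 ^ l - 1"] exI[of _ n] exI[of _ r]) (auto simp: st1_def apath_Nil_iff)
  let ?Q = "\<lambda>st'. nmem st' ''i'' 0 = Suc i \<and> nmem st' ''b'' 0 = 2 ^ Suc i \<and> (\<forall>j<Suc i. routed j st') \<and>
      (\<forall>y. nmem st' ''path'' y \<le> W)"
  show "runs cost W ((NSet ''x'' (V ''apex'') ;; NAssign ''len'' (V ''i'') (Const 0)) ;;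
     While (NLess (Const 1) (NCell ''ch'' (V ''x''))) trace_body ;;
     (NSet ''b'' (Op Plus (V ''b'') (V ''b'')) ;; NSet ''i'' (Inc (V ''i'')))) st (2 ^ l * row * (100 * n + 400) + 100) ?Q"
  proof (rule runs_Seq[of _ _ _ _ 20 "\<lambda>st'. st' = st1" _ "2 ^ l * row * (100 * n + 400) + 80"])
    show "runs cost W (NSet ''x'' (V ''apex'') ;; NAssign ''len'' (V ''i'') (Const 0)) st 20 (\<lambda>st'. st' = st1)"
      by (rule runs_loopfree) (use ctx' iW aW in \<open>simp_all add: st1_def\<close>)
  next
    fix st' assume [simp]: "st' = st1"
    show "runs cost W (While (NLess (Const 1) (NCell ''ch'' (V ''x''))) trace_body ;;
     (NSet ''b'' (Op Plus (V ''b'') (V ''b'')) ;; NSet ''i'' (Inc (V ''i'')))) st' (2 ^ l * row * (100 * n + 400) + 80) ?Q"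
    proof (rule runs_Seq[of _ _ _ _ "2 ^ l * row * (100 * n + 400) + 40"
          "\<lambda>st'. context_ok i st' \<and> (\<exists>x. tracing i x st' \<and> ch x = 1)" _ 40])
      show "runs cost W (While (NLess (Const 1) (NCell ''ch'' (V ''x''))) trace_body) st' (2 ^ l * row * (100 * n + 400) + 40)
        (\<lambda>st'. context_ok i st' \<and> (\<exists>x. tracing i x st' \<and> ch x = 1))"
      \<comment> \<open>The table index decreases in every step, so it bounds the number of
        remaining iterations. This is crude, but still affordable within
        \<open>3 ^ l\<close>.\<close>
      proof (rule runs_While[where I = "\<lambda>st'. \<exists>x. tracing i x st'" and \<mu> = "\<lambda>st. nmem st ''x'' 0 * (100 * n + 400)"])
        show "\<exists>x. tracing i x st'" using tr1 by auto
        have "nmem st' ''x'' 0 = apex" using tr1 by (simp add: tracing_def)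
        then show "nmem st' ''x'' 0 * (100 * n + 400) + 1 + bsteps (NLess (Const 1) (NCell ''ch'' (V ''x'')))
          \<le> 2 ^ l * row * (100 * n + 400) + 40"
        proof -
          have "apex * (100 * n + 400) \<le> 2 ^ l * row * (100 * n + 400)"
            using apexl by (intro mult_le_mono1) simp
          moreover have "bsteps (NLess (Const 1) (NCell ''ch'' (V ''x''))) \<le> 39" by simp
          ultimately show ?thesis unfolding \<open>nmem st' ''x'' 0 = apex\<close> by linarith
        qed
      next
        fix st2 assume fr: "frame trace_body st' st2" and "\<exists>x. tracing i x st2"
        then obtain x where tr2: "tracing i x st2" by blast
        have ctx2: "context_ok i st2" by (rule context_ok_frame[OF ctx1, of trace_body]) (use fr in simp_all)
        have ch2: "nmem st2 ''ch'' = ch" using ctx2 by (simp add: context_ok_def)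
        have xs: "nmem st2 ''x'' 0 = x" and xW: "x \<le> W" and pos: "0 < ch x"
          using tr2 idx_less index_le by (auto simp: tracing_def less_imp_le)
        show "bfits W st2 (NLess (Const 1) (NCell ''ch'' (V ''x'')))"
          using xs xW ch2 ch_le[of x] small_le by simp
        show "context_ok i st2 \<and> (\<exists>x. tracing i x st2 \<and> ch x = 1)"
          if "\<not> bval cost st2 (NLess (Const 1) (NCell ''ch'' (V ''x'')))"
          using that ctx2 tr2 pos xs ch2 by (auto intro!: exI[of _ x])
        assume "bval cost st2 (NLess (Const 1) (NCell ''ch'' (V ''x'')))"
        then have "1 < ch x" using xs ch2 by simp
        from runs_trace_body[OF ctx2 tr2 this]
        have "runs cost W trace_body st2 (100 * n + 350) (\<lambda>st'. (\<exists>x. tracing i x st') \<and>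
          nmem st' ''x'' 0 * (100 * n + 400) + (100 * n + 350) + 1 + bsteps (NLess (Const 1) (NCell ''ch'' (V ''x'')))
          \<le> nmem st2 ''x'' 0 * (100 * n + 400))"
        proof (rule runs_weaken)
          fix st3 assume "\<exists>y<x. tracing i y st3"
          then obtain y where y: "y < x" "tracing i y st3" by blast
          then have ys: "nmem st3 ''x'' 0 = y" by (simp add: tracing_def)
          have "(y + 1) * (100 * n + 400) \<le> x * (100 * n + 400)" using y(1) by (intro mult_le_mono1) simp
          then have "y * (100 * n + 400) + (100 * n + 350) + 50 \<le> x * (100 * n + 400)" by simp
          moreover have "bsteps (NLess (Const 1) (NCell ''ch'' (V ''x''))) \<le> 40" by simp
          ultimately have "y * (100 * n + 400) + (100 * n + 350) + 1 + bsteps (NLess (Const 1) (NCell ''ch'' (V ''x'')))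
            \<le> x * (100 * n + 400)" by linarith
          then show "(\<exists>x. tracing i x st3) \<and>
            nmem st3 ''x'' 0 * (100 * n + 400) + (100 * n + 350) + 1 + bsteps (NLess (Const 1) (NCell ''ch'' (V ''x'')))
            \<le> nmem st2 ''x'' 0 * (100 * n + 400)" using y unfolding ys xs by blast
        qed simp
        then show "\<exists>f. runs cost W trace_body st2 f (\<lambda>st'. (\<exists>x. tracing i x st') \<and>
          nmem st' ''x'' 0 * (100 * n + 400) + f + 1 + bsteps (NLess (Const 1) (NCell ''ch'' (V ''x'')))
          \<le> nmem st2 ''x'' 0 * (100 * n + 400))" by blast
      qed
    next
      fix st2 assume "context_ok i st2 \<and> (\<exists>x. tracing i x st2 \<and> ch x = 1)"
      then obtain x where ctx2: "context_ok i st2" and tr2: "tracing i x st2" and cx: "ch x = 1" by blast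
      obtain S k v where x: "x = idx S k v" and S: "S < 2 ^ l" and k: "k \<le> n" and vn: "v < n" and iS: "i \<in> set_decode S"
        and P: "apath r (path_row i st2) v"
        and sub: "set (path_row i st2) \<union> set (trace ch i x) \<subseteq> set (trace ch i apex)"
        using tr2 by (auto simp: tracing_def)
      \<comment> \<open>Code 1 occurs only at singleton masks; since the mask contains
        \<open>i\<close>, the vertex is the terminal of player \<open>i\<close>.\<close>
      have "v = terms ! i"
        using iS by (cases rule: table_cases[OF filled S k vn x]) (use cx set_decode_two_power in auto)
      then have "routed i st2" using P sub by (simp add: routed_def)
      then have rt: "routed j st2" if "j < Suc i" for j
        using tr2 that by (auto simp: tracing_def less_Suc_eq)
      define st3 where "st3 = nput ''i'' 0 (Suc i) (nput ''b'' 0 (2 ^ i + 2 ^ i) st2)"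
      have "routed j st3" if "j < Suc i" for j
        by (rule routed_cong[OF rt[OF that]]) (simp_all add: st3_def)
      moreover have "\<forall>y. nmem st3 ''path'' y \<le> W" using tr2 by (simp add: tracing_def st3_def)
      ultimately have "?Q st3" by (simp add: st3_def)
      moreover have "2 ^ i + 2 ^ i \<le> W" "2 ^ i \<le> W"
        using power_increasing[of "Suc i" l "2::nat"] ctx'(3) by (auto intro!: mask_le)
      ultimately show "runs cost W (NSet ''b'' (Op Plus (V ''b'') (V ''b'')) ;; NSet ''i'' (Inc (V ''i''))) st2 40 ?Q"
        by (intro runs_loopfree) (use ctx2 iW small_le in \<open>auto simp: st3_def context_ok_def\<close>)
    qed simp
  qed simp
qed

lemma runs_profile:
  assumes st: "inp st" "nmem st ''ch'' = ch" "rmem st ''D'' = D" "nmem st ''row'' 0 = row" "nmem st ''apex'' 0 = apex"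
    "\<forall>y. nmem st ''path'' y \<le> W"
  shows "runs cost W profile_prog st (l * (2 ^ l * row * (100 * n + 400) + 150) + 100)
    (\<lambda>st'. nmem st' ''feasible'' 0 = 1 \<and> rmem st' ''value'' 0 = D apex \<and> (\<forall>j<l. routed j st'))"
proof -
  define st1 where "st1 = nput ''b'' 0 1 (nput ''i'' 0 0 (rput ''value'' 0 (D apex) (nput ''feasible'' 0 1 st)))"
  have aW: "apex \<le> W" using idx_less[OF full_mask_less order_refl root_less] by (intro index_le) simp
  show ?thesis
    unfolding profile_prog_def
  proof (rule runs_Seq[of _ _ _ _ 40 "\<lambda>st'. st' = st1" _ "l * (2 ^ l * row * (100 * n + 400) + 150) + 60"])
    show "runs cost W (NSet ''feasible'' (Const 1) ;; RAssign ''value'' (Const 0) (RCell ''D'' (V ''apex'')) ;;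
       NSet ''i'' (Const 0) ;; NSet ''b'' (Const 1)) st 40 (\<lambda>st'. st' = st1)"
      by (rule runs_loopfree) (use st aW small_le in \<open>simp_all add: st1_def\<close>)
  next
    fix st' assume [simp]: "st' = st1"
    have st1: "inp st1" "nmem st1 ''ch'' = ch" "nmem st1 ''row'' 0 = row" "nmem st1 ''apex'' 0 = apex"
      "\<forall>y. nmem st1 ''path'' y \<le> W" "nmem st1 ''i'' 0 = 0" "nmem st1 ''b'' 0 = 1"
      "nmem st1 ''feasible'' 0 = 1" "rmem st1 ''value'' 0 = D apex"
      using st by (simp_all add: st1_def inp_def)
    show "runs cost W (While (NLess (V ''i'') (V ''l'')) player_body) st' (l * (2 ^ l * row * (100 * n + 400) + 150) + 60)
      (\<lambda>st'. nmem st' ''feasible'' 0 = 1 \<and> rmem st' ''value'' 0 = D apex \<and> (\<forall>j<l. routed j st'))"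
    proof (rule runs_For[where N = l and f = "\<lambda>_. 2 ^ l * row * (100 * n + 400) + 100" and
          I = "\<lambda>i st. nmem st ''i'' 0 = i \<and> nmem st ''b'' 0 = 2 ^ i \<and> (\<forall>j<i. routed j st) \<and> (\<forall>y. nmem st ''path'' y \<le> W)"])
      show "nmem st' ''i'' 0 = 0 \<and> nmem st' ''b'' 0 = 2 ^ 0 \<and> (\<forall>j<0. routed j st') \<and> (\<forall>y. nmem st' ''path'' y \<le> W)"
        using st1 by simp
    next
      fix i and st2 :: state assume fr: "frame player_body st' st2"
        and I: "nmem st2 ''i'' 0 = i \<and> nmem st2 ''b'' 0 = 2 ^ i \<and> (\<forall>j<i. routed j st2) \<and> (\<forall>y. nmem st2 ''path'' y \<le> W)"
      have inp2: "inp st2" by (rule inp_frame[OF _ fr]) (use st1 in simp_all)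
      have keep: "nmem st2 ''ch'' = nmem st1 ''ch''" "nmem st2 ''row'' = nmem st1 ''row''" "nmem st2 ''apex'' = nmem st1 ''apex''"
        using frame_nmem[OF fr] by simp_all
      show "bfits W st2 (NLess (V ''i'') (V ''l'')) \<and> (bval cost st2 (NLess (V ''i'') (V ''l'')) \<longleftrightarrow> i < l)" if "i \<le> l"
        using I inpD[OF inp2] that small_le(1) by simp
      assume "i < l"
      then have "context_ok i st2" using I inp2 keep st1 by (simp add: context_ok_def)
      then show "runs cost W player_body st2 (2 ^ l * row * (100 * n + 400) + 100)
        (\<lambda>st. nmem st ''i'' 0 = Suc i \<and> nmem st ''b'' 0 = 2 ^ Suc i \<and> (\<forall>j<Suc i. routed j st) \<and> (\<forall>y. nmem st ''path'' y \<le> W))"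
        by (rule runs_player_body) (use I in simp_all)
    next
      fix st2 :: state assume fr: "frame player_body st' st2"
        and I: "nmem st2 ''i'' 0 = l \<and> nmem st2 ''b'' 0 = 2 ^ l \<and> (\<forall>j<l. routed j st2) \<and> (\<forall>y. nmem st2 ''path'' y \<le> W)"
      have "nmem st2 ''feasible'' = nmem st1 ''feasible''" "rmem st2 ''value'' = rmem st1 ''value''"
        using frame_nmem[OF fr] frame_rmem[OF fr] by simp_all
      then show "nmem st2 ''feasible'' 0 = 1 \<and> rmem st2 ''value'' 0 = D apex \<and> (\<forall>j<l. routed j st2)"
        using st1 I by simp
    next
      let ?b = "bsteps (NLess (V ''i'') (V ''l''))" and ?A = "2 ^ l * row * (100 * n + 400)"
      have b: "?b = 5" by simp
      have "l * (?A + 106) \<le> l * (?A + 150)" by (rule mult_le_mono2) simp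
      moreover have "(\<Sum>i<l. ?A + 100 + 1 + ?b) = l * (?A + 106)" unfolding b by simp
      ultimately show "(\<Sum>i<l. ?A + 100 + 1 + ?b) + 1 + ?b \<le> l * (?A + 150) + 60" unfolding b by linarith
    qed
  qed simp
qed

end

end

section \<open>Correctness and running time\<close>

definition potential_prog :: com where
  "potential_prog = mask_prog ;; count_prog ;; cost_prog ;; table_prog ;; final_prog"

context machine_run
begin

definition outcome :: "state \<Rightarrow> bool" where
  "outcome st \<longleftrightarrow> is_min_potential (output_value st) \<and>
     (profiles \<noteq> {} \<longrightarrow> optimal_profile (output_profile n l st))"

text \<open>Treated separately because the full mask is then 0, whose table entries are all
  infinite, although the empty profile exists and has potential 0.\<close>

lemma outcome_no_players:
  assumes "l = 0" "nmem st ''feasible'' 0 = 1" "rmem st ''value'' 0 = 0"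
  shows "outcome st"
proof -
  have "profiles = {[]}" unfolding profiles_def using assms(1) by auto
  moreover have "potential [] = 0" by (simp add: potential_def)
  moreover have "output_profile n l st = []" using assms(1) by (simp add: output_profile_def)
  ultimately show ?thesis
    unfolding outcome_def is_min_potential_def optimal_profile_def output_value_def using assms(2,3) by simp
qed

lemma outcome_infeasible:
  assumes "filled (2 ^ l * row) ch D" "0 < l" "ch apex = 0" "nmem st ''feasible'' 0 = 0"
  shows "outcome st"
proof -
  have "profiles = {}" using table_le_potential[OF assms(1) _ assms(2)] assms(3) by fastforce
  then show ?thesis using assms(4) by (simp add: outcome_def is_min_potential_def output_value_def)
qed

lemma outcome_feasible:
  assumes "filled (2 ^ l * row) ch D" "0 < l" "0 < ch apex" "nmem st ''feasible'' 0 = 1"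
    "rmem st ''value'' 0 = D apex" "\<forall>j<l. routed ch j st" and ch_le: "\<And>y. ch y \<le> W"
  shows "outcome st"
proof -
  have nth: "output_profile n l st ! i = path_row i st" if "i < l" for i
    using that by (simp add: output_profile_def path_row_def)
  have rt: "apath r (path_row i st) (terms ! i)" "set (path_row i st) \<subseteq> set (trace ch i apex)" if "i < l" for i
    using assms(6) that unfolding routed_def[OF assms(1) ch_le assms(3)] by blast+
  have "optimal_profile (output_profile n l st) \<and> potential (output_profile n l st) = D apex"
  proof (rule optimal_from_table[OF assms(1-3)])
    show "length (output_profile n l st) = l" by (simp add: output_profile_def)
    show "apath r (output_profile n l st ! i) (terms ! i)" if "i < l" for i
      unfolding nth[OF that] by (rule rt(1)[OF that])
    show "set (output_profile n l st ! i) \<subseteq> set (trace ch i apex)" if "i < l" for i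
      unfolding nth[OF that] by (rule rt(2)[OF that])
  qed
  then show ?thesis
    using assms(4,5)
    by (auto simp: outcome_def is_min_potential_def output_value_def optimal_profile_def
        intro!: bexI[of _ "output_profile n l st"])
qed

lemma runs_final:
  assumes st: "inp st" "tabled st" "nmem st ''path'' = (\<lambda>_. 0)" "nmem st ''feasible'' 0 = 0" "rmem st ''value'' 0 = 0"
  shows "runs cost W final_prog st (l * (2 ^ l * row * (100 * n + 400) + 150) + 200) outcome"
  unfolding final_prog_def
proof (rule runs_Seq[of _ _ _ _ 40 "\<lambda>st'. st' = nput ''apex'' 0 apex st" _ "l * (2 ^ l * row * (100 * n + 400) + 150) + 160"])
  let ?ch = "nmem st ''ch''" and ?D = "rmem st ''D''"
  have tab: "filled (2 ^ l * row) ?ch ?D" "\<And>y. ?ch y \<le> W" "nmem st ''row'' 0 = row" "nmem st ''tot'' 0 = 2 ^ l * row"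
    using st(2) by (auto simp: tabled_def)
  note inps = inpD[OF st(1)]
  have aeq: "2 ^ l * row - row + n * n + r = apex" by (simp add: idx_def diff_mult_distrib)
  have apexl: "apex < 2 ^ l * row" using idx_less[OF full_mask_less order_refl root_less] .
  then have aW: "apex \<le> W" "2 ^ l * row \<le> W" "r \<le> W" "2 ^ l * row - row + n * n \<le> W"
    using index_le[of apex] index_le[of "2 ^ l * row"] aeq root_less small_le(3) by linarith+
  show "runs cost W (NSet ''apex'' (Op Plus (Op Plus (Op Minus (V ''tot'') (V ''row'')) (Op Times (V ''n'') (V ''n''))) (V ''root'')))
    st 40 (\<lambda>st'. st' = nput ''apex'' 0 apex st)"
    by (rule runs_loopfree) (use inps tab aW small_le aeq in simp_all)
  fix st1 assume st1: "st1 = nput ''apex'' 0 apex st"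
  have inp1: "inp st1" using st(1) by (simp add: st1 inp_def)
  have mem1: "nmem st1 ''ch'' = ?ch" "rmem st1 = rmem st" "nmem st1 ''apex'' 0 = apex" "nmem st1 ''row'' 0 = row"
    "nmem st1 ''path'' = (\<lambda>_. 0)" "nmem st1 ''feasible'' 0 = 0"
    using st tab by (simp_all add: st1)
  show "runs cost W (IfThen (NLess (V ''l'') (Const 1)) (NSet ''feasible'' (Const 1))
       (IfThen (NLess (Const 0) (NCell ''ch'' (V ''apex''))) profile_prog Skip)) st1
      (l * (2 ^ l * row * (100 * n + 400) + 150) + 160) outcome"
  proof (rule runs_If[where m = "l * (2 ^ l * row * (100 * n + 400) + 150) + 130"])
    show "bfits W st1 (NLess (V ''l'') (Const 1))" using inpD[OF inp1] small_le by simp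
    show "runs cost W (NSet ''feasible'' (Const 1)) st1 (l * (2 ^ l * row * (100 * n + 400) + 150) + 130) outcome"
      if "bval cost st1 (NLess (V ''l'') (Const 1))"
    proof (rule runs_loopfree)
      have "l = 0" using that inpD[OF inp1] by simp
      then show "outcome (post cost (NSet ''feasible'' (Const 1)) st1)"
        by (rule outcome_no_players) (use st(5) mem1 in simp_all)
    qed (use small_le in simp_all)
    assume "\<not> bval cost st1 (NLess (V ''l'') (Const 1))"
    then have l: "0 < l" using inpD[OF inp1] by simp
    show "runs cost W (IfThen (NLess (Const 0) (NCell ''ch'' (V ''apex''))) profile_prog Skip) st1
      (l * (2 ^ l * row * (100 * n + 400) + 150) + 130) outcome"
    proof (rule runs_If[where m = "l * (2 ^ l * row * (100 * n + 400) + 150) + 100"])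
      show "bfits W st1 (NLess (Const 0) (NCell ''ch'' (V ''apex'')))" using mem1 aW tab(2) by simp
      show "runs cost W Skip st1 (l * (2 ^ l * row * (100 * n + 400) + 150) + 100) outcome"
        if "\<not> bval cost st1 (NLess (Const 0) (NCell ''ch'' (V ''apex'')))"
        by (rule runs_loopfree) (use that mem1 outcome_infeasible[OF tab(1) l] in simp_all)
      assume "bval cost st1 (NLess (Const 0) (NCell ''ch'' (V ''apex'')))"
      then have pos: "0 < ?ch apex" using mem1 by simp
      show "runs cost W profile_prog st1 (l * (2 ^ l * row * (100 * n + 400) + 150) + 100) outcome"
        by (rule runs_weaken[OF runs_profile[OF tab(1,2) pos inp1]])
          (use mem1 outcome_feasible[OF tab(1) l pos] tab(2) in auto)
    qed simp
  qed simp
qed simp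

text \<open>The frames carry two things from phase to phase: the results computed so far, and the
  initial zeros of cells that a later phase presupposes.\<close>

lemma runs_potential:
  "runs cost W potential_prog (input_state G r terms)
     (50 * l + 50 * 2 ^ l + 50 * (l * m) + row * (2 ^ l * (160 * m + 250) + 210 * 3 ^ l) +
      l * (2 ^ l * row * (100 * n + 400) + 150) + 450) outcome"
  unfolding potential_prog_def
proof -
  let ?T3 = "row * (2 ^ l * (160 * m + 250) + 210 * 3 ^ l) + 100"
  let ?T4 = "l * (2 ^ l * row * (100 * n + 400) + 150) + 200"
  let ?st = "input_state G r terms"
  have inp0: "inp ?st" by (simp add: inp_def input_state_def contents_def)
  have zero: "rmem ?st = (\<lambda>_ _. 0)" "nmem ?st ''tv'' = (\<lambda>_. 0)" "nmem ?st ''cnt'' = (\<lambda>_. 0)" "nmem ?st ''ch'' = (\<lambda>_. 0)"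
    "nmem ?st ''path'' = (\<lambda>_. 0)" "nmem ?st ''feasible'' = (\<lambda>_. 0)"
    by (simp_all add: input_state_def)
  show "runs cost W (mask_prog ;; count_prog ;; cost_prog ;; table_prog ;; final_prog) ?st
     (50 * l + 50 * 2 ^ l + 50 * (l * m) + row * (2 ^ l * (160 * m + 250) + 210 * 3 ^ l) +
      l * (2 ^ l * row * (100 * n + 400) + 150) + 450) outcome"
  proof (rule runs_Seq[OF runs_frame[OF runs_masks[OF inp0 zero(2)]], of _ "50 * 2 ^ l + 50 + (50 * (l * m) + 50 + (?T3 + ?T4))"])
    fix st1 assume a1: "(nmem st1 ''p'' 0 = 2 ^ l \<and> marks l st1) \<and> frame mask_prog ?st st1"
    then have fr1: "frame mask_prog ?st st1" by simp
    have inp1: "inp st1" by (rule inp_frame[OF inp0 fr1]) simp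
    have k1: "rmem st1 y = (\<lambda>_. 0)" for y using frame_rmem[OF fr1, of y] zero(1) by simp
    have z1: "nmem st1 ''cnt'' = (\<lambda>_. 0)" "nmem st1 ''ch'' = (\<lambda>_. 0)" "nmem st1 ''path'' = (\<lambda>_. 0)" "nmem st1 ''feasible'' = (\<lambda>_. 0)"
      using frame_nmem[OF fr1] zero by simp_all
    have c1: "nmem st1 ''p'' 0 = 2 ^ l" "nmem st1 ''cnt'' 0 = 0" using a1 z1 by simp_all
    show "runs cost W (count_prog ;; cost_prog ;; table_prog ;; final_prog) st1
      (50 * 2 ^ l + 50 + (50 * (l * m) + 50 + (?T3 + ?T4))) outcome"
    proof (rule runs_Seq[OF runs_frame[OF runs_count[OF c1]] _ order_refl])
      fix st2 assume a2: "counted st2 \<and> frame count_prog st1 st2"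
      then have fr2: "frame count_prog st1 st2" by simp
      have inp2: "inp st2" by (rule inp_frame[OF inp1 fr2]) simp
      have k2: "rmem st2 y = (\<lambda>_. 0)" for y using frame_rmem[OF fr2, of y] k1 by simp
      have z2: "nmem st2 ''ch'' = (\<lambda>_. 0)" "nmem st2 ''path'' = (\<lambda>_. 0)" "nmem st2 ''feasible'' = (\<lambda>_. 0)"
        "nmem st2 ''p'' 0 = 2 ^ l" "nmem st2 ''tv'' = nmem st1 ''tv''"
        using frame_nmem[OF fr2] z1 c1 by simp_all
      show "runs cost W (cost_prog ;; table_prog ;; final_prog) st2 (50 * (l * m) + 50 + (?T3 + ?T4)) outcome"
      proof (rule runs_Seq[OF runs_frame[OF runs_cost[OF inp2 k2]] _ order_refl])
        fix st3 assume a3: "summed st3 \<and> frame cost_prog st2 st3"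
        then have fr3: "frame cost_prog st2 st3" by simp
        have inp3: "inp st3" by (rule inp_frame[OF inp2 fr3]) simp
        have k3: "rmem st3 ''zero'' = (\<lambda>_. 0)" "rmem st3 ''value'' = (\<lambda>_. 0)" using frame_rmem[OF fr3] k2 by simp_all
        have z3: "nmem st3 ''ch'' = (\<lambda>_. 0)" "nmem st3 ''path'' = (\<lambda>_. 0)" "nmem st3 ''feasible'' = (\<lambda>_. 0)"
          "nmem st3 ''p'' 0 = 2 ^ l" "nmem st3 ''tv'' = nmem st1 ''tv''" "nmem st3 ''cnt'' = nmem st2 ''cnt''"
          using frame_nmem[OF fr3] z2 by simp_all
        have s3: "counted st3" "marks l st3" "summed st3" "rmem st3 ''zero'' 0 = 0"
          using a1 a2 a3 z3 k3 by (simp_all add: counted_def marks_def)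
        show "runs cost W (table_prog ;; final_prog) st3 (?T3 + ?T4) outcome"
        proof (rule runs_Seq[OF runs_frame[OF runs_table[OF inp3 s3(1,3,2,4) z3(4,1)]] _ order_refl])
          fix st4 assume a4: "tabled st4 \<and> frame table_prog st3 st4"
          then have fr4: "frame table_prog st3 st4" by simp
          have inp4: "inp st4" by (rule inp_frame[OF inp3 fr4]) simp
          have z4: "rmem st4 ''value'' = (\<lambda>_. 0)" "nmem st4 ''path'' = (\<lambda>_. 0)" "nmem st4 ''feasible'' = (\<lambda>_. 0)"
            using frame_nmem[OF fr4] frame_rmem[OF fr4] z3 k3 by simp_all
          show "runs cost W final_prog st4 ?T4 outcome"
            by (rule runs_final) (use inp4 a4 z4 in simp_all)
        qed
      qed
    qed
  qed simp
qed

end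

text \<open>The first bound makes \<open>T\<close> an admissible word bound, the second one a time
  bound. Everything is measured in the unit \<open>B\<close>: \<open>row\<close> accounts for two
  factors \<open>graph_size G\<close>, one more comes from \<open>m\<close> or \<open>n\<close>. The
  running time adds up to 3990 units, and 10000 is a round number above it.\<close>

lemma (in numbered_arena) potential_bounds:
  defines "T \<equiv> 10000 * 3 ^ l * graph_size G ^ 3"
  shows "2 ^ l * row + (l + 1) * (m + n + 1) + 2 ^ l + m + 10 \<le> T"
    and "50 * l + 50 * 2 ^ l + 50 * (l * m) + row * (2 ^ l * (160 * m + 250) + 210 * 3 ^ l) +
      l * (2 ^ l * row * (100 * n + 400) + 150) + 450 \<le> T"
proof -
  let ?E = "3 ^ l :: nat" and ?g = "graph_size G"
  define B where "B = ?E * (?g * ?g * ?g)"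
  have T: "T = 10000 * B" by (simp add: T_def B_def power3_eq_cube)
  have g: "n \<le> ?g" "m \<le> ?g" "1 \<le> ?g" using n_pos by (simp_all add: graph_size_def)
  have E: "2 ^ l \<le> ?E" "l + 1 \<le> ?E" "1 \<le> ?E" "l * 2 ^ l \<le> 2 * ?E"
    using less_three_power[of l] mult_two_power_le[of l] by (simp_all add: power_mono)
  have "(n + 1) * n \<le> (2 * ?g) * ?g" using g by (intro mult_le_mono) auto
  then have row: "row \<le> 2 * (?g * ?g)" by (simp add: row_def)
  have gg: "1 \<le> ?g * ?g" "?g \<le> ?g * ?g * ?g" "?g * ?g \<le> ?g * ?g * ?g" "1 \<le> ?g * ?g * ?g"
    using g(3) by (simp_all add: Suc_le_eq)
  have EB: "?E * x \<le> B" if "x \<le> ?g * ?g * ?g" for x unfolding B_def using that by (rule mult_le_mono2)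
  have B1: "1 \<le> B" "?E \<le> B" "?E * ?g \<le> B" "?E * (?g * ?g) \<le> B"
    using EB[of 1] EB[of ?g] EB[of "?g * ?g"] gg le_trans[OF E(3)] by simp_all
  have 1: "2 ^ l * row \<le> 2 * B"
    using mult_le_mono[OF E(1) row] B1(4) by (simp add: algebra_simps)
  have "(l + 1) * (m + n + 1) \<le> ?E * (3 * ?g)" using E(2) g by (intro mult_le_mono) auto
  then have 2: "(l + 1) * (m + n + 1) \<le> 3 * B" using B1(3) by linarith
  have 3: "2 ^ l \<le> B" using E(1) B1(2) by linarith
  have "m \<le> ?E * ?g" using mult_le_mono[OF E(3) g(2)] by simp
  then have 4: "m \<le> B" using B1(3) by linarith
  show "2 ^ l * row + (l + 1) * (m + n + 1) + 2 ^ l + m + 10 \<le> T"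
    unfolding T using 1 2 3 4 B1(1) by linarith
  have 5: "l \<le> B" using E(2) B1(2) by linarith
  have "l * m \<le> ?E * ?g" using E(2) g(2) by (intro mult_le_mono) auto
  then have 6: "l * m \<le> B" using B1(3) by linarith
  have "2 ^ l * (160 * m + 250) + 210 * 3 ^ l \<le> ?E * (410 * ?g) + 210 * ?E * ?g"
  proof (rule add_mono)
    show "2 ^ l * (160 * m + 250) \<le> ?E * (410 * ?g)" using E(1) g by (intro mult_le_mono) auto
    show "210 * 3 ^ l \<le> 210 * ?E * ?g" using g(3) by simp
  qed
  also have "\<dots> = 620 * (?E * ?g)" by simp
  finally have "row * (2 ^ l * (160 * m + 250) + 210 * 3 ^ l) \<le> (2 * (?g * ?g)) * (620 * (?E * ?g))"
    using row by (intro mult_le_mono)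
  also have "\<dots> = 1240 * B" by (simp add: B_def)
  finally have 7: "row * (2 ^ l * (160 * m + 250) + 210 * 3 ^ l) \<le> 1240 * B" .
  \<comment> \<open>Here the factor \<open>l\<close> for reading off all paths is traded against the
    gap between \<open>2 ^ l\<close> and \<open>3 ^ l\<close>.\<close>
  have "(l * 2 ^ l) * (row * (100 * n + 400)) \<le> (2 * ?E) * ((2 * (?g * ?g)) * (500 * ?g))"
    using g by (intro mult_le_mono[OF E(4) mult_le_mono[OF row]]) auto
  also have "\<dots> = 2000 * B" by (simp add: B_def)
  finally have 8: "l * (2 ^ l * row * (100 * n + 400) + 150) \<le> 2150 * B"
    using 5 by (simp add: algebra_simps)
  show "50 * l + 50 * 2 ^ l + 50 * (l * m) + row * (2 ^ l * (160 * m + 250) + 210 * 3 ^ l) +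
      l * (2 ^ l * row * (100 * n + 400) + 150) + 450 \<le> T"
    unfolding T using 3 5 6 7 8 B1(1) by linarith
qed

theorem theorem3p3:
  shows "\<exists>(prog :: com) (a :: nat) (d :: nat).
    \<forall>(G :: (nat, nat) pre_digraph) (r :: nat) (terms :: nat list) (cost :: nat \<Rightarrow> nat \<Rightarrow> real).
      arena G r terms cost \<and> numbered G \<longrightarrow>
      (let T = a * 3 ^ length terms * graph_size G ^ d in
        \<exists>t st. exec cost T prog (input_state G r terms) t st \<and> t \<le> T \<and>
          arena.is_min_potential G r terms cost (output_value st) \<and>
          (arena.profiles G r terms \<noteq> {} \<longrightarrow>
            arena.optimal_profile G r terms cost
              (output_profile (card (verts G)) (length terms) st)))"
proof (rule exI[of _ potential_prog], rule exI[of _ 10000], rule exI[of _ 3], intro allI impI)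
  fix G :: "(nat, nat) pre_digraph" and r :: nat and terms :: "nat list" and cost :: "nat \<Rightarrow> nat \<Rightarrow> real"
  assume a: "arena G r terms cost \<and> numbered G"
  let ?T = "10000 * 3 ^ length terms * graph_size G ^ 3"
  interpret numbered_arena G r terms cost
    using a by (simp add: numbered_arena_def numbered_arena_axioms_def)
  interpret machine_run G r terms cost ?T
    by unfold_locales (rule potential_bounds(1))
  have "runs cost ?T potential_prog (input_state G r terms) ?T outcome"
    by (rule runs_weaken[OF runs_potential potential_bounds(2)])
  then show "let T = 10000 * 3 ^ length terms * graph_size G ^ 3 in
        \<exists>t st. exec cost T potential_prog (input_state G r terms) t st \<and> t \<le> T \<and>
          arena.is_min_potential G r terms cost (output_value st) \<and>
          (arena.profiles G r terms \<noteq> {} \<longrightarrow>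
            arena.optimal_profile G r terms cost
              (output_profile (card (verts G)) (length terms) st))"
    unfolding Let_def runs_def outcome_def by blast
qed

end
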